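(* Let $\boldsymbol{S}$ be a regular $m$-tier strip of length $n$ having at least one Kekulé structure, with associated poset $\mathcal{S}$. Then the Zhang-Zhang polynomial of $\boldsymbol{S}$ is $$\mathrm{ZZ}(\boldsymbol{S},x)=\sum_{k=0}^{|\mathcal{S}|}\ \sum_{w\in\mathcal{L}(\mathcal{S})}\binom{|\mathcal{S}|-\mathrm{fix}_{\mathcal{S}}(w)}{k-\mathrm{fix}_{\mathcal{S}}(w)}\binom{n+\mathrm{des}(w)}{k}(1+x)^k,$$ where $\mathrm{des}(w)$ and $\mathrm{fix}_{\mathcal{S}}(w)$ denote the number of descents and the number of fixed labels, respectively, in the linear extension $w\in\mathcal{L}(\mathcal{S})$.
   Context: Geometry. Let $L$ be the infinite hexagonal lattice, drawn so that some of its edges are vertical. A benzenoid is a finite subgraph of $L$ consisting of all vertices and edges lying on or inside a cycle of $L$. A regular 1-tier strip of length $n$ consists of $n$ adjacent hexagons in the same horizontal row of $L$. A regular $m$-tier strip $\boldsymbol{S}$ of length $n$ is obtained by merging $m$ consecutive regular 1-tier strips located in adjacent rows of $L$ (numbered $1,\dots,m$ from top to bottom) such that (i) adjacent strips differ at each end (left and right) by $\pm\frac12$ hexagon unit, and (ii) the top and bottom 1-tier strips both have length $n$. Interfaces and fragments. For $k=1,\dots,m$ the interface $i_k$ is the set of vertical edges of the hexagons in row $k$; put $i_0=i_{m+1}=\varnothing$. The fragment $f_k$ ($1\le k\le m+1$) is the set of edges (and vertices) lying at least partially between the horizontal lines $P_{k-1}$ and $P_k$, where $P_k$ ($1\le k\le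 m$) is the horizontal line through the midpoints of the edges of $i_k$, $P_0$ lies above $\boldsymbol{S}$ and $P_{m+1}$ below $\boldsymbol{S}$. The interface bonds of $f_k$ are the elements of $i_{k-1}\cup i_k$, ordered from left to right by horizontal position; the first one is the leftmost. Poset $\mathcal{S}$. Put $\mathrm{ord}(i_k)=|i_k|-n$ (non-negative when $\boldsymbol{S}$ has a Kekulé structure). The poset is $\mathcal{S}=\{s_{k,j}: 1\le k\le m,\ 1\le j\le \mathrm{ord}(i_k)\}$ with strict order $<_{\mathcal{S}}$ generated (by transitive closure) by the cover relations: $s_{k,j}\lessdot_{\mathcal{S}}s_{k',j'}$ if and only if $|k'-k|=1$ and, with $\kappa=\max(k,k')$, $j'-j=0$ when the first interface bond of $f_\kappa$ belongs to $i_k$, and $j'-j=1$ when the first interface bond of $f_\kappa$ belongs to $i_{k'}$. Clar covers. A Clar cover of $\boldsymbol{S}$ is a spanning subgraph every connected component of which is isomorphic to $K_2$ or to the cycle $C_6$; its order is the number of $C_6$ components. A Kekulé structure is a Clar cover of order $0$. If $c_k$ is the number of Clar covers of order $k$ and $Cl$ is the maximal order, then $\mathrm{ZZ}(\boldsymbol{S},x)=\sum_{k=0}^{Cl}c_kx^k$. Linear extensions. For a finite poset $P$ with $p$ elements fix a natural labeling, i.e. an order-preserving bijection $\omega:P\to\{1,\dots,p\}$. A linear extension of $P$ is an order-preserving bijection $\sigma:P\to\{1<2<\dots<p\}$, represented by the sequence $w=w_1w_2\cdots w_p$ with $w_i=\omega(\sigma^{-1}(i))$; $\mathcal{L}(P)$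 is the set of all such $w$. An index $i$ with $w_i>w_{i+1}$ is a descent of $w$; $\mathrm{des}(w)$ is the number of descents. A label $w_i$ is fixed in $w$ if at least one of the following holds: (1) $i-1$ or $i$ is a descent of $w$; or (2) the sets $L(w_i)=\{l: l<i,\ w_l>w_i\}$ and $J(w_i)=\{j: \omega^{-1}(w_j)<_P\omega^{-1}(w_i)\}$ satisfy $L(w_i)\neq\varnothing$ and $\max L(w_i)>\max J(w_i)$ (with $\max\varnothing=0$). $\mathrm{fix}_P(w)$ is the number of fixed labels of $w$. A binomial coefficient with negative lower index is $0$. *)

theory Defs
  imports "HOL-Computational_Algebra.Polynomial" "Graph_Theory.Graph_Theory"
begin

section \<open>Clar covers and the Zhang-Zhang polynomial\<close>

text \<open>
  As in \<^theory>\<open>Graph_Theory.Digraph\<close>, an undirected graph is a symmetric digraph; the strongly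
  connected components of such a graph are its connected components.
\<close>

definition cycle6 :: "nat pair_pre_digraph" where
  "cycle6 = \<lparr> pverts = {..<6},
     parcs = {(i, j). i < 6 \<and> j < 6 \<and> (j = Suc i mod 6 \<or> i = Suc j mod 6)} \<rparr>"

definition is_C6 :: "('a, 'b) pre_digraph \<Rightarrow> bool" where
  "is_C6 C \<longleftrightarrow> digraph_iso (with_proj cycle6) C"

text \<open>\<^const>\<open>complete_digraph\<close> is the library's predicate for being isomorphic to a complete graph.\<close>

definition clar_cover :: "'a pair_pre_digraph \<Rightarrow> 'a pair_pre_digraph \<Rightarrow> bool" where
  "clar_cover G K \<longleftrightarrow>
     spanning (with_proj K) (with_proj G) \<and> symmetric (with_proj K) \<and>
     (\<forall>C \<in> pre_digraph.sccs (with_proj K). complete_digraph 2 C \<or> is_C6 C)"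

definition clar_order :: "'a pair_pre_digraph \<Rightarrow> nat" where
  "clar_order K = card {C \<in> pre_digraph.sccs (with_proj K). is_C6 C}"

definition kekule_structure :: "'a pair_pre_digraph \<Rightarrow> 'a pair_pre_digraph \<Rightarrow> bool" where
  "kekule_structure G K \<longleftrightarrow> clar_cover G K \<and> clar_order K = 0"

definition num_clar_covers :: "'a pair_pre_digraph \<Rightarrow> nat \<Rightarrow> nat" where
  "num_clar_covers G k = card {K. clar_cover G K \<and> clar_order K = k}"

definition clar_number :: "'a pair_pre_digraph \<Rightarrow> nat" where
  "clar_number G = Max {clar_order K | K. clar_cover G K}"

definition zz_poly :: "'a pair_pre_digraph \<Rightarrow> int poly" where
  "zz_poly G = (\<Sum>k = 0..clar_number G. monom (int (num_clar_covers G k)) k)"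


section \<open>The hexagonal lattice and regular strips\<close>

text \<open>
  Vertex \<open>(a, b)\<close> has horizontal position \<open>a\<close>, measured in half hexagon widths, and lies on the
  horizontal zigzag chain number \<open>b\<close>, chains being numbered from top to bottom. The vertical edges
  join \<open>(a, b)\<close> to \<open>(a, b + 1)\<close> for even \<open>a + b\<close>.
\<close>

type_synonym vertex = "int \<times> int"

definition hex_lattice :: "vertex pair_pre_digraph" where
  "hex_lattice = \<lparr> pverts = UNIV,
     parcs = {((a, b), (c, d)).
        (b = d \<and> \<bar>a - c\<bar> = 1) \<or> (a = c \<and> \<bar>b - d\<bar> = 1 \<and> even (a + min b d))} \<rparr>"

text \<open>
  For even \<open>a + k\<close>, the pair \<open>(a, k)\<close> also denotes the hexagon between the chains \<open>k\<close> and \<open>k + 1\<close>,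
  that is, in row \<open>k\<close> of the lattice, whose left vertical edge is at horizontal position \<open>a\<close> and
  whose right one is at \<open>a + 2\<close>.
\<close>

type_synonym hexagon = "int \<times> int"

definition hexagon_verts :: "hexagon \<Rightarrow> vertex set" where
  "hexagon_verts h = {fst h .. fst h + 2} \<times> {snd h .. snd h + 1}"

definition hexagons_graph :: "hexagon set \<Rightarrow> vertex pair_pre_digraph" where
  "hexagons_graph H = \<lparr> pverts = (\<Union>h\<in>H. hexagon_verts h),
     parcs = {(u, v) \<in> parcs hex_lattice. \<exists>h\<in>H. u \<in> hexagon_verts h \<and> v \<in> hexagon_verts h} \<rparr>"

definition one_tier_strip :: "int \<Rightarrow> int \<Rightarrow> nat \<Rightarrow> hexagon set" where
  "one_tier_strip k a len = {(a + 2 * int j, k) | j. j < len}"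

text \<open>
  A strip is given by its set of hexagons; coordinates are chosen such that its tiers
  \<open>1, \<dots>, m\<close> are in the rows \<open>1, \<dots>, m\<close> of the lattice.
\<close>

definition regular_strip :: "nat \<Rightarrow> nat \<Rightarrow> hexagon set \<Rightarrow> bool" where
  "regular_strip m n H \<longleftrightarrow> 1 \<le> m \<and>
     (\<exists>(left :: nat \<Rightarrow> int) (len :: nat \<Rightarrow> nat).
        let right = (\<lambda>k. left k + 2 * int (len k)) in
        (\<forall>k\<in>{1..m}. 1 \<le> len k \<and> even (left k + int k)) \<and>
        (\<forall>k\<in>{1..<m}. \<bar>left (k + 1) - left k\<bar> = 1 \<and> \<bar>right (k + 1) - right k\<bar> = 1) \<and>
        len 1 = n \<and> len m = n \<and>
        H = (\<Union>k\<in>{1..m}. one_tier_strip (int k) (left k) (len k)))"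


section \<open>Interfaces and the poset of a strip\<close>

text \<open>A vertical edge is represented by its downward arc.\<close>

definition interface :: "hexagon set \<Rightarrow> nat \<Rightarrow> (vertex \<times> vertex) set" where
  "interface H k =
     {((c, int k), (c, int k + 1)) | c. \<exists>a. (a, int k) \<in> H \<and> (c = a \<or> c = a + 2)}"

text \<open>
  The interface bonds of the fragment $f_k$ with \<open>1 \<le> k \<le> m + 1\<close>; the interfaces \<open>0\<close> and \<open>m + 1\<close>
  are empty because a strip has no hexagons in these rows.
\<close>

definition interface_bonds :: "hexagon set \<Rightarrow> nat \<Rightarrow> (vertex \<times> vertex) set" where
  "interface_bonds H k = interface H (k - 1) \<union> interface H k"

definition horizontal_pos :: "vertex \<times> vertex \<Rightarrow> int" where
  "horizontal_pos e = fst (fst e)"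

definition first_interface_bond :: "hexagon set \<Rightarrow> nat \<Rightarrow> vertex \<times> vertex" where
  "first_interface_bond H k = arg_min_on horizontal_pos (interface_bonds H k)"

definition interface_ord :: "nat \<Rightarrow> hexagon set \<Rightarrow> nat \<Rightarrow> int" where
  "interface_ord n H k = int (card (interface H k)) - int n"

text \<open>The pair \<open>(k, j)\<close> stands for the poset element $s_{k,j}$.\<close>

definition strip_poset :: "nat \<Rightarrow> nat \<Rightarrow> hexagon set \<Rightarrow> (nat \<times> nat) set" where
  "strip_poset m n H = {(k, j). 1 \<le> k \<and> k \<le> m \<and> 1 \<le> j \<and> int j \<le> interface_ord n H k}"

definition strip_covers :: "nat \<Rightarrow> nat \<Rightarrow> hexagon set \<Rightarrow> ((nat \<times> nat) \<times> (nat \<times> nat)) set" where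
  "strip_covers m n H =
     {((k, j), (k', j')).
        (k, j) \<in> strip_poset m n H \<and> (k', j') \<in> strip_poset m n H \<and>
        \<bar>int k' - int k\<bar> = 1 \<and>
        (let e = first_interface_bond H (max k k') in
           (e \<in> interface H k \<and> int j' - int j = 0) \<or>
           (e \<in> interface H k' \<and> int j' - int j = 1))}"

definition strip_less :: "nat \<Rightarrow> nat \<Rightarrow> hexagon set \<Rightarrow> ((nat \<times> nat) \<times> (nat \<times> nat)) set" where
  "strip_less m n H = (strip_covers m n H)\<^sup>+"


section \<open>Linear extensions\<close>

text \<open>
  A finite poset is given by its carrier \<open>P\<close> and its strict order \<open>r\<close>. Positions \<open>i\<close> in a word are
  counted from \<open>1\<close>.
\<close>

definition order_pres_bij :: "'a set \<Rightarrow> 'a rel \<Rightarrow> ('a \<Rightarrow> nat) \<Rightarrow> bool" where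
  "order_pres_bij P r f \<longleftrightarrow>
     bij_betw f P {1..card P} \<and> (\<forall>x\<in>P. \<forall>y\<in>P. (x, y) \<in> r \<longrightarrow> f x < f y)"

definition linext_words :: "'a set \<Rightarrow> 'a rel \<Rightarrow> ('a \<Rightarrow> nat) \<Rightarrow> nat list set" where
  "linext_words P r \<omega> =
     {map (\<lambda>i. \<omega> (inv_into P \<sigma> i)) [1..<card P + 1] | \<sigma>. order_pres_bij P r \<sigma>}"

definition letter :: "nat list \<Rightarrow> nat \<Rightarrow> nat" where
  "letter w i = w ! (i - 1)"

definition descents :: "nat list \<Rightarrow> nat set" where
  "descents w = {i. 1 \<le> i \<and> i < length w \<and> letter w i > letter w (i + 1)}"

definition des :: "nat list \<Rightarrow> nat" where
  "des w = card (descents w)"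

definition larger_before :: "nat list \<Rightarrow> nat \<Rightarrow> nat set" where
  "larger_before w i = {l. 1 \<le> l \<and> l < i \<and> letter w l > letter w i}"

definition poset_before :: "'a set \<Rightarrow> 'a rel \<Rightarrow> ('a \<Rightarrow> nat) \<Rightarrow> nat list \<Rightarrow> nat \<Rightarrow> nat set" where
  "poset_before P r \<omega> w i =
     {j. 1 \<le> j \<and> j \<le> length w \<and>
         (inv_into P \<omega> (letter w j), inv_into P \<omega> (letter w i)) \<in> r}"

definition max0 :: "nat set \<Rightarrow> nat" where
  "max0 A = (if A = {} then 0 else Max A)"

definition fixed_at :: "'a set \<Rightarrow> 'a rel \<Rightarrow> ('a \<Rightarrow> nat) \<Rightarrow> nat list \<Rightarrow> nat \<Rightarrow> bool" where
  "fixed_at P r \<omega> w i \<longleftrightarrow>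
     i - 1 \<in> descents w \<or> i \<in> descents w \<or>
     (larger_before w i \<noteq> {} \<and> max0 (larger_before w i) > max0 (poset_before P r \<omega> w i))"

definition fix_count :: "'a set \<Rightarrow> 'a rel \<Rightarrow> ('a \<Rightarrow> nat) \<Rightarrow> nat list \<Rightarrow> nat" where
  "fix_count P r \<omega> w = card {letter w i | i. 1 \<le> i \<and> i \<le> length w \<and> fixed_at P r \<omega> w i}"

text \<open>The lower index is an integer, since \<open>k - fix_count P r \<omega> w\<close> can be negative.\<close>

definition binom :: "nat \<Rightarrow> int \<Rightarrow> nat" where
  "binom a b = (if b < 0 then 0 else a choose nat b)"

end

theory Submission
  imports Defs
begin

text \<open>
  Both sides count order-preserving maps from the poset $P$ of the strip to $\{0,\dots,n\}$, each
  weighted by a power of $1 + x$.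

  \<^emph>\<open>From Clar covers to matchings.\<close> Fix one of the two perfect matchings of a hexagon, its sextet.
  Replacing every hexagon of a Clar cover by its sextet gives a perfect matching $M$; conversely any
  set of sextets contained in $M$ can be turned back into hexagons, because two sextets of the same kind
  inside one matching are disjoint. Hence the Zhang-Zhang polynomial is
  $\sum_M (1+x)^{s(M)}$, where $s(M)$ is the number of sextets in $M$ (\<open>zz_poly_matchings\<close>).
  The geometric input is that the only 6-cycles of the lattice are its hexagons (\<open>hexagon_of_cycle\<close>).

  \<^emph>\<open>From matchings to order-preserving maps.\<close> A perfect matching is determined by its vertical
  edges. Walking along a horizontal zigzag chain, the vertical edges of the matching below and above
  the chain must alternate, starting and ending with the kind of edge that the chain itself starts and
  ends with; conversely every alternating choice extends uniquely to the chain
  (\<open>matching_drift\<close>, \<open>match_of_matching\<close>). So row $k$ contains exactly $\mathrm{ord}(i_k)$ matched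
  vertical edges. If the $j$-th of them is preceded by $g(k,j)$ unmatched ones, then alternation says
  precisely that $g$ is order preserving on $P$ (\<open>chain_ok_iff_drift\<close>). A sextet is a matched vertical
  edge that can be moved one hexagon to the left, which means that $g$ can be lowered by one there: $g$
  is positive and exceeds its values at all smaller elements (\<open>sextet_iff_rise\<close>). These
  elements of $P$ are the \<open>rises\<close> of $g$.

  \<^emph>\<open>From order-preserving maps to words.\<close> A map $g$ is determined by its restriction to its set
  $Q$ of rises, which can be any strictly order-preserving map $Q \to \{1,\dots,n\}$
  (\<open>card_weak_maps_rises\<close>). Sorting $Q$ by the values of such a map, and equal values by decreasing
  labels, gives a linear extension $u$ of $Q$ and shows that there are
  $\sum_u \binom{n + \mathrm{des}(u)}{|Q|}$ of them (\<open>card_strict_maps\<close>). Finally, deleting the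
  letters outside $Q$ is a descent-preserving bijection from the linear extensions of $P$ whose fixed
  labels all lie in $Q$ onto the linear extensions of $Q$ (\<open>sum_loose_words\<close>): a label that
  is not fixed stands at the only place into which it can be inserted as a non-fixed label. Summing over
  $Q$ of size $k$, a word $w$ occurs once for every $Q$ containing its fixed labels, that
  is $\binom{|P| - \mathrm{fix}(w)}{k - \mathrm{fix}(w)}$ times (\<open>sum_weak_maps\<close>).
\<close>

section \<open>Descents and loose letters\<close>

fun des_rec :: "nat list \<Rightarrow> nat" where
  "des_rec (x # y # zs) = (if x > y then 1 else 0) + des_rec (y # zs)"
| "des_rec _ = 0"

lemma des_rec_append:
  "us \<noteq> [] \<Longrightarrow> vs \<noteq> [] \<Longrightarrow>
     des_rec (us @ vs) = des_rec us + des_rec vs + (if last us > hd vs then 1 else 0)"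
proof (induction us rule: des_rec.induct)
  case ("2_2" x)
  then show ?case by (cases vs) auto
qed auto

lemma descents_Cons_Cons:
  "descents (x # y # zs) = (if x > y then {1} else {}) \<union> Suc ` descents (y # zs)"
proof (rule set_eqI)
  fix i
  show "i \<in> descents (x # y # zs) \<longleftrightarrow>
      i \<in> (if x > y then {1} else {}) \<union> Suc ` descents (y # zs)"
  proof (cases i)
    case 0
    then show ?thesis by (auto simp: descents_def)
  next
    case (Suc j)
    then show ?thesis
      by (cases j) (auto simp: descents_def letter_def image_iff)
  qed
qed

lemma des_eq_des_rec: "des w = des_rec w"
proof (induction w rule: des_rec.induct)
  case (1 x y zs)
  have fin: "finite (descents (y # zs))"
    by (rule finite_subset[of _ "{..length (y # zs)}"]) (auto simp: descents_def)
  have "0 \<notin> descents (y # zs)" by (auto simp: descents_def)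
  then have "card (descents (x # y # zs))
      = (if x > y then 1 else 0) + card (Suc ` descents (y # zs))"
    unfolding descents_Cons_Cons by (subst card_Un_disjoint) (use fin in auto)
  then show ?case using 1 by (simp add: des_def card_image)
qed (auto simp: des_def descents_def)

text \<open>
  The linear extensions of a naturally labelled poset, as words. Labels themselves serve as the
  elements of the poset, so that restriction to a set of labels \<open>A\<close> needs no relabelling.
\<close>

definition linexts :: "nat rel \<Rightarrow> nat set \<Rightarrow> nat list set" where
  "linexts R A = {w. distinct w \<and> set w = A \<and> sorted_wrt (\<lambda>x y. (y, x) \<notin> R) w}"

text \<open>
  A label is loose if it is not fixed: everything between its last predecessor and itself is smaller, and
  what follows is larger. As predecessors have smaller labels as well, the prefix \<open>us1\<close> may end at any of
  them.
\<close>

definition loose :: "nat rel \<Rightarrow> nat list \<Rightarrow> nat \<Rightarrow> bool" where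
  "loose R w x \<longleftrightarrow> (\<exists>us1 us2 vs. w = us1 @ us2 @ x # vs \<and> (\<forall>z\<in>set us2. z < x) \<and>
     (us1 = [] \<or> (last us1, x) \<in> R) \<and> (vs = [] \<or> x < hd vs))"

definition loose_words :: "nat rel \<Rightarrow> nat set \<Rightarrow> nat set \<Rightarrow> nat list set" where
  "loose_words R A Q = {w \<in> linexts R A. \<forall>x\<in>A - Q. loose R w x}"

lemma finite_linexts: "finite A \<Longrightarrow> finite (linexts R A)"
proof (rule finite_subset)
  show "linexts R A \<subseteq> {w. set w \<subseteq> A \<and> length w = card A}"
    by (auto simp: linexts_def distinct_card)
qed (auto intro: finite_lists_length_eq)

lemma distinct_split_unique:
  assumes "us @ x # vs = us' @ x # vs'" "distinct (us @ x # vs)"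
  shows "us = us' \<and> vs = vs'"
  using assms
proof (induction us arbitrary: us')
  case Nil
  then show ?case by (cases us') auto
next
  case (Cons a us)
  then show ?case by (cases us') auto
qed

lemma looseE:
  assumes "loose R (us @ x # vs) x" "distinct (us @ x # vs)"
  obtains us1 us2 where "us = us1 @ us2" "\<forall>z\<in>set us2. z < x"
    "us1 = [] \<or> (last us1, x) \<in> R" "vs = [] \<or> x < hd vs"
proof -
  obtain us1 us2 vs' where *: "us @ x # vs = us1 @ us2 @ x # vs'" "\<forall>z\<in>set us2. z < x"
    "us1 = [] \<or> (last us1, x) \<in> R" "vs' = [] \<or> x < hd vs'"
    using assms(1) by (auto simp: loose_def)
  then have "us @ x # vs = (us1 @ us2) @ x # vs'" by simp
  from distinct_split_unique[OF this assms(2)] show thesis using that * by metis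
qed

lemma looseI:
  assumes "us = us1 @ us2" "\<forall>z\<in>set us2. z < x"
    "us1 = [] \<or> (last us1, x) \<in> R" "vs = [] \<or> x < hd vs"
  shows "loose R (us @ x # vs) x"
  using assms unfolding loose_def by fastforce

locale natural_order =
  fixes R :: "nat rel"
  assumes R_trans: "trans R" and R_less: "(x, y) \<in> R \<Longrightarrow> x < y"
begin

text \<open>
  The largest label \<open>y\<close> outside \<open>Q\<close> can be removed without spoiling the looseness of the others:
  these are smaller, so \<open>y\<close> is neither in the stretch of smaller labels before a loose \<open>x\<close> nor the
  reason why \<open>x\<close> has a larger successor, as \<open>y\<close> is itself followed by something larger.
\<close>

lemma loose_words_delete:
  assumes w: "us @ y # vs \<in> loose_words R A Q" and y: "y \<in> A - Q" "\<forall>x\<in>A - Q. x \<le> y"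
  shows "us @ vs \<in> loose_words R (A - {y}) Q"
proof -
  from w have d: "distinct (us @ y # vs)" and s: "set (us @ y # vs) = A"
    and sw: "sorted_wrt (\<lambda>x y. (y, x) \<notin> R) (us @ y # vs)"
    and L: "\<And>x. x \<in> A - Q \<Longrightarrow> loose R (us @ y # vs) x"
    by (auto simp: loose_words_def linexts_def)
  have lin: "us @ vs \<in> linexts R (A - {y})"
    using d s sw by (auto simp: linexts_def sorted_wrt_append)
  obtain vy: "vs = [] \<or> y < hd vs"
    using L[OF y(1)] d by (elim looseE) auto
  have "loose R (us @ vs) x" if x: "x \<in> A - {y} - Q" for x
  proof -
    have xy: "x < y" using y x by force
    have Lx: "loose R (us @ y # vs) x" using L x by auto
    from x s consider "x \<in> set us" | "x \<in> set vs" by auto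
    then show ?thesis
    proof cases
      case 1
      then obtain a b where ab: "us = a @ x # b" by (meson split_list)
      from Lx d ab have "loose R (a @ x # (b @ y # vs)) x" "distinct (a @ x # (b @ y # vs))"
        by auto
      then obtain us1 us2 where u: "a = us1 @ us2" "\<forall>z\<in>set us2. z < x"
        "us1 = [] \<or> (last us1, x) \<in> R" "b @ y # vs = [] \<or> x < hd (b @ y # vs)"
        by (rule looseE)
      have "b @ vs = [] \<or> x < hd (b @ vs)" using u(4) vy xy by (cases b) auto
      from looseI[OF u(1-3) this] show ?thesis by (simp add: ab)
    next
      case 2
      then obtain a b where ab: "vs = a @ x # b" by (meson split_list)
      from Lx d ab have "loose R ((us @ y # a) @ x # b) x" "distinct ((us @ y # a) @ x # b)"
        by auto
      then obtain us1 us2 where u: "us @ y # a = us1 @ us2" "\<forall>z\<in>set us2. z < x"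
        "us1 = [] \<or> (last us1, x) \<in> R" "b = [] \<or> x < hd b"
        by (rule looseE)
      have "y \<notin> set us2" using u(2) xy by auto
      with u(1) obtain c where c: "us1 = us @ y # c" "a = c @ us2"
        by (auto simp: append_eq_append_conv2 append_eq_Cons_conv Cons_eq_append_conv)
      have "c \<noteq> []" using u(3) c xy R_less[of y x] by auto
      then have "us @ c = [] \<or> (last (us @ c), x) \<in> R" using u(3) c by auto
      from looseI[OF _ u(2) this u(4), of "us @ a"] show ?thesis by (simp add: ab c)
    qed
  qed
  then show ?thesis using lin by (auto simp: loose_words_def)
qed

text \<open>
  Of two insertion points the later one would have a letter larger than \<open>y\<close> shortly before it, followed
  by a predecessor of \<open>y\<close>; that predecessor would come after the earlier insertion point, which is impossible.
\<close>

lemma loose_insertion_unique: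
  assumes w: "us @ y # vs \<in> linexts R A" "loose R (us @ y # vs) y"
    and w': "us' @ y # vs' \<in> linexts R A" "loose R (us' @ y # vs') y"
    and eq: "us @ vs = us' @ vs'"
  shows "us = us'"
proof -
  have *: False
    if w: "us @ y # vs \<in> linexts R A" "loose R (us @ y # vs) y"
      and w': "us' @ y # vs' \<in> linexts R A" "loose R (us' @ y # vs') y"
      and eq: "us' = us @ z # d" "vs = z # d @ vs'" for us vs us' vs' z d
  proof -
    have dist: "distinct (us @ y # vs)" "distinct (us' @ y # vs')"
      using w w' by (auto simp: linexts_def)
    have yz: "y < z" using looseE[OF w(2) dist(1)] eq by (metis list.distinct(1) list.sel(1))
    obtain us1 us2 where u: "us' = us1 @ us2" "\<forall>z\<in>set us2. z < y"
        "us1 = [] \<or> (last us1, y) \<in> R"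
      using looseE[OF w'(2) dist(2)] by metis
    have "z \<notin> set us2" using u(2) yz by auto
    with u(1) eq(1) obtain c where c: "us1 = us @ z # c" "d = c @ us2"
      by (auto simp: append_eq_append_conv2 append_eq_Cons_conv Cons_eq_append_conv)
    then have "(last us1, y) \<in> R" using u(3) by auto
    moreover have "last us1 \<in> set vs" using c eq by auto
    ultimately show False using w(1) by (auto simp: linexts_def sorted_wrt_append)
  qed
  from eq consider d where "us' = us @ d" "vs = d @ vs'" | d where "us = us' @ d" "vs' = d @ vs"
    by (auto simp: append_eq_append_conv2)
  then show ?thesis
  proof cases
    case 1 then show ?thesis using *[OF w w'] by (cases d) auto
  next
    case 2 then show ?thesis using *[OF w' w] by (cases d) auto
  qed
qed

text \<open>
  The place for \<open>y\<close> is right before the first larger label that follows the last predecessor of \<open>y\<close>.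
\<close>

lemma loose_words_insert:
  assumes w': "w' \<in> loose_words R (A - {y}) Q" and y: "y \<in> A - Q" "\<forall>x\<in>A - Q. x \<le> y"
  obtains us vs where "w' = us @ vs" "us @ y # vs \<in> loose_words R A Q"
proof -
  define pre where "pre = rev (dropWhile (\<lambda>z. (z, y) \<notin> R) (rev w'))"
  define q where "q = rev (takeWhile (\<lambda>z. (z, y) \<notin> R) (rev w'))"
  define us2 where "us2 = takeWhile (\<lambda>z. z < y) q"
  define vs where "vs = dropWhile (\<lambda>z. z < y) q"
  define us where "us = pre @ us2"
  have w'_eq: "w' = pre @ q"
    unfolding pre_def q_def by (metis rev_append rev_rev_ident takeWhile_dropWhile_id)
  have q_eq: "q = us2 @ vs" by (simp add: us2_def vs_def)
  have last_pre: "pre = [] \<or> (last pre, y) \<in> R"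
    unfolding pre_def by (metis hd_dropWhile last_rev rev_is_Nil_conv)
  have q_nopred: "\<forall>z\<in>set q. (z, y) \<notin> R"
    unfolding q_def by (auto dest: set_takeWhileD)
  have us2_less: "\<forall>z\<in>set us2. z < y" unfolding us2_def by (auto dest: set_takeWhileD)
  have hd_vs: "vs = [] \<or> y < hd vs"
  proof (cases "vs = []")
    case False
    then have "\<not> hd vs < y" unfolding vs_def by (metis hd_dropWhile)
    moreover have "hd vs \<noteq> y"
      using False w' w'_eq q_eq by (auto simp: loose_words_def linexts_def)
    ultimately show ?thesis by auto
  qed simp
  from w' have d: "distinct (us @ vs)" and s: "set (us @ vs) = A - {y}"
    and sw: "sorted_wrt (\<lambda>x y. (y, x) \<notin> R) (us @ vs)"
    and L: "\<And>x. x \<in> A - {y} - Q \<Longrightarrow> loose R (us @ vs) x"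
    by (auto simp: loose_words_def linexts_def w'_eq q_eq us_def)
  have d': "distinct (us @ y # vs)" using d s by auto
  have succ_after: "(y, z) \<notin> R" if "z \<in> set us" for z
  proof
    assume yz: "(y, z) \<in> R"
    then have "z \<in> set pre" using that us2_less R_less[OF yz] by (auto simp: us_def)
    then have p: "(last pre, y) \<in> R" "pre \<noteq> []" using last_pre by auto
    then have lz: "(last pre, z) \<in> R" using yz R_trans by (meson transD)
    then have "z \<noteq> last pre" using R_less by blast
    moreover have "pre = butlast pre @ [last pre]" using p by simp
    ultimately have "z \<in> set (butlast pre)"
      using \<open>z \<in> set pre\<close> by (metis Un_iff empty_iff empty_set set_append set_ConsD)
    moreover have "sorted_wrt (\<lambda>x y. (y, x) \<notin> R) (butlast pre @ [last pre])"
      using sw p by (simp add: us_def sorted_wrt_append)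
    ultimately show False using lz by (auto simp: sorted_wrt_append)
  qed
  have lin: "us @ y # vs \<in> linexts R A"
    using d' s sw y succ_after q_nopred q_eq by (auto simp: linexts_def sorted_wrt_append)
  have "loose R (us @ y # vs) x" if x: "x \<in> A - Q" for x
  proof (cases "x = y")
    case True
    then show ?thesis using looseI[OF us_def us2_less last_pre hd_vs] by simp
  next
    case False
    have xy: "x < y" using y x False by force
    have Lx: "loose R (us @ vs) x" using L x False by auto
    from x s False consider "x \<in> set us" | "x \<in> set vs" by auto
    then show ?thesis
    proof cases
      case 1
      then obtain a b where ab: "us = a @ x # b" by (meson split_list)
      from Lx d ab have "loose R (a @ x # (b @ vs)) x" "distinct (a @ x # (b @ vs))"
        by auto
      then obtain us1 us2 where u: "a = us1 @ us2" "\<forall>z\<in>set us2. z < x"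
        "us1 = [] \<or> (last us1, x) \<in> R" "b @ vs = [] \<or> x < hd (b @ vs)"
        by (rule looseE)
      have "b @ y # vs = [] \<or> x < hd (b @ y # vs)" using u(4) xy by (cases b) auto
      from looseI[OF u(1-3) this] show ?thesis by (simp add: ab)
    next
      case 2
      then obtain a b where ab: "vs = a @ x # b" by (meson split_list)
      from Lx d ab have "loose R ((us @ a) @ x # b) x" "distinct ((us @ a) @ x # b)"
        by auto
      then obtain us1 us2 where u: "us @ a = us1 @ us2" "\<forall>z\<in>set us2. z < x"
        "us1 = [] \<or> (last us1, x) \<in> R" "b = [] \<or> x < hd b"
        by (rule looseE)
      have "a \<noteq> []" using hd_vs xy ab by auto
      then have "hd a > y" using hd_vs ab by auto
      then have "hd a \<notin> set us2" using u(2) xy by auto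
      then have na: "\<not> set a \<subseteq> set us2" using \<open>a \<noteq> []\<close> by (meson hd_in_set subsetD)
      obtain c where c: "us1 = us @ c" "a = c @ us2"
        using u(1) na by (auto simp: append_eq_append_conv2)
      then have "c \<noteq> []" using na by auto
      with c have "us @ y # c = [] \<or> (last (us @ y # c), x) \<in> R" using u(3) by auto
      from looseI[OF _ u(2) this u(4), of "us @ y # a"] show ?thesis by (simp add: ab c)
    qed
  qed
  then have "us @ y # vs \<in> loose_words R A Q" using lin by (auto simp: loose_words_def)
  then show thesis using that[of us vs] w'_eq q_eq us_def by simp
qed

lemma des_rec_delete_loose:
  assumes "loose R (us @ y # vs) y" "distinct (us @ y # vs)"
  shows "des_rec (us @ y # vs) = des_rec (us @ vs)"
proof -
  obtain us1 us2 where u: "us = us1 @ us2" "\<forall>z\<in>set us2. z < y"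
        "us1 = [] \<or> (last us1, y) \<in> R" "vs = [] \<or> y < hd vs"
    using assms by (rule looseE)
  have lu: "us = [] \<or> last us < y"
    using u(1-3) R_less by (cases "us2 = []") auto
  have *: "des_rec (y # vs) = des_rec vs" using u(4) by (cases vs) auto
  show ?thesis
  proof (cases "us = [] \<or> vs = []")
    case True
    then show ?thesis using lu * des_rec_append[of us "[y]"] by (cases "us = []") auto
  next
    case False
    then show ?thesis using lu * u(4) by (simp add: des_rec_append)
  qed
qed

lemma bij_remove_largest_loose:
  assumes y: "y \<in> A - Q" "\<forall>x\<in>A - Q. x \<le> y"
  shows "bij_betw (remove1 y) (loose_words R A Q) (loose_words R (A - {y}) Q)"
proof (rule bij_betwI')
  have split: "\<exists>us vs. w = us @ y # vs \<and> remove1 y w = us @ vs \<and> loose R w y \<and> w \<in> linexts R A"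
    if "w \<in> loose_words R A Q" for w
  proof -
    from that y have "y \<in> set w" "distinct w" "loose R w y" "w \<in> linexts R A"
      by (auto simp: loose_words_def linexts_def)
    moreover from this obtain us vs where "w = us @ y # vs" by (meson split_list)
    ultimately show ?thesis by (auto simp: remove1_append)
  qed
  fix w assume w: "w \<in> loose_words R A Q"
  then show "remove1 y w \<in> loose_words R (A - {y}) Q"
    using split[OF w] loose_words_delete[OF _ y] by auto
  fix w' assume w': "w' \<in> loose_words R A Q"
  show "(remove1 y w = remove1 y w') = (w = w')"
  proof
    assume eq: "remove1 y w = remove1 y w'"
    obtain us vs us' vs' where
      *: "w = us @ y # vs" "remove1 y w = us @ vs" "loose R w y" "w \<in> linexts R A"
        "w' = us' @ y # vs'" "remove1 y w' = us' @ vs'" "loose R w' y" "w' \<in> linexts R A"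
      using split[OF w] split[OF w'] by blast
    then have "us = us'" using loose_insertion_unique[of us y vs A us' vs'] eq by auto
    then show "w = w'" using * eq by auto
  qed simp
next
  fix w assume "w \<in> loose_words R (A - {y}) Q"
  then obtain us vs where uv: "w = us @ vs" "us @ y # vs \<in> loose_words R A Q"
    using loose_words_insert[OF _ y] by blast
  then have "y \<notin> set us" by (auto simp: loose_words_def linexts_def)
  then show "\<exists>w'\<in>loose_words R A Q. w = remove1 y w'"
    using uv by (intro bexI[of _ "us @ y # vs"]) (auto simp: remove1_append)
qed

text \<open>
  Removing the labels outside \<open>Q\<close> one by one, largest first, gives a descent-preserving bijection onto
  the linear extensions of \<open>Q\<close>.
\<close>

lemma sum_loose_words:
  assumes "finite A" "Q \<subseteq> A"
  shows "(\<Sum>w\<in>loose_words R A Q. F (des_rec w)) = (\<Sum>u\<in>linexts R Q. F (des_rec u))"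
  using assms
proof (induction "card (A - Q)" arbitrary: A)
  case 0
  then have "A = Q" by auto
  then show ?case by (simp add: loose_words_def)
next
  case (Suc k)
  then have ne: "finite (A - Q)" "A - Q \<noteq> {}" by auto
  define y where "y = Max (A - Q)"
  have y: "y \<in> A - Q" "\<forall>x\<in>A - Q. x \<le> y" using Max_in[OF ne] Max_ge[OF ne(1)] unfolding y_def by blast+
  have nd: "des_rec (remove1 y w) = des_rec w" if "w \<in> loose_words R A Q" for w
  proof -
    from that y have *: "y \<in> set w" "distinct w" "loose R w y"
      by (auto simp: loose_words_def linexts_def)
    then obtain us vs where "w = us @ y # vs" by (meson split_list)
    then show ?thesis using * des_rec_delete_loose[of us y vs] by (auto simp: remove1_append)
  qed
  have "A - {y} - Q = (A - Q) - {y}" by auto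
  then have c: "card (A - {y} - Q) = k"
    using Suc.hyps(2) y(1) by (simp add: card_Diff_singleton)
  have "(\<Sum>w\<in>loose_words R A Q. F (des_rec w)) = (\<Sum>w\<in>loose_words R A Q. F (des_rec (remove1 y w)))"
    by (rule sum.cong) (auto simp: nd)
  also have "\<dots> = (\<Sum>w\<in>loose_words R (A - {y}) Q. F (des_rec w))"
    by (rule sum.reindex_bij_betw[OF bij_remove_largest_loose[OF y]])
  also have "\<dots> = (\<Sum>u\<in>linexts R Q. F (des_rec u))"
    using Suc.hyps(1)[of "A - {y}"] c Suc.prems y by auto
  finally show ?case .
qed

end

section \<open>Strict maps and linear extensions\<close>

text \<open>
  A word sorted by the values of \<open>f\<close>, with equal values in decreasing order of the labels: \<open>f\<close> may be
  constant exactly across the descents of the word.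
\<close>

definition along :: "nat list \<Rightarrow> (nat \<Rightarrow> nat) \<Rightarrow> bool" where
  "along u f \<longleftrightarrow> sorted_wrt (\<lambda>x y. f x < f y \<or> f x = f y \<and> x > y) u"

lemma along_snoc:
  "along (u @ [x]) f \<longleftrightarrow> along u f \<and> (\<forall>z\<in>set u. f z < f x \<or> f z = f x \<and> z > x)"
  by (auto simp: along_def sorted_wrt_append)

lemma along_cong: "(\<And>z. z \<in> set u \<Longrightarrow> f z = g z) \<Longrightarrow> along u f \<longleftrightarrow> along u g"
  by (induction u) (auto simp: along_def)

lemma along_last:
  assumes "along u f" "z \<in> set u"
  shows "f z < f (last u) \<or> f z = f (last u) \<and> z \<ge> last u"
proof -
  have "u = butlast u @ [last u]" using assms(2) by (cases u) auto
  then show ?thesis using assms along_snoc[of "butlast u" "last u" f]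
    by (metis Un_iff empty_iff empty_set le_eq_less_or_eq set_ConsD set_append)
qed

text \<open>
  Induction on the word and on \<open>n\<close>: either the last letter \<open>x\<close> has a value at most \<open>n\<close>, or it has the
  value \<open>n + 1\<close>; then the earlier letters take values up to \<open>n + 1\<close> if \<open>x\<close> ends a descent and up to
  \<open>n\<close> otherwise. This is Pascal's rule.
\<close>

lemma card_along:
  "distinct u \<Longrightarrow> card {f \<in> set u \<rightarrow>\<^sub>E {1..n}. along u f} = (n + des_rec u) choose length u"
proof (induction u arbitrary: n rule: rev_induct)
  case Nil
  have "{f \<in> set [] \<rightarrow>\<^sub>E {1..n}. along [] f} = {\<lambda>_. undefined}"
    by (auto simp: along_def)
  then show ?case by simp
next
  case (snoc x u)
  then have xu: "x \<notin> set u" and du: "distinct u" by auto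
  define S where "S = (\<lambda>u n. {f \<in> set u \<rightarrow>\<^sub>E {1..n}. along u f})"
  define d where "d = (if u \<noteq> [] \<and> last u > x then 1 else 0 :: nat)"
  have fin: "finite (S u n)" for u n
    unfolding S_def by (rule finite_subset[of _ "set u \<rightarrow>\<^sub>E {1..n}"]) (auto intro: finite_PiE)
  have nd: "des_rec (u @ [x]) = des_rec u + d"
    by (cases "u = []") (auto simp: des_rec_append d_def)
  have IH: "card (S u n) = (n + des_rec u) choose length u" for n
    using snoc.IH[OF du] by (simp add: S_def)
  have "card (S (u @ [x]) n) = (n + des_rec (u @ [x])) choose length (u @ [x])" for n
  proof (induction n)
    case 0
    have "des_rec v \<le> length v - 1" for v by (induction v rule: des_rec.induct) auto
    from this[of u] have "des_rec u + d < length (u @ [x])" by (cases u) (auto simp: d_def)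
    moreover have "S (u @ [x]) 0 = {}" by (auto simp: S_def PiE_iff)
    ultimately show ?case using nd by (simp add: binomial_eq_0)
  next
    case (Suc n)
    let ?h = "\<lambda>f. f(x := Suc n)"
    have split: "S (u @ [x]) (Suc n) = S (u @ [x]) n \<union> ?h ` S u (n + d)"
    proof (intro set_eqI iffI)
      fix f assume f: "f \<in> S (u @ [x]) (Suc n)"
      then have al: "along u f" "\<forall>z\<in>set u. f z < f x \<or> f z = f x \<and> z > x"
        and P: "f \<in> set (u @ [x]) \<rightarrow>\<^sub>E {1..Suc n}"
        by (auto simp: S_def along_snoc)
      show "f \<in> S (u @ [x]) n \<union> ?h ` S u (n + d)"
      proof (cases "f x = Suc n")
        case False
        then have "f x \<le> n" using P by (force simp: PiE_iff)
        then have "\<forall>z\<in>set (u @ [x]). f z \<le> n" using al by fastforce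
        then have "f \<in> S (u @ [x]) n" using f by (auto simp: S_def PiE_iff)
        then show ?thesis by simp
      next
        case True
        have "f z \<le> n + d" if z: "z \<in> set u" for z
        proof (cases "last u > x")
          case True
          then show ?thesis using z P by (auto simp: d_def PiE_iff)
        next
          case False
          have "u \<noteq> []" using z by auto
          then have "f (last u) \<le> n" using al(2) False \<open>f x = Suc n\<close>
            by (metis last_in_set less_Suc_eq_le)
          then show ?thesis using along_last[OF al(1) z] by auto
        qed
        moreover have "along u (f(x := undefined))"
          using al(1) xu by (subst along_cong[of _ _ f]) auto
        ultimately have "f(x := undefined) \<in> S u (n + d)"
          using P xu by (auto simp: S_def PiE_iff extensional_def)
        moreover have "f = ?h (f(x := undefined))" using True by auto
        ultimately show ?thesis by blast
      qed
    next
      fix f assume "f \<in> S (u @ [x]) n \<union> ?h ` S u (n + d)"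
      then show "f \<in> S (u @ [x]) (Suc n)"
      proof
        assume "f \<in> S (u @ [x]) n"
        then show ?thesis by (force simp: S_def PiE_iff)
      next
        assume "f \<in> ?h ` S u (n + d)"
        then obtain g where g: "g \<in> S u (n + d)" "f = ?h g" by auto
        then have al: "along u g" and P: "g \<in> set u \<rightarrow>\<^sub>E {1..n + d}" by (auto simp: S_def)
        have "d \<le> 1" by (simp add: d_def)
        have "g z < Suc n \<or> g z = Suc n \<and> z > x" if z: "z \<in> set u" for z
        proof (cases "d = 0")
          case True
          then show ?thesis using P z by (force simp: PiE_iff)
        next
          case False
          then have "last u > x" "d = 1" "last u \<in> set u" by (auto simp: d_def split: if_splits)
          moreover from this have "g (last u) \<le> Suc n" using P by (force simp: PiE_iff)
          ultimately show ?thesis using along_last[OF al z] by auto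
        qed
        moreover have "along u f"
          using al xu unfolding g(2) by (subst along_cong[of _ _ g]) auto
        ultimately have "along (u @ [x]) f"
          using xu unfolding along_snoc g(2) by auto
        then show ?thesis using P \<open>d \<le> 1\<close> g(2) xu
          by (force simp: S_def PiE_iff extensional_def)
      qed
    qed
    have inj: "inj_on ?h (S u (n + d))"
    proof (rule inj_onI)
      fix f g assume fg: "f \<in> S u (n + d)" "g \<in> S u (n + d)" "?h f = ?h g"
      then have "f x = undefined" "g x = undefined" using xu by (auto simp: S_def PiE_iff extensional_def)
      then show "f = g" using fg(3) by (metis fun_upd_triv fun_upd_upd)
    qed
    have disj: "S (u @ [x]) n \<inter> ?h ` S u (n + d) = {}"
      by (force simp: S_def PiE_iff)
    have "card (S (u @ [x]) (Suc n)) = card (S (u @ [x]) n) + card (S u (n + d))"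
      unfolding split using disj fin inj by (simp add: card_Un_disjoint card_image)
    then show ?case using Suc.IH IH[of "n + d"] nd by (simp add: algebra_simps)
  qed
  then show ?case by (simp add: S_def)
qed

definition strict_maps :: "'a rel \<Rightarrow> 'a set \<Rightarrow> nat \<Rightarrow> ('a \<Rightarrow> nat) set" where
  "strict_maps r A n = {f \<in> A \<rightarrow>\<^sub>E {1..n}. \<forall>x\<in>A. \<forall>y\<in>A. (x, y) \<in> r \<longrightarrow> f x < f y}"

definition weak_maps :: "'a rel \<Rightarrow> 'a set \<Rightarrow> nat \<Rightarrow> ('a \<Rightarrow> nat) set" where
  "weak_maps r A n = {g \<in> A \<rightarrow>\<^sub>E {0..n}. \<forall>x\<in>A. \<forall>y\<in>A. (x, y) \<in> r \<longrightarrow> g x \<le> g y}"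

text \<open>
  The elements at which a weakly order-preserving map can be lowered by one.
\<close>

definition rises :: "'a rel \<Rightarrow> 'a set \<Rightarrow> ('a \<Rightarrow> nat) \<Rightarrow> 'a set" where
  "rises r A g = {y \<in> A. 1 \<le> g y \<and> (\<forall>x\<in>A. (x, y) \<in> r \<longrightarrow> g x < g y)}"

text \<open>
  The injective integer key \<open>f x * B - x\<close> turns the lexicographic comparison into the usual order, so
  that uniqueness of sorted lists applies.
\<close>

lemma ex1_along:
  assumes "finite A"
  shows "\<exists>!u. distinct u \<and> set u = A \<and> along u f"
proof -
  define B where "B = Suc (Max (insert 0 A))"
  have B: "x < B" if "x \<in> A" for x
    using that assms unfolding B_def by (simp add: less_Suc_eq_le)
  \<comment> \<open>Subtracting the label orders equal values decreasingly; \<open>B\<close> exceeds all labels.\<close>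
  define key where "key x = int (f x) * int B - int x" for x
  have key_less: "key x < key y" if "x \<in> A" "y \<in> A" "f x < f y \<or> f x = f y \<and> x > y" for x y
  proof (cases "f x = f y")
    case True
    then show ?thesis using that by (simp add: key_def)
  next
    case False
    then have "int (f x) + 1 \<le> int (f y)" using that by auto
    then have "(int (f x) + 1) * int B \<le> int (f y) * int B" by (intro mult_right_mono) auto
    then show ?thesis using B[OF that(1)] B[OF that(2)] unfolding key_def by (simp add: algebra_simps)
  qed
  have key_iff: "key x < key y \<longleftrightarrow> f x < f y \<or> f x = f y \<and> x > y" if "x \<in> A" "y \<in> A" for x y
    using key_less[OF that] key_less[OF that(2,1)]
    by (metis less_asym less_irrefl linorder_neqE_nat)
  have inj: "inj_on key A"
  proof (rule inj_onI)
    fix x y assume "x \<in> A" "y \<in> A" "key x = key y"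
    then show "x = y" using key_less[of x y] key_less[of y x]
      by (metis linorder_neqE_nat order_less_irrefl)
  qed
  have iff: "along u f \<longleftrightarrow> sorted_wrt (<) (map key u)" if "set u = A" for u
    using that key_iff unfolding along_def sorted_wrt_map
    by (auto elim!: sorted_wrt_mono_rel[rotated])
  show ?thesis
  proof (rule ex1I)
    let ?u = "sort_key key (sorted_list_of_set A)"
    have "distinct (map key ?u)" using inj assms by (simp add: distinct_map)
    then have "sorted_wrt (<) (map key ?u)" by (simp add: strict_sorted_iff)
    then show "distinct ?u \<and> set ?u = A \<and> along ?u f" using iff[of ?u] assms by simp
    fix u assume u: "distinct u \<and> set u = A \<and> along u f"
    have "map key u = map key ?u"
    proof (rule strict_sorted_equal)
      show "sorted_wrt (<) (map key u)" using u iff by blast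
      show "sorted_wrt (<) (map key ?u)" by fact
      show "set (map key u) = set (map key ?u)" using u assms by simp
    qed
    then show "u = ?u" using inj u assms by (intro map_inj_on[of key]) auto
  qed
qed

context natural_order
begin

lemma along_linext_iff:
  assumes "distinct u" "along u f"
  shows "u \<in> linexts R (set u) \<longleftrightarrow> (\<forall>x\<in>set u. \<forall>y\<in>set u. (x, y) \<in> R \<longrightarrow> f x < f y)"
proof
  assume u: "u \<in> linexts R (set u)"
  show "\<forall>x\<in>set u. \<forall>y\<in>set u. (x, y) \<in> R \<longrightarrow> f x < f y"
  proof (intro ballI impI)
    fix x y assume xy: "x \<in> set u" "y \<in> set u" "(x, y) \<in> R"
    then obtain i j where ij: "i < length u" "j < length u" "x = u ! i" "y = u ! j"
      by (metis in_set_conv_nth)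
    have "\<not> j < i" using u ij xy(3) by (auto simp: linexts_def sorted_wrt_iff_nth_less)
    moreover have "i \<noteq> j" using ij R_less[OF xy(3)] by auto
    ultimately have "i < j" by simp
    then have "f x < f y \<or> f x = f y \<and> x > y"
      using assms(2) ij by (auto simp: along_def sorted_wrt_iff_nth_less)
    then show "f x < f y" using R_less[OF xy(3)] by auto
  qed
next
  assume "\<forall>x\<in>set u. \<forall>y\<in>set u. (x, y) \<in> R \<longrightarrow> f x < f y"
  then have "sorted_wrt (\<lambda>x y. (y, x) \<notin> R) u"
    using assms(2) unfolding along_def by (rule_tac sorted_wrt_mono_rel[rotated]) force+
  then show "u \<in> linexts R (set u)" using assms(1) by (simp add: linexts_def)
qed

lemma card_strict_maps:
  assumes "finite A"
  shows "card (strict_maps R A n) = (\<Sum>u\<in>linexts R A. (n + des_rec u) choose card A)"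
proof -
  let ?S = "\<lambda>u. {f \<in> A \<rightarrow>\<^sub>E {1..n}. along u f}"
  have eq: "strict_maps R A n = (\<Union>u\<in>linexts R A. ?S u)"
  proof (intro set_eqI iffI)
    fix f assume f: "f \<in> strict_maps R A n"
    obtain u where u: "distinct u" "set u = A" "along u f" using ex1_along[OF assms] by metis
    then have "u \<in> linexts R A"
      using f along_linext_iff[OF u(1,3)] by (simp add: strict_maps_def)
    then show "f \<in> (\<Union>u\<in>linexts R A. ?S u)" using f u by (auto simp: strict_maps_def)
  next
    fix f assume "f \<in> (\<Union>u\<in>linexts R A. ?S u)"
    then obtain u where u: "u \<in> linexts R A" "f \<in> A \<rightarrow>\<^sub>E {1..n}" "along u f" by auto
    then have "distinct u" "set u = A" by (auto simp: linexts_def)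
    then show "f \<in> strict_maps R A n"
      using along_linext_iff[of u f] u by (auto simp: strict_maps_def)
  qed
  have "card (strict_maps R A n) = (\<Sum>u\<in>linexts R A. card (?S u))"
    unfolding eq
  proof (rule card_UN_disjoint)
    show "\<forall>u\<in>linexts R A. finite (?S u)"
      using assms by (auto intro!: finite_subset[of "?S _" "A \<rightarrow>\<^sub>E {1..n}"] finite_PiE)
    show "\<forall>u\<in>linexts R A. \<forall>v\<in>linexts R A. u \<noteq> v \<longrightarrow> ?S u \<inter> ?S v = {}"
      using ex1_along[OF assms] by (auto simp: linexts_def)
  qed (rule finite_linexts[OF assms])
  also have "\<dots> = (\<Sum>u\<in>linexts R A. (n + des_rec u) choose card A)"
  proof (rule sum.cong[OF refl])
    fix u assume "u \<in> linexts R A"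
    then have "distinct u" "set u = A" by (auto simp: linexts_def)
    then show "card (?S u) = (n + des_rec u) choose card A"
      using card_along[of u n] by (auto simp: distinct_card)
  qed
  finally show ?thesis .
qed

end

text \<open>
  Restriction to the rises is a bijection onto the strict maps: the inverse sends an element to
  the largest value of the strict map below it, or to \<open>0\<close> if there is none.
\<close>

lemma card_weak_maps_rises:
  assumes fin: "finite A" and tr: "trans R" and irr: "\<And>x y. (x, y) \<in> R \<Longrightarrow> x < (y::nat)"
    and Q: "Q \<subseteq> A"
  shows "card {g \<in> weak_maps R A n. rises R A g = Q} = card (strict_maps R Q n)"
proof (rule bij_betw_same_card[of "\<lambda>g. restrict g Q"], rule bij_betwI')
  fix g h
  assume g: "g \<in> {g \<in> weak_maps R A n. rises R A g = Q}"
    and h: "h \<in> {g \<in> weak_maps R A n. rises R A g = Q}"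
  have *: "g x \<le> h x" if gh: "restrict g Q = restrict h Q" and x: "x \<in> A"
    and g: "g \<in> weak_maps R A n" "rises R A g = Q" and h: "h \<in> weak_maps R A n" for g h x
    using x
  proof (induction x rule: less_induct)
    case (less x)
    show ?case
    proof (cases "x \<in> Q \<or> g x = 0")
      case True
      then show ?thesis using gh by (metis le0 le_refl restrict_apply)
    next
      case False
      then have "x \<notin> rises R A g" "1 \<le> g x" using g(2) by auto
      then obtain z where z: "z \<in> A" "(z, x) \<in> R" "g x \<le> g z"
        using less.prems unfolding rises_def by (fastforce simp: not_less)
      have "g z \<le> h z" using less.IH z irr by auto
      moreover have "h z \<le> h x" using h z less.prems by (auto simp: weak_maps_def)
      ultimately show ?thesis using z by auto
    qed
  qed
  show "(restrict g Q = restrict h Q) = (g = h)"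
  proof
    assume eq: "restrict g Q = restrict h Q"
    show "g = h"
    proof (rule ext)
      fix x
      show "g x = h x"
      proof (cases "x \<in> A")
        case True
        then show ?thesis using *[OF eq True] *[OF eq[symmetric] True] g h by (simp add: antisym)
      next
        case False
        then show ?thesis using g h by (auto simp: weak_maps_def PiE_iff extensional_def)
      qed
    qed
  qed simp
next
  fix g assume g: "g \<in> {g \<in> weak_maps R A n. rises R A g = Q}"
  then show "restrict g Q \<in> strict_maps R Q n"
    by (auto simp: weak_maps_def rises_def strict_maps_def PiE_iff)
next
  fix f assume f: "f \<in> strict_maps R Q n"
  have finQ: "finite Q" using fin Q finite_subset by blast
  define below where "below x = {z \<in> Q. z = x \<or> (z, x) \<in> R}" for x
  define g where "g = restrict (\<lambda>x. Max (insert 0 (f ` below x))) A"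
  have finb: "finite (insert 0 (f ` below x))" for x using finQ by (auto simp: below_def)
  have gA: "g x = Max (insert 0 (f ` below x))" if "x \<in> A" for x using that by (simp add: g_def)
  have ge: "f z \<le> g x" if "x \<in> A" "z \<in> below x" for x z
    unfolding gA[OF that(1)] using that finb by (intro Max_ge) auto
  have f_range: "1 \<le> f z" "f z \<le> n" if "z \<in> Q" for z
    using f that by (auto simp: strict_maps_def PiE_iff)
  have f_less: "f z < f x" if "z \<in> Q" "x \<in> Q" "(z, x) \<in> R" for z x
    using f that by (auto simp: strict_maps_def)
  have cases: "g x = 0 \<or> (\<exists>z\<in>below x. g x = f z)" if "x \<in> A" for x
    using Max_in[OF finb, of x] gA[OF that] by auto
  have gQ: "g x = f x" if "x \<in> Q" for x
  proof -
    have xA: "x \<in> A" using that Q by auto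
    have "x \<in> below x" using that by (simp add: below_def)
    then have "f x \<le> g x" using ge xA by auto
    moreover have "f z \<le> f x" if "z \<in> below x" for z
      using that f_less \<open>x \<in> Q\<close> by (fastforce simp: below_def)
    ultimately show ?thesis using cases[OF xA] by fastforce
  qed
  have weak: "g \<in> weak_maps R A n"
    unfolding weak_maps_def
  proof (intro CollectI conjI ballI impI)
    have "g x \<le> n" if "x \<in> A" for x
      using cases[OF that] f_range by (auto simp: below_def)
    then show "g \<in> A \<rightarrow>\<^sub>E {0..n}" by (auto simp: g_def)
    fix x y assume xy: "x \<in> A" "y \<in> A" "(x, y) \<in> R"
    have "below x \<subseteq> below y" using xy tr by (auto simp: below_def dest: transD)
    then show "g x \<le> g y" using cases[OF xy(1)] ge[OF xy(2)] by auto
  qed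
  have "rises R A g = Q"
  proof (intro set_eqI iffI)
    fix x assume x: "x \<in> rises R A g"
    then have "x \<in> A" "1 \<le> g x" by (auto simp: rises_def)
    then obtain z where z: "z \<in> below x" "g x = f z" using cases by force
    show "x \<in> Q"
    proof (rule ccontr)
      assume "x \<notin> Q"
      then have "z \<in> Q" "(z, x) \<in> R" using z by (auto simp: below_def)
      moreover from this have "g z = g x" using gQ z by simp
      ultimately show False using x Q by (auto simp: rises_def)
    qed
  next
    fix x assume x: "x \<in> Q"
    have "g z < g x" if "z \<in> A" "(z, x) \<in> R" for z
    proof (cases "g z = 0")
      case True
      then show ?thesis using f_range(1)[OF x] gQ[OF x] by auto
    next
      case False
      then obtain t where t: "t \<in> below z" "g z = f t" using cases[OF \<open>z \<in> A\<close>] by auto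
      then have "t \<in> Q" "(t, x) \<in> R" using that tr by (auto simp: below_def dest: transD)
      then show ?thesis using t f_less x gQ by auto
    qed
    then show "x \<in> rises R A g" using x Q gQ f_range by (auto simp: rises_def)
  qed
  moreover have "restrict g Q = f"
    using f gQ by (auto simp: fun_eq_iff strict_maps_def PiE_iff extensional_def)
  ultimately show "\<exists>g\<in>{g \<in> weak_maps R A n. rises R A g = Q}. f = restrict g Q"
    using weak by (intro bexI[of _ g]) auto
qed

section \<open>Counting weak maps by words\<close>

lemma card_supersets_within:
  assumes "finite A" "F \<subseteq> A"
  shows "card {Q. F \<subseteq> Q \<and> Q \<subseteq> A \<and> card Q = k} = binom (card A - card F) (int k - int (card F))"
proof (cases "card F \<le> k")
  case False
  have "card F \<le> card Q" if "F \<subseteq> Q" "Q \<subseteq> A" for Q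
    using that assms(1) by (meson card_mono finite_subset)
  then have empty: "{Q. F \<subseteq> Q \<and> Q \<subseteq> A \<and> card Q = k} = {}"
    using False by auto
  show ?thesis unfolding empty using False by (simp add: binom_def)
next
  case True
  have finF: "finite F" using assms finite_subset by auto
  have "bij_betw (\<lambda>Q. Q - F) {Q. F \<subseteq> Q \<and> Q \<subseteq> A \<and> card Q = k}
      {B. B \<subseteq> A - F \<and> card B = k - card F}"
  proof (rule bij_betw_byWitness[where f' = "\<lambda>B. B \<union> F"])
    show "(\<lambda>B. B \<union> F) ` {B. B \<subseteq> A - F \<and> card B = k - card F}
        \<subseteq> {Q. F \<subseteq> Q \<and> Q \<subseteq> A \<and> card Q = k}"
    proof clarsimp
      fix B assume B: "B \<subseteq> A - F" "card B = k - card F"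
      then have "card (B \<union> F) = card B + card F"
        using assms(1) finF by (intro card_Un_disjoint) (auto intro: finite_subset)
      then show "B \<subseteq> A \<and> F \<subseteq> A \<and> card (B \<union> F) = k" using B assms True by auto
    qed
  qed (use finF in \<open>auto simp: card_Diff_subset\<close>)
  then have "card {Q. F \<subseteq> Q \<and> Q \<subseteq> A \<and> card Q = k} = card {B. B \<subseteq> A - F \<and> card B = k - card F}"
    by (rule bij_betw_same_card)
  also have "\<dots> = card (A - F) choose (k - card F)"
    using assms by (intro n_subsets) auto
  finally show ?thesis
    using True assms finF by (simp add: binom_def card_Diff_subset nat_diff_distrib)
qed

definition fixed_labels :: "nat rel \<Rightarrow> nat list \<Rightarrow> nat set" where
  "fixed_labels R w = {x \<in> set w. \<not> loose R w x}"

text \<open>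
  Group the maps by their set of rises, count each group by words, and exchange the two sums.
\<close>

lemma (in natural_order) sum_weak_maps:
  fixes y :: "'a :: comm_semiring_1"
  assumes fin: "finite A"
  shows "(\<Sum>g\<in>weak_maps R A n. y ^ card (rises R A g)) =
    (\<Sum>k = 0..card A. \<Sum>w\<in>linexts R A.
       of_nat (binom (card A - card (fixed_labels R w)) (int k - int (card (fixed_labels R w)))
         * ((n + des w) choose k)) * y ^ k)"
proof -
  let ?t = "\<lambda>w Q. of_nat ((n + des_rec w) choose card Q) * y ^ card Q"
  let ?c = "\<lambda>w k. of_nat (binom (card A - card (fixed_labels R w)) (int k - int (card (fixed_labels R w)))
         * ((n + des w) choose k)) * y ^ k"
  let ?W = "\<lambda>Q. {g \<in> weak_maps R A n. rises R A g = Q}"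
  have finW: "finite (weak_maps R A n)"
    by (rule finite_subset[of _ "A \<rightarrow>\<^sub>E {0..n}"]) (use fin in \<open>auto simp: weak_maps_def intro: finite_PiE\<close>)
  note finL = finite_linexts[OF fin, of R]
  have sub: "card Q \<in> {0..card A}" if "Q \<in> Pow A" for Q using that fin by (auto intro: card_mono)
  have loose_iff: "{w \<in> linexts R A. fixed_labels R w \<subseteq> Q} = loose_words R A Q" for Q
    by (auto simp: loose_words_def fixed_labels_def linexts_def)
  have "(\<Sum>g\<in>weak_maps R A n. y ^ card (rises R A g)) =
      (\<Sum>Q\<in>Pow A. \<Sum>g\<in>?W Q. y ^ card (rises R A g))"
    by (rule sum.group[symmetric]) (use finW fin in \<open>auto simp: rises_def\<close>)
  also have "\<dots> = (\<Sum>Q\<in>Pow A. of_nat (card (strict_maps R Q n)) * y ^ card Q)"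
  proof (rule sum.cong[OF refl])
    fix Q assume "Q \<in> Pow A"
    then have "card (?W Q) = card (strict_maps R Q n)"
      by (intro card_weak_maps_rises fin R_trans R_less) auto
    moreover have "(\<Sum>g\<in>?W Q. y ^ card (rises R A g))
       = (\<Sum>g\<in>?W Q. y ^ card Q)"
      by (rule sum.cong) auto
    ultimately show "(\<Sum>g\<in>?W Q. y ^ card (rises R A g))
      = of_nat (card (strict_maps R Q n)) * y ^ card Q"
      by simp
  qed
  also have "\<dots> = (\<Sum>Q\<in>Pow A. \<Sum>w\<in>loose_words R A Q. ?t w Q)"
  proof (rule sum.cong[OF refl])
    fix Q assume Q: "Q \<in> Pow A"
    then have "finite Q" using fin finite_subset by auto
    then show "of_nat (card (strict_maps R Q n)) * y ^ card Q =
      (\<Sum>w\<in>loose_words R A Q. ?t w Q)"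
      using Q by (simp add: card_strict_maps sum_distrib_right
          sum_loose_words[OF fin, of Q "\<lambda>d. of_nat ((n + d) choose card Q) * y ^ card Q"])
  qed
  also have "\<dots> = (\<Sum>Q\<in>Pow A. \<Sum>w | w \<in> linexts R A \<and> fixed_labels R w \<subseteq> Q.
      ?t w Q)"
    by (simp add: loose_iff)
  also have "\<dots> = (\<Sum>w\<in>linexts R A. \<Sum>Q | Q \<in> Pow A \<and> fixed_labels R w \<subseteq> Q.
      ?t w Q)"
    using fin finL by (intro sum.swap_restrict) auto
  also have "\<dots> = (\<Sum>w\<in>linexts R A. \<Sum>k = 0..card A. ?c w k)"
  proof (rule sum.cong[OF refl])
    fix w assume "w \<in> linexts R A"
    then have F: "fixed_labels R w \<subseteq> A" by (auto simp: fixed_labels_def linexts_def)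
    let ?S = "{Q \<in> Pow A. fixed_labels R w \<subseteq> Q}"
    have eq: "{Q \<in> ?S. card Q = k} = {Q. fixed_labels R w \<subseteq> Q \<and> Q \<subseteq> A \<and> card Q = k}" for k
      by auto
    have "(\<Sum>Q\<in>?S. ?t w Q)
      = (\<Sum>k = 0..card A. \<Sum>Q\<in>{Q \<in> ?S. card Q = k}. ?t w Q)"
      by (rule sum.group[symmetric]) (use fin sub in auto)
    also have "\<dots> = (\<Sum>k = 0..card A. of_nat (card {Q \<in> ?S. card Q = k}) * (of_nat ((n + des_rec w) choose k) * y ^ k))"
      by (rule sum.cong) auto
    finally show "(\<Sum>Q\<in>?S. ?t w Q) = (\<Sum>k = 0..card A. ?c w k)"
      unfolding eq card_supersets_within[OF fin F] by (simp add: des_eq_des_rec mult.assoc)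
  qed
  also have "\<dots> = (\<Sum>k = 0..card A. \<Sum>w\<in>linexts R A. ?c w k)"
    by (rule sum.swap)
  finally show ?thesis .
qed

locale labelled_poset =
  fixes P :: "'a set" and r :: "'a rel" and \<omega> :: "'a \<Rightarrow> nat"
  assumes finP: "finite P" and r_trans: "trans r" and r_sub: "r \<subseteq> P \<times> P"
    and omega: "order_pres_bij P r \<omega>"
begin

definition R where "R = {(\<omega> x, \<omega> y) | x y. (x, y) \<in> r}"

lemma bij: "bij_betw \<omega> P {1..card P}" and inj: "inj_on \<omega> P" and img: "\<omega> ` P = {1..card P}"
  using omega by (auto simp: order_pres_bij_def bij_betw_def)

lemma R_iff: "x \<in> P \<Longrightarrow> y \<in> P \<Longrightarrow> (\<omega> x, \<omega> y) \<in> R \<longleftrightarrow> (x, y) \<in> r"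
proof
  assume x: "x \<in> P" "y \<in> P" and "(\<omega> x, \<omega> y) \<in> R"
  then obtain x' y' where xy: "\<omega> x = \<omega> x'" "\<omega> y = \<omega> y'" "(x', y') \<in> r" by (auto simp: R_def)
  then have "x' \<in> P" "y' \<in> P" using r_sub by auto
  then show "(x, y) \<in> r" using xy x inj_onD[OF inj] by metis
qed (auto simp: R_def)

lemma inv_iff:
  assumes "a \<in> {1..card P}" "b \<in> {1..card P}"
  shows "(inv_into P \<omega> a, inv_into P \<omega> b) \<in> r \<longleftrightarrow> (a, b) \<in> R"
  using assms R_iff[of "inv_into P \<omega> a" "inv_into P \<omega> b"] img
  by (metis f_inv_into_f inv_into_into)

sublocale natural_order R
proof
  show "trans R"
  proof (rule transI)
    fix a b c assume "(a, b) \<in> R" "(b, c) \<in> R"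
    then obtain x y y' z where "a = \<omega> x" "b = \<omega> y" "(x, y) \<in> r" "b = \<omega> y'" "c = \<omega> z" "(y', z) \<in> r"
      by (auto simp: R_def)
    moreover from this have "y = y'" using r_sub inj by (auto simp: inj_on_def)
    ultimately show "(a, c) \<in> R" using r_trans by (auto simp: R_def dest: transD)
  qed
  show "a < b" if "(a, b) \<in> R" for a b
    using that omega r_sub by (auto simp: R_def order_pres_bij_def)
qed

text \<open>
  A word lists the labels in the order of the bijection \<open>\<sigma>\<close>, so its letters respect the relabelled order.
\<close>

lemma linext_words_eq: "linext_words P r \<omega> = linexts R {1..card P}"
proof (intro set_eqI iffI)
  fix w assume "w \<in> linext_words P r \<omega>"
  then obtain \<sigma> where s: "order_pres_bij P r \<sigma>"
    and w: "w = map (\<lambda>i. \<omega> (inv_into P \<sigma> i)) [1..<card P + 1]"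
    by (auto simp: linext_words_def)
  have sb: "bij_betw \<sigma> P {1..card P}" using s by (auto simp: order_pres_bij_def)
  have si: "bij_betw (\<omega> \<circ> inv_into P \<sigma>) {1..card P} {1..card P}"
    by (rule bij_betw_trans[OF bij_betw_inv_into[OF sb] bij])
  have set: "set [1..<card P + 1] = {1..card P}" by auto
  have "distinct w" unfolding w using si set by (auto simp: distinct_map bij_betw_def comp_def)
  moreover have "set w = {1..card P}"
    unfolding w set_map set using si by (auto simp: bij_betw_def comp_def)
  moreover have "sorted_wrt (\<lambda>x y. (y, x) \<notin> R) w"
    unfolding w sorted_wrt_map
  proof (rule sorted_wrt_mono_rel)
    show "sorted_wrt (<) [1..<card P + 1]" by (rule sorted_wrt_upt)
    fix i j assume ij: "i \<in> set [1..<card P + 1]" "j \<in> set [1..<card P + 1]" "i < j"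
    then have P: "inv_into P \<sigma> i \<in> P" "inv_into P \<sigma> j \<in> P"
      using sb unfolding set by (metis bij_betw_imp_surj_on inv_into_into)+
    have "\<sigma> (inv_into P \<sigma> i) = i" "\<sigma> (inv_into P \<sigma> j) = j"
      using ij sb unfolding set by (metis bij_betw_inv_into_right)+
    then have "(inv_into P \<sigma> j, inv_into P \<sigma> i) \<notin> r"
      using s P ij(3) unfolding order_pres_bij_def by (metis less_asym)
    then show "(\<omega> (inv_into P \<sigma> j), \<omega> (inv_into P \<sigma> i)) \<notin> R" using R_iff P by auto
  qed
  ultimately show "w \<in> linexts R {1..card P}" by (auto simp: linexts_def)
next
  fix w assume "w \<in> linexts R {1..card P}"
  then have d: "distinct w" and s: "set w = {1..card P}" and sw: "sorted_wrt (\<lambda>x y. (y, x) \<notin> R) w"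
    by (auto simp: linexts_def)
  have len: "length w = card P" using d s distinct_card by fastforce
  have b1: "bij_betw (\<lambda>i. w ! (i - 1)) {1..card P} {1..card P}"
  proof -
    have "bij_betw (\<lambda>i. i - 1) {1..card P} {..<card P}"
      by (rule bij_betw_byWitness[where f' = Suc]) auto
    moreover have "bij_betw ((!) w) {..<card P} {1..card P}"
      using bij_betw_nth[OF d, of "{..<card P}" "{1..card P}"] len s by auto
    ultimately show ?thesis using bij_betw_trans by (force simp: comp_def)
  qed
  define \<tau> where "\<tau> i = inv_into P \<omega> (w ! (i - 1))" for i
  have bt: "bij_betw \<tau> {1..card P} P"
    using bij_betw_trans[OF b1 bij_betw_inv_into[OF bij]] by (simp add: \<tau>_def[abs_def] comp_def)
  define \<sigma> where "\<sigma> = inv_into {1..card P} \<tau>"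
  have bs: "bij_betw \<sigma> P {1..card P}" unfolding \<sigma>_def by (rule bij_betw_inv_into[OF bt])
  have \<tau>\<sigma>: "\<tau> (\<sigma> x) = x" if "x \<in> P" for x
    unfolding \<sigma>_def using bt that by (simp add: bij_betw_inv_into_right)
  have inv: "inv_into P \<sigma> i = \<tau> i" if "i \<in> {1..card P}" for i
    using that bs \<tau>\<sigma> by (metis bij_betw_inv_into_left bij_betw_inv_into_right bij_betwE bt \<sigma>_def)
  have \<omega>\<tau>: "\<omega> (\<tau> i) = w ! (i - 1)" if "i \<in> {1..card P}" for i
    unfolding \<tau>_def using that b1 bij by (metis bij_betwE bij_betw_inv_into_right)
  have "\<sigma> x < \<sigma> y" if xy: "x \<in> P" "y \<in> P" "(x, y) \<in> r" for x y
  proof (rule ccontr)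
    assume n: "\<not> \<sigma> x < \<sigma> y"
    have ne: "\<omega> x \<noteq> \<omega> y" using R_less[of "\<omega> x" "\<omega> y"] R_iff[OF xy(1,2)] xy(3) by simp
    have r: "\<sigma> x \<in> {1..card P}" "\<sigma> y \<in> {1..card P}" using bs xy by (auto dest: bij_betwE)
    have "\<sigma> x \<noteq> \<sigma> y" using \<tau>\<sigma>[OF xy(1)] \<tau>\<sigma>[OF xy(2)] ne by metis
    then have "\<sigma> y - 1 < \<sigma> x - 1" "\<sigma> x - 1 < length w" using n r len by auto
    then have "(w ! (\<sigma> x - 1), w ! (\<sigma> y - 1)) \<notin> R"
      using sw by (auto simp: sorted_wrt_iff_nth_less)
    then show False using \<omega>\<tau>[OF r(1)] \<omega>\<tau>[OF r(2)] \<tau>\<sigma>[OF xy(1)] \<tau>\<sigma>[OF xy(2)] xy R_iff[OF xy(1,2)] by simp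
  qed
  then have "order_pres_bij P r \<sigma>" using bs by (auto simp: order_pres_bij_def)
  moreover have "w = map (\<lambda>i. \<omega> (inv_into P \<sigma> i)) [1..<card P + 1]"
    by (rule nth_equalityI) (auto simp: len inv \<omega>\<tau> simp del: upt_Suc)
  ultimately show "w \<in> linext_words P r \<omega>" by (auto simp: linext_words_def)
qed

text \<open>
  If position \<open>i\<close> is not fixed, cutting the word at the last predecessor of its letter gives the
  decomposition required for looseness; conversely, in such a decomposition every larger letter before
  position \<open>i\<close> is in \<open>us1\<close>, and hence not beyond the last predecessor.
\<close>

lemma fixed_at_iff:
  assumes w: "w \<in> linexts R {1..card P}" and i: "1 \<le> i" "i \<le> length w"
  shows "fixed_at P r \<omega> w i \<longleftrightarrow> \<not> loose R w (letter w i)"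
proof -
  define x where "x = letter w i"
  define us where "us = take (i - 1) w"
  define vs where "vs = drop i w"
  have w_eq: "w = us @ x # vs"
    using i id_take_nth_drop[of "i - 1" w] by (simp add: us_def vs_def x_def letter_def)
  have len: "length us = i - 1" using i by (simp add: us_def)
  from w have d: "distinct w" and s: "set w = {1..card P}" and sw: "sorted_wrt (\<lambda>x y. (y, x) \<notin> R) w"
    by (auto simp: linexts_def)
  have inA: "letter w j \<in> {1..card P}" if "1 \<le> j" "j \<le> length w" for j
    using that s nth_mem[of "j - 1" w] by (auto simp: letter_def)
  define J where "J = poset_before P r \<omega> w i"
  define L where "L = larger_before w i"
  have J_iff: "j \<in> J \<longleftrightarrow> 1 \<le> j \<and> j \<le> length w \<and> (letter w j, x) \<in> R" for j
    using inv_iff inA i unfolding J_def poset_before_def x_def by blast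
  have J_less: "j < i" if "j \<in> J" for j
  proof (rule ccontr)
    assume "\<not> j < i"
    moreover have "j \<noteq> i" using that J_iff R_less unfolding x_def by blast
    ultimately have "i - 1 < j - 1" "j - 1 < length w" using i that J_iff[of j] by auto
    then have "(w ! (j - 1), w ! (i - 1)) \<notin> R" using sw by (auto simp: sorted_wrt_iff_nth_less)
    then show False using that J_iff[of j] by (simp add: x_def letter_def)
  qed
  have finJ: "finite J" and finL: "finite L"
    using J_less by (auto intro: finite_subset[of _ "{..<i}"] simp: L_def larger_before_def)
  have us_nth: "us ! j = letter w (Suc j)" if "j < length us" for j
    using that by (simp add: us_def letter_def)
  have desc_left: "i - 1 \<in> descents w \<longleftrightarrow> us \<noteq> [] \<and> last us > x"
  proof (cases "us = []")
    case True
    then show ?thesis using len i by (auto simp: descents_def)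
  next
    case False
    then have "2 \<le> i" using len by (cases us) auto
    moreover have "last us = letter w (i - 1)"
      using False us_nth[of "i - 2"] len \<open>2 \<le> i\<close> by (simp add: last_conv_nth numeral_2_eq_2 Suc_diff_Suc)
    ultimately show ?thesis using i False by (auto simp: descents_def x_def)
  qed
  have desc_right: "i \<in> descents w \<longleftrightarrow> vs \<noteq> [] \<and> x > hd vs"
    using i by (cases "i < length w") (auto simp: descents_def x_def vs_def letter_def hd_drop_conv_nth)
  have x_notin: "x \<notin> set us" "x \<notin> set vs" using d w_eq by auto
  have fixed: "fixed_at P r \<omega> w i \<longleftrightarrow> (us \<noteq> [] \<and> last us > x) \<or> (vs \<noteq> [] \<and> x > hd vs) \<or>
      (L \<noteq> {} \<and> Max L > max0 J)"
    unfolding fixed_at_def desc_left desc_right by (auto simp: J_def L_def max0_def)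
  have "loose R w x" if nf: "\<not> fixed_at P r \<omega> w i"
  proof -
    define m where "m = max0 J"
    have m2: "m = 0 \<or> m \<in> J"
      using finJ Max_in[of J] by (auto simp: m_def max0_def)
    then have m: "m \<le> length us" using J_less[of m] len by auto
    have "us = take m us @ drop m us" by simp
    moreover have "\<forall>z\<in>set (drop m us). z < x"
    proof
      fix z assume "z \<in> set (drop m us)"
      then obtain k where "k < length us - m" "z = us ! (m + k)"
        by (auto simp: in_set_conv_nth m)
      then obtain l where l: "m \<le> l" "l < length us" "z = us ! l" by (intro that[of "m + k"]) auto
      have "\<not> z > x"
      proof
        assume "z > x"
        then have "Suc l \<in> L" using l us_nth len by (auto simp: L_def larger_before_def x_def)
        then have "Suc l \<le> Max L" "L \<noteq> {}" using Max_ge[OF finL] by blast+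
        moreover have "L = {} \<or> Max L \<le> m" using nf unfolding fixed m_def by auto
        ultimately show False using l by linarith
      qed
      moreover have "z \<noteq> x" using x_notin l by auto
      ultimately show "z < x" by simp
    qed
    moreover have "take m us = [] \<or> (last (take m us), x) \<in> R"
    proof (cases "m = 0")
      case False
      then have "last (take m us) = us ! (m - 1)" using m by (subst last_conv_nth) auto
      then show ?thesis using False m m2 us_nth[of "m - 1"] J_iff[of m] by simp
    qed simp
    moreover have "vs = [] \<or> \<not> x > hd vs" "vs = [] \<or> hd vs \<noteq> x"
      using nf x_notin(2) unfolding fixed by auto
    then have "vs = [] \<or> x < hd vs" by linarith
    ultimately show ?thesis unfolding w_eq by (rule looseI)
  qed
  moreover have "\<not> fixed_at P r \<omega> w i" if lo: "loose R w x"
  proof -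
    obtain us1 us2 where u: "us = us1 @ us2" "\<forall>z\<in>set us2. z < x"
      "us1 = [] \<or> (last us1, x) \<in> R" "vs = [] \<or> x < hd vs"
      using lo d unfolding w_eq by (rule looseE)
    have "us = [] \<or> last us < x" using u(1-3) R_less by (cases "us2 = []") auto
    moreover have False if "L \<noteq> {}" "Max L > max0 J"
    proof -
      have maxL: "Max L \<in> L" using Max_in[OF finL] that by simp
      define l where "l = Max L"
      have l: "1 \<le> l" "l < i" "letter w l > x"
        using maxL by (auto simp: l_def L_def larger_before_def x_def)
      have "l \<le> length us1"
      proof (rule ccontr)
        assume "\<not> l \<le> length us1"
        then have "us ! (l - 1) = us2 ! (l - 1 - length us1)" "l - 1 - length us1 < length us2"
          using l len unfolding u(1) by (auto simp: nth_append)
        then have "us ! (l - 1) \<in> set us2" by simp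
        then have "us ! (l - 1) < x" using u(2) by blast
        moreover have "us ! (l - 1) = letter w l" using us_nth[of "l - 1"] l len by simp
        ultimately show False using l(3) by simp
      qed
      then have "us1 \<noteq> []" using l by auto
      then have "last us1 = us ! (length us1 - 1)"
        unfolding u(1) by (simp add: last_conv_nth nth_append)
      also have "\<dots> = letter w (length us1)"
        using us_nth[of "length us1 - 1"] \<open>us1 \<noteq> []\<close> unfolding u(1)
        by (cases us1) auto
      finally have "(letter w (length us1), x) \<in> R" using u(3) \<open>us1 \<noteq> []\<close> by simp
      moreover have "1 \<le> length us1" using \<open>us1 \<noteq> []\<close> by (simp add: Suc_le_eq)
      moreover have "length us1 \<le> length w" unfolding w_eq u(1) by simp
      ultimately have "length us1 \<in> J" unfolding J_iff by simp
      then have "length us1 \<le> max0 J" using finJ by (auto simp: max0_def)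
      then show False using \<open>l \<le> length us1\<close> that l_def by simp
    qed
    ultimately show ?thesis using u(4) unfolding fixed by auto
  qed
  ultimately show ?thesis unfolding x_def by blast
qed

lemma fix_count_eq:
  assumes "w \<in> linexts R {1..card P}"
  shows "fix_count P r \<omega> w = card (fixed_labels R w)"
proof -
  have "{letter w i | i. 1 \<le> i \<and> i \<le> length w \<and> fixed_at P r \<omega> w i} = fixed_labels R w"
  proof (intro set_eqI iffI)
    fix x assume "x \<in> {letter w i | i. 1 \<le> i \<and> i \<le> length w \<and> fixed_at P r \<omega> w i}"
    then show "x \<in> fixed_labels R w"
      using fixed_at_iff[OF assms] by (auto simp: fixed_labels_def letter_def)
  next
    fix x assume x: "x \<in> fixed_labels R w"
    then obtain j where "j < length w" "x = w ! j" by (auto simp: fixed_labels_def in_set_conv_nth)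
    then have "x = letter w (Suc j)" "1 \<le> Suc j" "Suc j \<le> length w" by (auto simp: letter_def)
    then show "x \<in> {letter w i | i. 1 \<le> i \<and> i \<le> length w \<and> fixed_at P r \<omega> w i}"
      using x fixed_at_iff[OF assms] unfolding fixed_labels_def by blast
  qed
  then show ?thesis by (simp add: fix_count_def)
qed

lemma inv_omega:
  assumes "a \<in> {1..card P}"
  shows "inv_into P \<omega> a \<in> P" "\<omega> (inv_into P \<omega> a) = a"
  using assms img by (metis inv_into_into, metis f_inv_into_f)

lemma omega_mem: "x \<in> P \<Longrightarrow> \<omega> x \<in> {1..card P}"
  using img by auto

lemma rises_transfer:
  "rises r P (\<lambda>x\<in>P. h (\<omega> x)) = {x \<in> P. \<omega> x \<in> rises R {1..card P} h}"
proof (intro set_eqI iffI)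
  fix x assume x: "x \<in> rises r P (\<lambda>x\<in>P. h (\<omega> x))"
  then have xP: "x \<in> P" by (simp add: rises_def)
  have "h b < h (\<omega> x)" if b: "b \<in> {1..card P}" "(b, \<omega> x) \<in> R" for b
  proof -
    have "(inv_into P \<omega> b, x) \<in> r"
      using R_iff[OF inv_omega(1)[OF b(1)] xP] inv_omega(2)[OF b(1)] b(2) by metis
    moreover note inv_omega[OF b(1)]
    ultimately show ?thesis using x xP by (fastforce simp: rises_def)
  qed
  then show "x \<in> {x \<in> P. \<omega> x \<in> rises R {1..card P} h}"
    using x xP omega_mem[OF xP] by (simp add: rises_def)
next
  fix x assume x: "x \<in> {x \<in> P. \<omega> x \<in> rises R {1..card P} h}"
  then show "x \<in> rises r P (\<lambda>x\<in>P. h (\<omega> x))"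
    using omega_mem R_iff by (simp add: rises_def)
qed

lemma weak_maps_transfer:
  "bij_betw (\<lambda>h. \<lambda>x\<in>P. h (\<omega> x)) (weak_maps R {1..card P} n) (weak_maps r P n)"
proof (rule bij_betwI')
  fix h k assume h: "h \<in> weak_maps R {1..card P} n" and k: "k \<in> weak_maps R {1..card P} n"
  show "((\<lambda>x\<in>P. h (\<omega> x)) = (\<lambda>x\<in>P. k (\<omega> x))) = (h = k)"
  proof
    assume eq: "(\<lambda>x\<in>P. h (\<omega> x)) = (\<lambda>x\<in>P. k (\<omega> x))"
    show "h = k"
    proof (rule extensionalityI)
      show "h \<in> extensional {1..card P}" "k \<in> extensional {1..card P}"
        using h k by (auto simp: weak_maps_def PiE_iff)
      fix a assume "a \<in> {1..card P}"
      then show "h a = k a" using fun_cong[OF eq, of "inv_into P \<omega> a"] inv_omega[of a] by simp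
    qed
  qed simp
next
  fix h assume "h \<in> weak_maps R {1..card P} n"
  then show "(\<lambda>x\<in>P. h (\<omega> x)) \<in> weak_maps r P n"
    using omega_mem R_iff by (fastforce simp: weak_maps_def PiE_iff)
next
  fix g assume g: "g \<in> weak_maps r P n"
  define h where "h = (\<lambda>a\<in>{1..card P}. g (inv_into P \<omega> a))"
  have "h \<in> weak_maps R {1..card P} n"
    unfolding weak_maps_def
  proof (intro CollectI conjI ballI impI)
    show "h \<in> {1..card P} \<rightarrow>\<^sub>E {0..n}"
      using g inv_omega(1) by (auto simp: h_def weak_maps_def PiE_iff)
    fix a b assume ab: "a \<in> {1..card P}" "b \<in> {1..card P}" "(a, b) \<in> R"
    then have "(inv_into P \<omega> a, inv_into P \<omega> b) \<in> r" using inv_iff by blast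
    then show "h a \<le> h b"
      using g ab inv_omega(1)[OF ab(1)] inv_omega(1)[OF ab(2)] unfolding weak_maps_def h_def by simp
  qed
  moreover have "g = (\<lambda>x\<in>P. h (\<omega> x))"
  proof (rule extensionalityI)
    show "g \<in> extensional P" using g by (simp add: weak_maps_def PiE_iff)
    fix x assume "x \<in> P"
    then show "g x = (\<lambda>x\<in>P. h (\<omega> x)) x" using omega_mem inj by (simp add: h_def)
  qed simp
  ultimately show "\<exists>h\<in>weak_maps R {1..card P} n. g = (\<lambda>x\<in>P. h (\<omega> x))" by blast
qed

lemma card_rises_transfer: "card (rises r P (\<lambda>x\<in>P. h (\<omega> x))) = card (rises R {1..card P} h)"
proof (rule bij_betw_same_card)
  have "rises R {1..card P} h \<subseteq> \<omega> ` P" unfolding img by (auto simp: rises_def)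
  then have "\<omega> ` {x \<in> P. \<omega> x \<in> rises R {1..card P} h} = rises R {1..card P} h" by auto
  moreover have "inj_on \<omega> {x \<in> P. \<omega> x \<in> rises R {1..card P} h}"
    by (rule inj_on_subset[OF inj]) auto
  ultimately show "bij_betw \<omega> (rises r P (\<lambda>x\<in>P. h (\<omega> x))) (rises R {1..card P} h)"
    unfolding rises_transfer bij_betw_def by simp
qed

theorem sum_weak_maps_words:
  fixes y :: "'b :: comm_semiring_1"
  shows "(\<Sum>g\<in>weak_maps r P n. y ^ card (rises r P g)) =
    (\<Sum>k = 0..card P. \<Sum>w\<in>linext_words P r \<omega>.
       of_nat (binom (card P - fix_count P r \<omega> w) (int k - int (fix_count P r \<omega> w))
               * ((n + des w) choose k)) * y ^ k)"
proof -
  have "(\<Sum>g\<in>weak_maps r P n. y ^ card (rises r P g)) =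
      (\<Sum>h\<in>weak_maps R {1..card P} n. y ^ card (rises R {1..card P} h))"
    unfolding sum.reindex_bij_betw[OF weak_maps_transfer, symmetric] card_rises_transfer ..
  also have "\<dots> = (\<Sum>k = 0..card P. \<Sum>w\<in>linexts R {1..card P}.
       of_nat (binom (card P - card (fixed_labels R w)) (int k - int (card (fixed_labels R w)))
               * ((n + des w) choose k)) * y ^ k)"
    using sum_weak_maps[of "{1..card P}" y n] by simp
  also have "\<dots> = (\<Sum>k = 0..card P. \<Sum>w\<in>linext_words P r \<omega>.
       of_nat (binom (card P - fix_count P r \<omega> w) (int k - int (fix_count P r \<omega> w))
               * ((n + des w) choose k)) * y ^ k)"
    unfolding linext_words_eq by (intro sum.cong refl) (simp only: fix_count_eq)
  finally show ?thesis .
qed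

end

section \<open>Connected components and the hexagonal lattice\<close>

definition component :: "'a rel \<Rightarrow> 'a set \<Rightarrow> ('a, 'a \<times> 'a) pre_digraph" where
  "component E S = with_proj \<lparr>pverts = S, parcs = E \<inter> S \<times> S\<rparr>"

lemma rtrancl_on_eq:
  assumes "E \<subseteq> V \<times> V" "u \<in> V"
  shows "(u, v) \<in> rtrancl_on V E \<longleftrightarrow> (u, v) \<in> E\<^sup>*"
proof
  assume "(u, v) \<in> rtrancl_on V E"
  then show "(u, v) \<in> E\<^sup>*"
    by (induction rule: rtrancl_on.induct) (auto intro: rtrancl.intros)
next
  assume "(u, v) \<in> E\<^sup>*"
  then show "(u, v) \<in> rtrancl_on V E"
    by (induction rule: rtrancl_induct) (use assms in \<open>auto intro: rtrancl_on.intros\<close>)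
qed

lemma sccs_symmetric:
  assumes E: "parcs K \<subseteq> pverts K \<times> pverts K" and sy: "sym (parcs K)"
  shows "pre_digraph.sccs (with_proj K) = (\<lambda>v. component (parcs K) ((parcs K)\<^sup>* `` {v})) ` pverts K"
proof -
  interpret K: pair_sym_digraph K
    by unfold_locales (use E sy in \<open>auto simp: symmetric_def\<close>)
  have reach: "u \<rightarrow>\<^sup>*\<^bsub>with_proj K\<^esub> v \<longleftrightarrow> (u, v) \<in> (parcs K)\<^sup>*" if "u \<in> pverts K" for u v
    using rtrancl_on_eq[OF E that] by (simp add: reachable_def)
  have scc_of: "pre_digraph.scc_of (with_proj K) v = (parcs K)\<^sup>* `` {v}" if v: "v \<in> pverts K" for v
  proof -
    have "u \<in> pverts K" if "(v, u) \<in> (parcs K)\<^sup>*" for u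
      using that v E by (induction rule: rtrancl_induct) auto
    moreover have "sym ((parcs K)\<^sup>*)" using sy by (rule sym_rtrancl)
    ultimately show ?thesis
      unfolding K.scc_of_def using v reach by (auto dest: symD)
  qed
  have "with_proj K \<restriction> S = component (parcs K) S" for S
    by (auto simp: induce_subgraph_def component_def with_proj_def)
  then show ?thesis
    unfolding K.sccs_conv_sccs_verts K.sccs_verts_conv_scc_of image_image
    using scc_of by (intro image_cong) auto
qed

definition edge_comp :: "'a rel \<Rightarrow> 'a \<Rightarrow> bool" where
  "edge_comp E x \<longleftrightarrow> (\<exists>u. E `` {x} = {u} \<and> E `` {u} = {x})"

lemma rtrancl_closed:
  assumes "v \<in> S" "\<And>x. x \<in> S \<Longrightarrow> E `` {x} \<subseteq> S"
  shows "E\<^sup>* `` {v} \<subseteq> S"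
proof
  fix u assume "u \<in> E\<^sup>* `` {v}"
  then have "(v, u) \<in> E\<^sup>*" by simp
  then show "u \<in> S" by (induction rule: rtrancl_induct) (use assms in auto)
qed

lemma complete2_component_iff:
  assumes irr: "irrefl E" and sy: "sym E"
  shows "complete_digraph 2 (component E (E\<^sup>* `` {v})) \<longleftrightarrow> edge_comp E v"
proof
  let ?S = "E\<^sup>* `` {v}"
  assume "complete_digraph 2 (component E ?S)"
  then have c: "card ?S = 2" and e: "E \<inter> ?S \<times> ?S = {(u, w). (u, w) \<in> ?S \<times> ?S \<and> u \<noteq> w}"
    by (auto simp: component_def complete_digraph_pair_def)
  have "v \<in> ?S" by auto
  with c obtain u where S: "?S = {v, u}" "u \<noteq> v"
    by (metis card_2_iff doubleton_eq_iff insertE singletonD)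
  have cl: "E `` {x} \<subseteq> ?S" if "x \<in> ?S" for x using that by (auto intro: rtrancl_into_rtrancl)
  have "(v, u) \<in> E" "(u, v) \<in> E" using e S by auto
  moreover have "(v, v) \<notin> E" "(u, u) \<notin> E" using irr by (auto simp: irrefl_def)
  moreover have "E `` {v} \<subseteq> {v, u}" "E `` {u} \<subseteq> {v, u}" using cl unfolding S by auto
  ultimately show "edge_comp E v" unfolding edge_comp_def by (intro exI[of _ u]) blast
next
  assume "edge_comp E v"
  then obtain u where u: "E `` {v} = {u}" "E `` {u} = {v}" by (auto simp: edge_comp_def)
  have ne: "u \<noteq> v" using u irr by (auto simp: irrefl_def)
  have "E\<^sup>* `` {v} \<subseteq> {v, u}" by (rule rtrancl_closed) (use u in auto)
  moreover have "(v, u) \<in> E\<^sup>*" using u by auto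
  ultimately have S: "E\<^sup>* `` {v} = {v, u}" by auto
  show "complete_digraph 2 (component E (E\<^sup>* `` {v}))"
    unfolding component_def complete_digraph_pair_def S using u ne by auto
qed

lemma is_C6_iff:
  "is_C6 (with_proj K) \<longleftrightarrow> (\<exists>c. inj_on c {..<6} \<and> pverts K = c ` {..<6} \<and>
     parcs K = (\<lambda>(i, j). (c i, c j)) ` parcs cycle6)"
proof
  assume "is_C6 (with_proj K)"
  then obtain f where f: "pre_digraph.digraph_isomorphism (with_proj cycle6) f"
    "with_proj K = app_iso f (with_proj cycle6)"
    by (auto simp: is_C6_def digraph_iso_def)
  let ?c = "iso_verts f"
  have inj: "inj_on ?c {..<6}"
    using f(1) by (simp add: pre_digraph.digraph_isomorphism_def cycle6_def)
  have V: "pverts K = ?c ` {..<6}"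
    using arg_cong[OF f(2), of verts] by (simp add: app_iso_def cycle6_def)
  have A: "parcs K = iso_arcs f ` parcs cycle6"
    using arg_cong[OF f(2), of arcs] by (simp add: app_iso_def)
  have ht: "iso_head f = snd" "iso_tail f = fst"
    using arg_cong[OF f(2), of head] arg_cong[OF f(2), of tail] by (simp_all add: app_iso_def)
  have "iso_arcs f a = (case a of (i, j) \<Rightarrow> (?c i, ?c j))" if "a \<in> parcs cycle6" for a
  proof -
    have "?c (fst a) = iso_tail f (iso_arcs f a)" "?c (snd a) = iso_head f (iso_arcs f a)"
      using f(1) that by (auto simp: pre_digraph.digraph_isomorphism_def)
    then show ?thesis unfolding ht by (auto simp: prod_eq_iff split: prod.splits)
  qed
  then have "parcs K = (\<lambda>(i, j). (?c i, ?c j)) ` parcs cycle6" unfolding A by (intro image_cong) auto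
  then show "\<exists>c. inj_on c {..<6} \<and> pverts K = c ` {..<6} \<and>
     parcs K = (\<lambda>(i, j). (c i, c j)) ` parcs cycle6"
    using inj V by blast
next
  assume "\<exists>c. inj_on c {..<6} \<and> pverts K = c ` {..<6} \<and>
     parcs K = (\<lambda>(i, j). (c i, c j)) ` parcs cycle6"
  then obtain c where c: "inj_on c {..<6}" "pverts K = c ` {..<6}"
     "parcs K = (\<lambda>(i, j). (c i, c j)) ` parcs cycle6" by blast
  define f where "f = \<lparr>iso_verts = c, iso_arcs = (\<lambda>(i, j). (c i, c j)), iso_head = snd, iso_tail = fst\<rparr>"
  have wf: "wf_digraph (with_proj cycle6)" by unfold_locales (auto simp: cycle6_def)
  have sub: "parcs cycle6 \<subseteq> {..<6} \<times> {..<6}" by (auto simp: cycle6_def)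
  have "inj_on (\<lambda>(i, j). (c i, c j)) (parcs cycle6)"
    using c(1) sub by (auto simp: inj_on_def)
  then have "pre_digraph.digraph_isomorphism (with_proj cycle6) f"
    using c(1) wf by (auto simp: pre_digraph.digraph_isomorphism_def f_def cycle6_def)
  moreover have "with_proj K = app_iso f (with_proj cycle6)"
    using c by (auto simp: app_iso_def f_def with_proj_def cycle6_def)
  ultimately show "is_C6 (with_proj K)" by (auto simp: is_C6_def digraph_iso_def)
qed

abbreviation "adjacent u v \<equiv> (u, v) \<in> parcs hex_lattice"

lemma adjacent_iff:
  "adjacent (a, b) v \<longleftrightarrow> v = (a - 1, b) \<or> v = (a + 1, b) \<or> v = (a, if even (a + b) then b + 1 else b - 1)"
proof -
  obtain c d where v: "v = (c, d)" by (cases v)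
  have "\<bar>b - d\<bar> = 1 \<and> even (a + min b d) \<longleftrightarrow> d = (if even (a + b) then b + 1 else b - 1)"
    by presburger
  moreover have "\<bar>a - c\<bar> = 1 \<longleftrightarrow> c = a - 1 \<or> c = a + 1" by presburger
  ultimately show ?thesis unfolding hex_lattice_def v by auto
qed

lemma adjacent_sym: "adjacent u v \<Longrightarrow> adjacent v u"
  by (cases u, cases v) (auto simp: hex_lattice_def abs_minus_commute min.commute)

lemma mem_hexagon_verts: "(c, d) \<in> hexagon_verts (a, k) \<longleftrightarrow> c \<in> {a, a + 1, a + 2} \<and> d \<in> {k, k + 1}"
  by (auto simp: hexagon_verts_def)

lemma hexagon_verts_eq:
  "hexagon_verts (a, k) = {(a, k), (a + 1, k), (a + 2, k), (a + 2, k + 1), (a + 1, k + 1), (a, k + 1)}"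
proof -
  have "{a..a + 2} = {a, a + 1, a + 2}" "{k..k + 1} = {k, k + 1}" by auto
  then have "hexagon_verts (a, k) = {a, a + 1, a + 2} \<times> {k, k + 1}" by (simp add: hexagon_verts_def)
  then show ?thesis by blast
qed

lemma card_hexagon_verts: "card (hexagon_verts h) = 6"
  by (simp add: hexagon_verts_def card_cartesian_product)

text \<open>
  The displacements along the twelve non-backtracking walks of length 3 in the lattice. They are written
  for a start whose vertical edge goes down; \<open>orient\<close> reflects them for the other vertices.
\<close>

definition walks3 :: "((int \<times> int) \<times> (int \<times> int) \<times> (int \<times> int)) list" where
  "walks3 = [((-1, 0), (-2, 0), (-3, 0)),
    ((-1, 0), (-2, 0), (-2, 1)),
    ((-1, 0), (-1, -1), (-2, -1)),
    ((-1, 0), (-1, -1), (0, -1)),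
    ((1, 0), (2, 0), (3, 0)),
    ((1, 0), (2, 0), (2, 1)),
    ((1, 0), (1, -1), (0, -1)),
    ((1, 0), (1, -1), (2, -1)),
    ((0, 1), (-1, 1), (-2, 1)),
    ((0, 1), (-1, 1), (-1, 2)),
    ((0, 1), (1, 1), (2, 1)),
    ((0, 1), (1, 1), (1, 2))]"

definition shift :: "int \<Rightarrow> vertex \<Rightarrow> int \<times> int \<Rightarrow> vertex" where
  "shift s v d = (fst v + fst d, snd v + s * snd d)"

definition orient :: "vertex \<Rightarrow> int" where
  "orient v = (if even (fst v + snd v) then 1 else - 1)"

lemma walk3:
  assumes "adjacent v0 v1" "adjacent v1 v2" "adjacent v2 v3" "v2 \<noteq> v0" "v3 \<noteq> v1"
  shows "\<exists>(p, q, r)\<in>set walks3. v1 = shift (orient v0) v0 p \<and> v2 = shift (orient v0) v0 q \<and> v3 = shift (orient v0) v0 r"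
proof -
  obtain a b where v0: "v0 = (a, b)" by (cases v0)
  define s where "s = orient v0"
  have s: "if s = 1 then even a = even b else s = -1 \<and> even a \<noteq> even b"
    by (auto simp: s_def v0 orient_def)
  have v1: "v1 = (a - 1, b) \<or> v1 = (a + 1, b) \<or> v1 = (a, b + s)"
    using assms(1) s unfolding adjacent_iff v0 by (auto split: if_splits)
  then have "(v1 = (a - 1, b) \<and> v2 = (a - 2, b)) \<or> (v1 = (a - 1, b) \<and> v2 = (a - 1, b - s)) \<or>
      (v1 = (a + 1, b) \<and> v2 = (a + 2, b)) \<or> (v1 = (a + 1, b) \<and> v2 = (a + 1, b - s)) \<or>
      (v1 = (a, b + s) \<and> v2 = (a - 1, b + s)) \<or> (v1 = (a, b + s) \<and> v2 = (a + 1, b + s))"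
    using assms(2,4) s by (elim disjE) (auto simp: adjacent_iff v0 split: if_splits)
  then show ?thesis using assms(3,5) s unfolding s_def[symmetric]
    by (elim disjE conjE) (auto simp: adjacent_iff v0 walks3_def shift_def split: if_splits)
qed

definition rel_hexagons :: "(int \<times> int) list" where
  "rel_hexagons = [(-2, 0), (0, 0), (-1, -1)]"

definition in_rel :: "int \<times> int \<Rightarrow> int \<times> int \<Rightarrow> bool" where
  "in_rel h v \<longleftrightarrow> fst v - fst h \<in> {0, 1, 2} \<and> snd v - snd h \<in> {0, 1}"

text \<open>
  Two such walks to the same endpoint with different first steps form a hexagon around the start. This is
  a finite check on explicit numbers.
\<close>

lemma walks3_meet:
  "\<forall>(p, q, r)\<in>set walks3. \<forall>(p', q', r')\<in>set walks3. r = r' \<longrightarrow> p \<noteq> p' \<longrightarrow>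
     (\<exists>h\<in>set rel_hexagons. list_all (in_rel h) [(0, 0), p, q, r, q', p'])"
  unfolding walks3_def rel_hexagons_def in_rel_def by simp

text \<open>
  A 6-cycle splits into two walks of length 3 from \<open>v0\<close> to the opposite vertex \<open>v3\<close>.
\<close>

lemma hexagon_of_cycle:
  assumes "adjacent v0 v1" "adjacent v1 v2" "adjacent v2 v3" "adjacent v3 v4" "adjacent v4 v5" "adjacent v5 v0"
    and d: "distinct [v0, v1, v2, v3, v4, v5]"
  obtains h where "even (fst h + snd h)" "{v0, v1, v2, v3, v4, v5} \<subseteq> hexagon_verts h"
proof -
  define s where "s = orient v0"
  define sh where "sh = shift s v0"
  have s: "s = 1 \<and> even (fst v0 + snd v0) \<or> s = -1 \<and> odd (fst v0 + snd v0)"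
    by (auto simp: s_def orient_def)
  have rev: "adjacent v0 v5" "adjacent v5 v4" "adjacent v4 v3"
    using assms adjacent_sym by blast+
  obtain p q r where 1: "(p, q, r) \<in> set walks3" "v1 = sh p" "v2 = sh q" "v3 = sh r"
    using walk3[OF assms(1-3)] d unfolding sh_def s_def by auto
  obtain p' q' r' where 2: "(p', q', r') \<in> set walks3" "v5 = sh p'" "v4 = sh q'" "v3 = sh r'"
    using walk3[OF rev] d unfolding sh_def s_def by auto
  have inj: "sh x = sh y \<longleftrightarrow> x = y" for x y using s by (auto simp: sh_def shift_def prod_eq_iff)
  have "r = r'" "p \<noteq> p'" using 1 2 d inj by auto
  then obtain h where h: "h \<in> set rel_hexagons" "list_all (in_rel h) [(0, 0), p, q, r, q', p']"
    using walks3_meet 1(1) 2(1) by fastforce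
  \<comment> \<open>Under reflection the upper row of a hexagon becomes its lower row, hence the shift by one.\<close>
  define g where "g = (fst v0 + fst h, if s = 1 then snd v0 + snd h else snd v0 - snd h - 1)"
  have "even (fst g + snd g)" using h(1) s by (auto simp: g_def rel_hexagons_def)
  moreover have "sh x \<in> hexagon_verts g" if "in_rel h x" for x
    using that s by (auto simp: in_rel_def sh_def shift_def g_def hexagon_verts_def)
  moreover have "v0 = sh (0, 0)" by (simp add: sh_def shift_def)
  ultimately show thesis using that[of g] h(2) 1 2 by simp
qed

definition hexagon_arcs :: "hexagon \<Rightarrow> (vertex \<times> vertex) set" where
  "hexagon_arcs h = {(u, v). adjacent u v \<and> u \<in> hexagon_verts h \<and> v \<in> hexagon_verts h}"

definition hexagon_cycle :: "hexagon \<Rightarrow> nat \<Rightarrow> vertex" where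
  "hexagon_cycle h i = (let a = fst h; k = snd h in
     [(a, k), (a + 1, k), (a + 2, k), (a + 2, k + 1), (a + 1, k + 1), (a, k + 1)] ! i)"

lemma lessThan_6: "{..<6} = {0, 1, 2, 3, 4, 5 :: nat}"
proof -
  have "{..<6} = {5, 4, 3, 2, 1, 0 :: nat}" by (simp add: lessThan_nat_numeral lessThan_Suc)
  then show ?thesis by blast
qed

lemma cycle6_arcs: "parcs cycle6 = (\<Union>i<6. {(i, Suc i mod 6), (Suc i mod 6, i)})"
  by (auto simp: cycle6_def)

lemma hexagon_cycle_image: "hexagon_cycle h ` {..<6} = hexagon_verts h"
  by (cases h) (simp add: lessThan_6 hexagon_verts_eq hexagon_cycle_def)

lemma hexagon_cycle_arcs:
  assumes "even (fst h + snd h)"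
  shows "(\<lambda>(i, j). (hexagon_cycle h i, hexagon_cycle h j)) ` parcs cycle6 = hexagon_arcs h"
proof -
  obtain a k where h: "h = (a, k)" by (cases h)
  have ev: "even a = even k" using assms h by auto
  have im: "(\<lambda>(i, j). (hexagon_cycle h i, hexagon_cycle h j)) ` parcs cycle6 =
    {((a, k), (a + 1, k)), ((a + 1, k), (a + 2, k)), ((a + 2, k), (a + 2, k + 1)),
     ((a + 2, k + 1), (a + 1, k + 1)), ((a + 1, k + 1), (a, k + 1)), ((a, k + 1), (a, k)),
     ((a + 1, k), (a, k)), ((a + 2, k), (a + 1, k)), ((a + 2, k + 1), (a + 2, k)),
     ((a + 1, k + 1), (a + 2, k + 1)), ((a, k + 1), (a + 1, k + 1)), ((a, k), (a, k + 1))}" (is "_ = ?T")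
    unfolding cycle6_arcs lessThan_6 h by (simp add: hexagon_cycle_def insert_commute)
  have sub: "?T \<subseteq> hexagon_arcs h"
    using ev by (simp add: hexagon_arcs_def h mem_hexagon_verts adjacent_iff)
  have "e \<in> ?T" if e0: "e \<in> hexagon_arcs h" for e
  proof -
    obtain u v where e: "e = (u, v)" "adjacent u v" "u \<in> hexagon_verts h" "v \<in> hexagon_verts h"
      using e0 unfolding hexagon_arcs_def by blast
    from e(3) show ?thesis
      unfolding h hexagon_verts_eq insert_iff empty_iff
      by (elim disjE FalseE) (use e(1,2,4) ev in \<open>auto simp: adjacent_iff h mem_hexagon_verts\<close>)
  qed
  then show ?thesis unfolding im by (intro subset_antisym[OF sub] subsetI)
qed

lemma inj_hexagon_cycle: "inj_on (hexagon_cycle h) {..<6}"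
  by (rule eq_card_imp_inj_on) (simp_all add: hexagon_cycle_image card_hexagon_verts)

section \<open>Clar covers\<close>

lemma hexagon_arcs_sub: "hexagon_arcs h \<subseteq> hexagon_verts h \<times> hexagon_verts h"
  by (auto simp: hexagon_arcs_def)

lemma hexagon_arcsD: "(x, y) \<in> hexagon_arcs h \<Longrightarrow> x \<in> hexagon_verts h \<and> y \<in> hexagon_verts h"
  by (auto simp: hexagon_arcs_def)

lemma verts_component: "verts (component E S) = S"
  by (simp add: component_def)

lemma adjacent_irrefl: "\<not> adjacent v v"
  by (cases v) (auto simp: adjacent_iff)

lemma sym_hexagon_arcs: "sym (hexagon_arcs h)"
  by (auto simp: sym_def hexagon_arcs_def adjacent_sym)

lemma finite_hexagon_verts [simp]: "finite (hexagon_verts h)"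
  by (simp add: hexagon_verts_def)

lemma hexagon_arcs_edge:
  assumes "i < 6" "even (fst h + snd h)"
  shows "(hexagon_cycle h i, hexagon_cycle h (Suc i mod 6)) \<in> hexagon_arcs h"
  unfolding hexagon_cycle_arcs[OF assms(2), symmetric] cycle6_arcs using assms(1) by auto

lemma hexagon_verts_determine:
  assumes "even (fst h + snd h)" "even (fst g + snd g)"
    and "\<forall>x\<in>hexagon_verts h. x \<in> hexagon_verts g"
  shows "h = g"
proof -
  obtain a k b l where hg: "h = (a, k)" "g = (b, l)" by (cases h, cases g)
  have "(a, k) \<in> hexagon_verts g" "(a + 2, k + 1) \<in> hexagon_verts g"
    using assms(3) unfolding hg(1) by (auto simp: mem_hexagon_verts)
  then show ?thesis unfolding hg by (auto simp: mem_hexagon_verts)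
qed

text \<open>
  Agreement of all neighbourhoods on the hexagon: its boundary is then a component of \<open>E\<close>. This and
  \<open>edge_comp\<close> describe components locally, without reachability.
\<close>

definition hexagon_comp :: "vertex rel \<Rightarrow> hexagon \<Rightarrow> bool" where
  "hexagon_comp E h \<longleftrightarrow> (\<forall>x\<in>hexagon_verts h. E `` {x} = hexagon_arcs h `` {x})"

lemma hexagon_comp_reach:
  assumes ev: "even (fst h + snd h)" and h: "hexagon_comp E h" and v: "v \<in> hexagon_verts h"
  shows "E\<^sup>* `` {v} = hexagon_verts h"
proof
  show "E\<^sup>* `` {v} \<subseteq> hexagon_verts h"
    using v by (rule rtrancl_closed) (use h in \<open>auto simp: hexagon_comp_def dest: hexagon_arcsD\<close>)
  have sub: "hexagon_arcs h \<subseteq> E"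
  proof (rule subrelI)
    fix x y assume "(x, y) \<in> hexagon_arcs h"
    moreover from this have "x \<in> hexagon_verts h" using hexagon_arcsD by blast
    ultimately show "(x, y) \<in> E" using h by (auto simp: hexagon_comp_def)
  qed
  let ?c = "hexagon_cycle h"
  have from0: "(?c 0, ?c i) \<in> (hexagon_arcs h)\<^sup>*" if "i < 6" for i
    using that
  proof (induction i)
    case (Suc i)
    then have "(?c i, ?c (Suc i)) \<in> hexagon_arcs h" using hexagon_arcs_edge[OF _ ev, of i] by simp
    then show ?case using Suc by (meson Suc_lessD rtrancl_into_rtrancl)
  qed simp
  have sy: "sym ((hexagon_arcs h)\<^sup>*)" using sym_hexagon_arcs by (rule sym_rtrancl)
  have conn: "(u, w) \<in> (hexagon_arcs h)\<^sup>*" if "u \<in> hexagon_verts h" "w \<in> hexagon_verts h" for u w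
  proof -
    have "(?c 0, u) \<in> (hexagon_arcs h)\<^sup>*" "(?c 0, w) \<in> (hexagon_arcs h)\<^sup>*"
      using that from0 unfolding hexagon_cycle_image[symmetric] by auto
    then show ?thesis using sy by (meson rtrancl_trans symD)
  qed
  have "(hexagon_arcs h)\<^sup>* \<subseteq> E\<^sup>*" using sub by (rule rtrancl_mono)
  then show "hexagon_verts h \<subseteq> E\<^sup>* `` {v}" using conn[OF v] by blast
qed

lemma hexagon_comp_component:
  assumes "hexagon_comp E h"
  shows "E \<inter> hexagon_verts h \<times> hexagon_verts h = hexagon_arcs h"
  using assms hexagon_arcs_sub[of h] unfolding hexagon_comp_def by blast

lemma is_C6_hexagon:
  assumes "even (fst h + snd h)" "hexagon_comp E h"
  shows "is_C6 (component E (hexagon_verts h))"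
  using inj_hexagon_cycle[of h] hexagon_cycle_image[of h] hexagon_cycle_arcs[OF assms(1)]
  unfolding component_def is_C6_iff hexagon_comp_component[OF assms(2)]
  by (intro exI[of _ "hexagon_cycle h"]) auto

text \<open>
  The vertices of the component are those of a lattice hexagon; the arcs agree because both sets of arcs
  have the cardinality of \<open>parcs cycle6\<close>.
\<close>

lemma hexagon_of_C6:
  assumes E: "E \<subseteq> parcs hex_lattice" and C6: "is_C6 (component E (E\<^sup>* `` {v}))"
  obtains h where "even (fst h + snd h)" "E\<^sup>* `` {v} = hexagon_verts h" "hexagon_comp E h" "v \<in> hexagon_verts h"
proof -
  let ?S = "E\<^sup>* `` {v}"
  obtain c where inj: "inj_on c {..<6}" and S: "?S = c ` {..<6}"
    and A: "E \<inter> ?S \<times> ?S = (\<lambda>(i, j). (c i, c j)) ` parcs cycle6"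
    using C6 unfolding component_def is_C6_iff by auto
  have adj: "adjacent (c i) (c (Suc i mod 6))" if "i < 6" for i
  proof -
    have "(i, Suc i mod 6) \<in> parcs cycle6" using that by (auto simp: cycle6_arcs)
    then have "(c i, c (Suc i mod 6)) \<in> E \<inter> ?S \<times> ?S" unfolding A by force
    then show ?thesis using E by auto
  qed
  have "distinct [c 0, c 1, c 2, c 3, c 4, c 5]"
    using inj unfolding lessThan_6 by (auto simp: inj_on_def)
  moreover have "adjacent (c 0) (c 1)" "adjacent (c 1) (c 2)" "adjacent (c 2) (c 3)"
    "adjacent (c 3) (c 4)" "adjacent (c 4) (c 5)" "adjacent (c 5) (c 0)"
    using adj[of 0] adj[of 1] adj[of 2] adj[of 3] adj[of 4] adj[of 5] by (simp_all add: numeral_2_eq_2[symmetric])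
  ultimately obtain h where ev: "even (fst h + snd h)" and sub: "{c 0, c 1, c 2, c 3, c 4, c 5} \<subseteq> hexagon_verts h"
    by (metis hexagon_of_cycle)
  have S': "?S = hexagon_verts h"
  proof (rule card_subset_eq)
    show "?S \<subseteq> hexagon_verts h" using sub unfolding S lessThan_6 by simp
    show "card ?S = card (hexagon_verts h)" unfolding S using inj by (simp add: card_image card_hexagon_verts)
  qed simp
  have arcs: "E \<inter> ?S \<times> ?S = hexagon_arcs h"
  proof (rule card_subset_eq)
    show "finite (hexagon_arcs h)"
      by (rule finite_subset[OF hexagon_arcs_sub]) simp
    show "E \<inter> ?S \<times> ?S \<subseteq> hexagon_arcs h" unfolding S' using E by (auto simp: hexagon_arcs_def)
    have "inj_on (\<lambda>(i, j). (c i, c j)) (parcs cycle6)"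
      by (rule inj_onI) (use inj in \<open>auto simp: cycle6_def inj_on_def\<close>)
    then have "card (E \<inter> ?S \<times> ?S) = card (parcs cycle6)" unfolding A by (rule card_image)
    also have "\<dots> = card (hexagon_arcs h)"
      unfolding hexagon_cycle_arcs[OF ev, symmetric]
      by (rule card_image[symmetric], rule inj_onI)
        (use inj_hexagon_cycle[of h] in \<open>auto simp: cycle6_def inj_on_def\<close>)
    finally show "card (E \<inter> ?S \<times> ?S) = card (hexagon_arcs h)" .
  qed
  have "hexagon_comp E h"
    unfolding hexagon_comp_def
  proof
    fix x assume x: "x \<in> hexagon_verts h"
    then have xS: "x \<in> ?S" using S' by simp
    have "E `` {x} \<subseteq> ?S" using xS by (auto intro: rtrancl_into_rtrancl)
    then show "E `` {x} = hexagon_arcs h `` {x}"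
      unfolding arcs[symmetric] using xS by auto
  qed
  moreover have "v \<in> hexagon_verts h" unfolding S'[symmetric] by auto
  ultimately show thesis using that ev S' by blast
qed

text \<open>
  The second assumption excludes holes of the size of one hexagon: a hexagon whose boundary
  belongs to the graph is one of the given hexagons.
\<close>

locale hexagon_system =
  fixes H :: "hexagon set"
  assumes even_H: "h \<in> H \<Longrightarrow> even (fst h + snd h)"
    and full_H: "even (fst h + snd h) \<Longrightarrow> hexagon_arcs h \<subseteq> parcs (hexagons_graph H) \<Longrightarrow> h \<in> H"
    and fin_H: "finite H"
begin

abbreviation "V \<equiv> pverts (hexagons_graph H)"
abbreviation "A \<equiv> parcs (hexagons_graph H)"

lemma V_eq: "V = (\<Union>h\<in>H. hexagon_verts h)" by (simp add: hexagons_graph_def)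
lemma A_eq: "A = (\<Union>h\<in>H. hexagon_arcs h)" by (auto simp: hexagons_graph_def hexagon_arcs_def)
lemma A_lattice: "A \<subseteq> parcs hex_lattice" by (auto simp: hexagons_graph_def)
lemma A_sub: "A \<subseteq> V \<times> V" unfolding A_eq V_eq using hexagon_arcs_sub by fastforce
lemma fin_V: "finite V" unfolding V_eq using fin_H by simp
lemma fin_A: "finite A" by (rule finite_subset[OF A_sub]) (simp add: fin_V)
lemma sym_A: "sym A" unfolding A_eq by (intro symI) (blast dest: symD[OF sym_hexagon_arcs])
lemma irrefl_A: "irrefl A" using A_lattice adjacent_irrefl by (auto simp: irrefl_def)

definition local_cover :: "vertex rel \<Rightarrow> bool" where
  "local_cover E \<longleftrightarrow> E \<subseteq> A \<and> sym E \<and>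
     (\<forall>x\<in>V. edge_comp E x \<or> (\<exists>h\<in>H. x \<in> hexagon_verts h \<and> hexagon_comp E h))"

lemma hexagon_comp_mem:
  assumes "E \<subseteq> A" "even (fst h + snd h)" "hexagon_comp E h"
  shows "h \<in> H"
proof (rule full_H[OF assms(2)])
  show "hexagon_arcs h \<subseteq> A" using hexagon_comp_component[OF assms(3)] assms(1) by auto
qed

lemma clar_cover_iff:
  "clar_cover (hexagons_graph H) K \<longleftrightarrow> pverts K = V \<and> local_cover (parcs K)"
proof -
  have span: "spanning (with_proj K) (with_proj (hexagons_graph H)) \<longleftrightarrow> pverts K = V \<and> parcs K \<subseteq> A"
  proof
    assume "spanning (with_proj K) (with_proj (hexagons_graph H))"
    then show "pverts K = V \<and> parcs K \<subseteq> A" by (auto simp: spanning_def subgraph_def)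
  next
    assume a: "pverts K = V \<and> parcs K \<subseteq> A"
    have "wf_digraph (with_proj (hexagons_graph H))" using A_sub by unfold_locales auto
    moreover have "wf_digraph (with_proj K)" using a A_sub by unfold_locales auto
    ultimately show "spanning (with_proj K) (with_proj (hexagons_graph H))"
      using a by (auto simp: spanning_def subgraph_def compatible_def)
  qed
  have sy: "symmetric (with_proj K) \<longleftrightarrow> sym (parcs K)" by (simp add: symmetric_def)
  have comps: "(\<forall>C \<in> pre_digraph.sccs (with_proj K). complete_digraph 2 C \<or> is_C6 C) \<longleftrightarrow>
      (\<forall>x\<in>V. edge_comp (parcs K) x \<or> (\<exists>h\<in>H. x \<in> hexagon_verts h \<and> hexagon_comp (parcs K) h))"
    if K: "pverts K = V" "parcs K \<subseteq> A" "sym (parcs K)"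
  proof -
    let ?E = "parcs K"
    have irr: "irrefl ?E" using K(2) irrefl_A by (auto simp: irrefl_def)
    have lat: "?E \<subseteq> parcs hex_lattice" using K(2) A_lattice by auto
    have C6: "is_C6 (component ?E (?E\<^sup>* `` {x})) \<longleftrightarrow> (\<exists>h\<in>H. x \<in> hexagon_verts h \<and> hexagon_comp ?E h)" for x
    proof
      assume "is_C6 (component ?E (?E\<^sup>* `` {x}))"
      then obtain h where h: "even (fst h + snd h)" "hexagon_comp ?E h" "x \<in> hexagon_verts h"
        using hexagon_of_C6[OF lat] by metis
      then show "\<exists>h\<in>H. x \<in> hexagon_verts h \<and> hexagon_comp ?E h"
        using hexagon_comp_mem[OF K(2)] by blast
    next
      assume "\<exists>h\<in>H. x \<in> hexagon_verts h \<and> hexagon_comp ?E h"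
      then obtain h where "h \<in> H" "x \<in> hexagon_verts h" "hexagon_comp ?E h" by blast
      then show "is_C6 (component ?E (?E\<^sup>* `` {x}))"
        using even_H hexagon_comp_reach is_C6_hexagon by metis
    qed
    have sub: "parcs K \<subseteq> pverts K \<times> pverts K" using K A_sub by auto
    show ?thesis
      unfolding sccs_symmetric[OF sub K(3)] K(1)[symmetric] ball_simps
        complete2_component_iff[OF irr K(3)] C6 ..
  qed
  show ?thesis unfolding clar_cover_def span sy local_cover_def using comps by blast
qed

lemma clar_order_eq:
  assumes "pverts K = V" "local_cover (parcs K)"
  shows "clar_order K = card {h \<in> H. hexagon_comp (parcs K) h}"
proof -
  let ?E = "parcs K"
  have E: "?E \<subseteq> A" "sym ?E" using assms(2) by (auto simp: local_cover_def)
  have lat: "?E \<subseteq> parcs hex_lattice" using E(1) A_lattice by auto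
  have sub: "parcs K \<subseteq> pverts K \<times> pverts K" using E(1) assms(1) A_sub by auto
  have "{C \<in> pre_digraph.sccs (with_proj K). is_C6 C}
      = (\<lambda>h. component ?E (hexagon_verts h)) ` {h \<in> H. hexagon_comp ?E h}" (is "?L = ?R")
  proof (intro set_eqI iffI)
    fix C assume "C \<in> ?L"
    then obtain v where v: "v \<in> V" "C = component ?E (?E\<^sup>* `` {v})" "is_C6 C"
      unfolding sccs_symmetric[OF sub E(2)] assms(1) by auto
    then obtain h where h: "even (fst h + snd h)" "?E\<^sup>* `` {v} = hexagon_verts h" "hexagon_comp ?E h"
      using hexagon_of_C6[OF lat] by metis
    then show "C \<in> ?R" using v hexagon_comp_mem[OF E(1)] by auto
  next
    fix C assume "C \<in> ?R"
    then obtain h where h: "h \<in> H" "hexagon_comp ?E h" "C = component ?E (hexagon_verts h)" by auto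
    obtain v where v: "v \<in> hexagon_verts h" by (metis mem_hexagon_verts insertI1 surj_pair)
    then have "v \<in> V" using h(1) V_eq by auto
    moreover have "C = component ?E (?E\<^sup>* `` {v})"
      using hexagon_comp_reach[OF even_H[OF h(1)] h(2) v] h(3) by simp
    moreover have "is_C6 C" using is_C6_hexagon[OF even_H[OF h(1)] h(2)] h(3) by simp
    ultimately show "C \<in> ?L" unfolding sccs_symmetric[OF sub E(2)] assms(1) by auto
  qed
  moreover have "inj_on (\<lambda>h. component ?E (hexagon_verts h)) {h \<in> H. hexagon_comp ?E h}"
  proof (rule inj_onI)
    fix h g assume hg: "h \<in> {h \<in> H. hexagon_comp ?E h}" "g \<in> {h \<in> H. hexagon_comp ?E h}"
      "component ?E (hexagon_verts h) = component ?E (hexagon_verts g)"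
    then have "hexagon_verts h = hexagon_verts g"
      using hg(3) by (metis verts_component)
    then show "h = g" using hexagon_verts_determine[of h g] hg even_H by auto
  qed
  ultimately show ?thesis unfolding clar_order_def by (simp add: card_image)
qed

end

section \<open>Perfect matchings and sextets\<close>

text \<open>
  The chosen one of the two perfect matchings of a hexagon: right vertical, upper left and lower left
  edge, as symmetric arcs.
\<close>

definition sextet_arcs :: "hexagon \<Rightarrow> vertex rel" where
  "sextet_arcs h = (let a = fst h; k = snd h in
     {((a, k), (a + 1, k)), ((a + 1, k), (a, k)), ((a, k + 1), (a + 1, k + 1)), ((a + 1, k + 1), (a, k + 1)),
      ((a + 2, k), (a + 2, k + 1)), ((a + 2, k + 1), (a + 2, k))})"

lemma sextet_arcs_sub: "even (fst h + snd h) \<Longrightarrow> sextet_arcs h \<subseteq> hexagon_arcs h"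
  by (cases h) (auto simp: sextet_arcs_def hexagon_arcs_def mem_hexagon_verts adjacent_iff)

lemma sym_sextet_arcs: "sym (sextet_arcs h)"
  by (auto simp: sextet_arcs_def sym_def Let_def)

lemma sextet_arcs_ex1: "x \<in> hexagon_verts h \<Longrightarrow> \<exists>!u. (x, u) \<in> sextet_arcs h"
proof -
  assume x: "x \<in> hexagon_verts h"
  obtain a k where h: "h = (a, k)" by (cases h)
  show "\<exists>!u. (x, u) \<in> sextet_arcs h"
    using x unfolding h hexagon_verts_eq insert_iff empty_iff
    by (elim disjE FalseE) (simp_all add: sextet_arcs_def)
qed

text \<open>
  An edge determines the hexagon of which it is a sextet edge: a vertical edge must be its right side, and a
  horizontal edge is its upper or lower left edge depending on parity.
\<close>

lemma sextet_arcs_unique: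
  assumes "even (fst h + snd h)" "even (fst g + snd g)" "e \<in> sextet_arcs h" "e \<in> sextet_arcs g"
  shows "h = g"
proof -
  obtain a k b l where hg: "h = (a, k)" "g = (b, l)" by (cases h, cases g)
  have "even a = even k" "even b = even l" using assms(1,2) hg by auto
  then show ?thesis using assms(3,4) unfolding hg sextet_arcs_def by auto
qed

text \<open>
  The upper middle vertex with its two neighbours pins down the hexagon up to the row, and parity
  decides the row.
\<close>

lemma hexagon_middle_unique:
  assumes "even (fst h + snd h)" "even (fst g + snd g)"
    and "hexagon_arcs h `` {(fst h + 1, snd h)} \<subseteq> hexagon_verts g" "(fst h + 1, snd h) \<in> hexagon_verts g"
  shows "h = g"
proof -
  obtain a k b l where hg: "h = (a, k)" "g = (b, l)" by (cases h, cases g)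
  have "(a, k) \<in> hexagon_arcs h `` {(a + 1, k)}" "(a + 2, k) \<in> hexagon_arcs h `` {(a + 1, k)}"
    by (auto simp: hg hexagon_arcs_def mem_hexagon_verts adjacent_iff)
  then have "(a, k) \<in> hexagon_verts g" "(a + 2, k) \<in> hexagon_verts g" using assms(3) hg by auto
  then show ?thesis using assms(1,2) unfolding hg by (auto simp: mem_hexagon_verts)
qed

lemma sum_Pow_power_card:
  fixes x :: "'a :: comm_semiring_1"
  assumes "finite S"
  shows "(\<Sum>T\<in>Pow S. x ^ card T) = (1 + x) ^ card S"
  using assms
proof (induction S rule: finite_induct)
  case (insert s S)
  have "(\<Sum>T\<in>Pow (insert s S). x ^ card T) = (\<Sum>T\<in>Pow S. x ^ card T) + (\<Sum>T\<in>insert s ` Pow S. x ^ card T)"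
    unfolding Pow_insert using insert.hyps by (intro sum.union_disjoint) auto
  also have "(\<Sum>T\<in>insert s ` Pow S. x ^ card T) = (\<Sum>T\<in>Pow S. x ^ card (insert s T))"
    using insert.hyps(2) by (subst sum.reindex) (auto intro!: inj_onI)
  also have "\<dots> = (\<Sum>T\<in>Pow S. x * x ^ card T)"
  proof (rule sum.cong[OF refl])
    fix T assume "T \<in> Pow S"
    then have "finite T" "s \<notin> T" using insert.hyps finite_subset by auto
    then show "x ^ card (insert s T) = x * x ^ card T" by simp
  qed
  finally show ?case using insert by (simp add: sum_distrib_left[symmetric] algebra_simps)
qed simp

context hexagon_system
begin

definition matching :: "vertex rel \<Rightarrow> bool" where
  "matching M \<longleftrightarrow> M \<subseteq> A \<and> sym M \<and> (\<forall>x\<in>V. \<exists>!u. (x, u) \<in> M)"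

definition sextets :: "vertex rel \<Rightarrow> hexagon set" where
  "sextets M = {h \<in> H. sextet_arcs h \<subseteq> M}"

definition cover_of :: "vertex rel \<Rightarrow> hexagon set \<Rightarrow> vertex rel" where
  "cover_of M T = M \<union> (\<Union>h\<in>T. hexagon_arcs h)"

definition hexagons_of :: "vertex rel \<Rightarrow> hexagon set" where
  "hexagons_of E = {h \<in> H. hexagon_comp E h}"

definition matching_of :: "vertex rel \<Rightarrow> vertex rel" where
  "matching_of E = E - (\<Union>h\<in>hexagons_of E. hexagon_arcs h - sextet_arcs h)"

lemma matching_image:
  assumes "matching M" "x \<in> V"
  obtains u where "M `` {x} = {u}"
proof -
  obtain u where "(x, u) \<in> M" "\<And>w. (x, w) \<in> M \<Longrightarrow> w = u"
    using assms unfolding matching_def by metis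
  then have "M `` {x} = {u}" by blast
  then show thesis by (rule that)
qed

lemma matching_sextet:
  assumes "matching M" "h \<in> sextets M" "x \<in> hexagon_verts h"
  shows "M `` {x} = sextet_arcs h `` {x}"
proof -
  have "x \<in> V" using assms V_eq by (auto simp: sextets_def)
  then have "\<exists>!u. (x, u) \<in> M" using assms(1) by (auto simp: matching_def)
  moreover obtain u where "(x, u) \<in> sextet_arcs h" using sextet_arcs_ex1[OF assms(3)] by auto
  moreover have "sextet_arcs h \<subseteq> M" using assms(2) by (simp add: sextets_def)
  ultimately show ?thesis by auto
qed

text \<open>
  The partner of a common vertex gives a common sextet edge.
\<close>

lemma sextets_disjoint:
  assumes "matching M" "h \<in> sextets M" "g \<in> sextets M" "x \<in> hexagon_verts h" "x \<in> hexagon_verts g"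
  shows "h = g"
proof -
  have "sextet_arcs h `` {x} = sextet_arcs g `` {x}" using matching_sextet assms by metis
  moreover obtain u where "(x, u) \<in> sextet_arcs h" using sextet_arcs_ex1[OF assms(4)] by auto
  ultimately have "(x, u) \<in> sextet_arcs h" "(x, u) \<in> sextet_arcs g" by auto
  then show ?thesis using sextet_arcs_unique even_H assms(2,3) by (auto simp: sextets_def)
qed

lemma cover_of_at:
  assumes M: "matching M" and T: "T \<subseteq> sextets M" and h: "h \<in> T" "x \<in> hexagon_verts h"
  shows "cover_of M T `` {x} = hexagon_arcs h `` {x}"
proof -
  have hs: "h \<in> sextets M" "h \<in> H" using T h(1) by (auto simp: sextets_def)
  have "M `` {x} \<subseteq> hexagon_arcs h `` {x}"
    using matching_sextet[OF M hs(1) h(2)] sextet_arcs_sub[OF even_H[OF hs(2)]] by blast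
  moreover have "g = h" if "g \<in> T" "(x, u) \<in> hexagon_arcs g" for g u
    using sextets_disjoint[OF M _ _ _ h(2)] T h that hexagon_arcsD by blast
  ultimately show ?thesis using h unfolding cover_of_def by blast
qed

lemma cover_of_outside:
  assumes "x \<notin> (\<Union>h\<in>T. hexagon_verts h)"
  shows "cover_of M T `` {x} = M `` {x}"
  using assms hexagon_arcsD unfolding cover_of_def by blast

lemma cover_of_local_cover:
  assumes M: "matching M" and T: "T \<subseteq> sextets M"
  shows "local_cover (cover_of M T)"
  unfolding local_cover_def
proof (intro conjI ballI)
  have TH: "T \<subseteq> H" using T by (auto simp: sextets_def)
  show "cover_of M T \<subseteq> A" using M TH unfolding matching_def cover_of_def A_eq by auto
  show "sym (cover_of M T)"
    using M unfolding matching_def cover_of_def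
    by (intro symI) (blast dest: symD[OF sym_hexagon_arcs] symD)
  fix x assume x: "x \<in> V"
  show "edge_comp (cover_of M T) x \<or> (\<exists>h\<in>H. x \<in> hexagon_verts h \<and> hexagon_comp (cover_of M T) h)"
  proof (cases "x \<in> (\<Union>h\<in>T. hexagon_verts h)")
    case True
    then obtain h where "h \<in> T" "x \<in> hexagon_verts h" by auto
    then show ?thesis using TH cover_of_at[OF M T] unfolding hexagon_comp_def by blast
  next
    case False
    obtain u where u: "M `` {x} = {u}" using M x by (rule matching_image)
    then have xu: "(x, u) \<in> M" "(u, x) \<in> M" using M by (auto simp: matching_def dest: symD)
    then have "u \<in> V" using M A_sub by (auto simp: matching_def)
    then have u': "M `` {u} = {x}" using M xu(2) by (auto simp: matching_def)
    have "u \<notin> (\<Union>h\<in>T. hexagon_verts h)"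
    proof
      assume "u \<in> (\<Union>h\<in>T. hexagon_verts h)"
      then obtain h where h: "h \<in> T" "u \<in> hexagon_verts h" by auto
      then have "(u, x) \<in> sextet_arcs h" using matching_sextet[OF M, of h u] T u' by auto
      then have "x \<in> hexagon_verts h"
        using sextet_arcs_sub[OF even_H] h TH hexagon_arcsD by blast
      then show False using False h by auto
    qed
    then have "edge_comp (cover_of M T) x"
      unfolding edge_comp_def using u u' cover_of_outside False by (intro exI[of _ u]) simp
    then show ?thesis ..
  qed
qed

lemma hexagons_of_cover_of:
  assumes M: "matching M" and T: "T \<subseteq> sextets M"
  shows "hexagons_of (cover_of M T) = T"
proof (intro set_eqI iffI)
  fix h assume "h \<in> T"
  then show "h \<in> hexagons_of (cover_of M T)"
    using T cover_of_at[OF M T] by (auto simp: hexagons_of_def hexagon_comp_def sextets_def)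
next
  fix h assume h: "h \<in> hexagons_of (cover_of M T)"
  let ?x = "(fst h + 1, snd h)"
  have hH: "h \<in> H" and hc: "hexagon_comp (cover_of M T) h" using h by (auto simp: hexagons_of_def)
  have x: "?x \<in> hexagon_verts h" by (cases h) (simp add: mem_hexagon_verts)
  then have eq: "cover_of M T `` {?x} = hexagon_arcs h `` {?x}" using hc by (simp add: hexagon_comp_def)
  show "h \<in> T"
  proof (cases "?x \<in> (\<Union>h\<in>T. hexagon_verts h)")
    case True
    then obtain g where g: "g \<in> T" "?x \<in> hexagon_verts g" by auto
    then have "hexagon_arcs h `` {?x} \<subseteq> hexagon_verts g"
      using eq cover_of_at[OF M T g] hexagon_arcsD by blast
    moreover have "g \<in> H" using g T by (auto simp: sextets_def)
    ultimately show ?thesis using hexagon_middle_unique[OF even_H[OF hH] even_H, of g] g by auto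
  next
    case False
    have "?x \<in> V" using hH x V_eq by auto
    then obtain u where "M `` {?x} = {u}" using matching_image[OF M] by blast
    then have "hexagon_arcs h `` {?x} = {u}" using eq cover_of_outside[OF False] by simp
    moreover have "(fst h, snd h) \<in> hexagon_arcs h `` {?x}" "(fst h + 2, snd h) \<in> hexagon_arcs h `` {?x}"
      by (cases h, auto simp: hexagon_arcs_def mem_hexagon_verts adjacent_iff)+
    ultimately have "(fst h, snd h) = (fst h + 2, snd h)" by (metis singletonD)
    then have "fst h = fst h + 2" by (simp only: prod.inject)
    then show ?thesis by simp
  qed
qed

lemma matching_of_cover_of:
  assumes M: "matching M" and T: "T \<subseteq> sextets M"
  shows "matching_of (cover_of M T) = M"
proof -
  have in_sextet: "e \<in> sextet_arcs h" if "e \<in> M" "h \<in> T" "e \<in> hexagon_arcs h" for e h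
  proof -
    obtain x u where e: "e = (x, u)" by (cases e)
    have "x \<in> hexagon_verts h" using hexagon_arcsD that(3) e by blast
    moreover have "h \<in> sextets M" using T that(2) by blast
    ultimately have "M `` {x} = sextet_arcs h `` {x}" using matching_sextet[OF M] by blast
    then show ?thesis using that(1) e by blast
  qed
  have sub: "sextet_arcs h \<subseteq> M" if "h \<in> T" for h using T that unfolding sextets_def by blast
  have "e \<in> cover_of M T - (\<Union>h\<in>T. hexagon_arcs h - sextet_arcs h) \<longleftrightarrow> e \<in> M" for e
  proof
    assume "e \<in> cover_of M T - (\<Union>h\<in>T. hexagon_arcs h - sextet_arcs h)"
    then show "e \<in> M" using sub unfolding cover_of_def by blast
  next
    assume "e \<in> M"
    then show "e \<in> cover_of M T - (\<Union>h\<in>T. hexagon_arcs h - sextet_arcs h)"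
      using in_sextet[of e] unfolding cover_of_def by blast
  qed
  then show ?thesis
    unfolding matching_of_def hexagons_of_cover_of[OF assms] by blast
qed

text \<open>
  On a hexagon component the removal of the other three edges leaves its sextet; on an edge
  component nothing is removed.
\<close>

lemma matching_of_matching:
  assumes E: "local_cover E"
  shows "matching (matching_of E)" "hexagons_of E \<subseteq> sextets (matching_of E)"
    "cover_of (matching_of E) (hexagons_of E) = E"
proof -
  let ?T = "hexagons_of E" and ?M = "matching_of E"
  have sy: "sym E" and EA: "E \<subseteq> A" using E by (auto simp: local_cover_def)
  have sub: "hexagon_arcs h \<subseteq> E" if "h \<in> ?T" for h
    using that hexagon_comp_component[of E h] unfolding hexagons_of_def by blast
  have uniq: "g = h" if "g \<in> ?T" "h \<in> ?T" "x \<in> hexagon_verts g" "x \<in> hexagon_verts h" for g h x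
  proof -
    have "hexagon_verts g = hexagon_verts h"
      using that hexagon_comp_reach[of g E x] hexagon_comp_reach[of h E x] even_H by (auto simp: hexagons_of_def)
    then show ?thesis using hexagon_verts_determine[of g h] that even_H by (auto simp: hexagons_of_def)
  qed
  have in_hex: "?M `` {x} = sextet_arcs h `` {x}" if h: "h \<in> ?T" "x \<in> hexagon_verts h" for h x
  proof -
    have Ex: "E `` {x} = hexagon_arcs h `` {x}" using h by (auto simp: hexagons_of_def hexagon_comp_def)
    have "sextet_arcs h \<subseteq> hexagon_arcs h"
      using sextet_arcs_sub even_H h by (auto simp: hexagons_of_def)
    moreover have "g = h" if "g \<in> ?T" "(x, u) \<in> hexagon_arcs g" for g u
      using uniq[OF that(1) h(1) _ h(2)] that hexagon_arcsD by blast
    ultimately show ?thesis using Ex h unfolding matching_of_def by blast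
  qed
  have sy': "sym ?M"
    unfolding matching_of_def
    by (intro symI) (blast dest: symD[OF sy] symD[OF sym_hexagon_arcs] symD[OF sym_sextet_arcs])
  have ex1: "\<exists>!u. (x, u) \<in> ?M" if x: "x \<in> V" for x
  proof (cases "x \<in> (\<Union>h\<in>?T. hexagon_verts h)")
    case True
    then obtain h where h: "h \<in> ?T" "x \<in> hexagon_verts h" by auto
    have "(x, u) \<in> ?M \<longleftrightarrow> (x, u) \<in> sextet_arcs h" for u using in_hex[OF h] by blast
    then show ?thesis using sextet_arcs_ex1[OF h(2)] by simp
  next
    case False
    then have "edge_comp E x" using E x by (auto simp: local_cover_def hexagons_of_def)
    then obtain u where "E `` {x} = {u}" by (auto simp: edge_comp_def)
    moreover have "(x, w) \<in> ?M \<longleftrightarrow> (x, w) \<in> E" for w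
      using False hexagon_arcsD unfolding matching_of_def by blast
    ultimately have "(x, w) \<in> ?M \<longleftrightarrow> w = u" for w by blast
    then show ?thesis by simp
  qed
  show "matching ?M" using sy' ex1 EA by (auto simp: matching_def matching_of_def)
  show "?T \<subseteq> sextets ?M"
  proof
    fix h assume h: "h \<in> ?T"
    have "sextet_arcs h \<subseteq> ?M"
    proof (rule subrelI)
      fix x u assume xu: "(x, u) \<in> sextet_arcs h"
      then have "x \<in> hexagon_verts h"
        using sextet_arcs_sub[OF even_H] h hexagon_arcsD unfolding hexagons_of_def by blast
      then show "(x, u) \<in> ?M" using in_hex[OF h] xu by blast
    qed
    then show "h \<in> sextets ?M" using h by (auto simp: sextets_def hexagons_of_def)
  qed
  show "cover_of ?M ?T = E" using sub unfolding cover_of_def matching_of_def by blast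
qed

lemma finite_sextets: "finite (sextets M)"
  using fin_H by (simp add: sextets_def)

lemma finite_matchings: "finite {M. matching M}"
  by (rule finite_subset[of _ "Pow A"]) (auto simp: matching_def fin_A)

lemma sum_local_covers:
  fixes x :: "'a :: comm_semiring_1"
  shows "(\<Sum>E | local_cover E. x ^ card (hexagons_of E)) = (\<Sum>M | matching M. (1 + x) ^ card (sextets M))"
proof -
  have "(\<Sum>E | local_cover E. x ^ card (hexagons_of E))
      = (\<Sum>(M, T)\<in>(SIGMA M:{M. matching M}. Pow (sextets M)). x ^ card T)"
    by (rule sum.reindex_bij_witness[where i = "\<lambda>(M, T). cover_of M T"
          and j = "\<lambda>E. (matching_of E, hexagons_of E)"])
      (auto simp: matching_of_matching matching_of_cover_of hexagons_of_cover_of cover_of_local_cover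
        dest: matching_of_matching(2) subsetD)
  also have "\<dots> = (\<Sum>M | matching M. \<Sum>T\<in>Pow (sextets M). x ^ card T)"
    using finite_matchings finite_sextets by (subst sum.Sigma) auto
  also have "\<dots> = (\<Sum>M | matching M. (1 + x) ^ card (sextets M))"
    by (simp add: sum_Pow_power_card finite_sextets)
  finally show ?thesis .
qed

theorem zz_poly_matchings:
  assumes ex: "\<exists>K. clar_cover (hexagons_graph H) K"
  shows "zz_poly (hexagons_graph H) = (\<Sum>M | matching M. [:1, 1:] ^ card (sextets M))"
proof -
  let ?G = "hexagons_graph H" and ?K = "\<lambda>E. \<lparr>pverts = V, parcs = E\<rparr>" and ?c = "\<lambda>E. card (hexagons_of E)"
  let ?L = "{E. local_cover E}"
  have finL: "finite ?L"
    by (rule finite_subset[of _ "Pow A"]) (auto simp: local_cover_def fin_A)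
  have covers: "{K. clar_cover ?G K \<and> P (clar_order K)} =
      ?K ` {E \<in> ?L. P (?c E)}" for P
  proof (intro set_eqI iffI)
    fix K assume "K \<in> {K. clar_cover ?G K \<and> P (clar_order K)}"
    then have K: "pverts K = V" "local_cover (parcs K)" "P (card (hexagons_of (parcs K)))"
      using clar_cover_iff clar_order_eq by (auto simp: hexagons_of_def)
    have "K = \<lparr>pverts = V, parcs = parcs K\<rparr>" using K(1) by simp
    then show "K \<in> ?K ` {E \<in> ?L. P (?c E)}"
      using K by blast
  next
    fix K assume "K \<in> ?K ` {E \<in> ?L. P (?c E)}"
    then obtain E where "K = ?K E" "local_cover E" "P (?c E)" by blast
    then show "K \<in> {K. clar_cover ?G K \<and> P (clar_order K)}"
      using clar_cover_iff[of K] clar_order_eq[of K] by (simp add: hexagons_of_def)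
  qed
  have inj: "inj_on ?K X" for X :: "vertex rel set" by (rule inj_onI) simp
  have num: "num_clar_covers ?G k = card {E \<in> ?L. ?c E = k}" for k
    unfolding num_clar_covers_def covers[of "\<lambda>c. c = k"] using inj by (rule card_image)
  have "{clar_order K | K. clar_cover ?G K} = ?c ` ?L"
  proof (intro set_eqI iffI)
    fix c assume "c \<in> {clar_order K | K. clar_cover ?G K}"
    then show "c \<in> ?c ` ?L"
      using clar_cover_iff clar_order_eq by (auto simp: hexagons_of_def)
  next
    fix c assume "c \<in> ?c ` ?L"
    then obtain E where "local_cover E" "c = ?c E" by auto
    then have "clar_cover ?G (?K E)" "c = clar_order (?K E)"
      using clar_cover_iff[of "?K E"] clar_order_eq[of "?K E"]
      by (simp_all add: hexagons_of_def)
    then show "c \<in> {clar_order K | K. clar_cover ?G K}" by blast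
  qed
  then have le: "?c E \<in> {0..clar_number ?G}" if "E \<in> ?L" for E
    unfolding clar_number_def using finL that by (auto intro: Max_ge)
  have "zz_poly ?G = (\<Sum>k = 0..clar_number ?G. \<Sum>E\<in>{E \<in> ?L. ?c E = k}.
      monom 1 1 ^ ?c E)"
    unfolding zz_poly_def num
  proof (rule sum.cong[OF refl])
    fix k
    have "(\<Sum>E\<in>{E \<in> ?L. ?c E = k}. monom 1 1 ^ ?c E)
      = (\<Sum>E\<in>{E \<in> ?L. ?c E = k}. monom (1 :: int) k)"
      by (rule sum.cong) (auto simp: monom_power)
    also have "\<dots> = monom (int (card {E \<in> ?L. ?c E = k})) k"
      by (simp add: of_nat_monom mult_monom)
    finally show "monom (int (card {E \<in> ?L. ?c E = k})) k =
      (\<Sum>E\<in>{E \<in> ?L. ?c E = k}. monom 1 1 ^ ?c E)" by simp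
  qed
  also have "\<dots> = (\<Sum>E | local_cover E. monom 1 1 ^ ?c E)"
    by (rule sum.group) (use finL le in auto)
  also have "\<dots> = (\<Sum>M | matching M. (1 + monom 1 1) ^ card (sextets M))"
    by (rule sum_local_covers)
  also have "1 + monom 1 1 = [:1, 1 :: int:]" by (simp add: monom_altdef one_pCons)
  finally show ?thesis .
qed

end

section \<open>Coordinates of a regular strip\<close>

text \<open>
  Row \<open>k\<close> spans the horizontal positions \<open>L k\<close> to \<open>R k\<close>. The fictitious rows \<open>0\<close> and \<open>Suc m\<close>, one hexagon
  shorter than their neighbours, make the first and the last zigzag chain behave like all others: they
  have the order \<open>0\<close>, in agreement with the absence of vertical edges there. Chain \<open>k\<close>, for \<open>k \<le> m\<close>,
  is the zigzag between the rows \<open>k\<close> and \<open>Suc k\<close>, with second coordinate \<open>int k + 1\<close>.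
\<close>

locale strip =
  fixes m n :: nat and L R :: "nat \<Rightarrow> int" and H :: "hexagon set"
  assumes m_pos: "1 \<le> m"
    and L_even: "k \<le> Suc m \<Longrightarrow> even (L k + int k)"
    and R_even: "k \<le> Suc m \<Longrightarrow> even (R k + int k)"
    and L_step: "k \<le> m \<Longrightarrow> \<bar>L (Suc k) - L k\<bar> = 1"
    and R_step: "k \<le> m \<Longrightarrow> \<bar>R (Suc k) - R k\<bar> = 1"
    and width: "1 \<le> k \<Longrightarrow> k \<le> m \<Longrightarrow> L k + 2 \<le> R k"
    and top: "L 0 = L 1 + 1" "R 0 = R 1 - 1" "R 1 - L 1 = 2 * int n"
    and bottom: "L (Suc m) = L m + 1" "R (Suc m) = R m - 1" "R m - L m = 2 * int n"
    and H_eq: "H = {(a, int k) | a k. 1 \<le> k \<and> k \<le> m \<and> L k \<le> a \<and> a + 2 \<le> R k \<and> even (a + int k)}"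
begin

definition row :: "nat \<Rightarrow> int set" where
  "row k = (if 1 \<le> k \<and> k \<le> m then {c. L k \<le> c \<and> c \<le> R k \<and> even (c + int k)} else {})"

definition lo where "lo k = min (L k) (L (Suc k))"
definition hi where "hi k = max (R k) (R (Suc k))"
text \<open>
  Whether the first interface bond at chain \<open>k\<close> belongs to the lower row.
\<close>

definition \<delta> :: "nat \<Rightarrow> nat" where "\<delta> k = (if L (Suc k) < L k then 1 else 0)"

text \<open>
  The order of the interface of row \<open>k\<close>, computed from the ends of the row.
\<close>

definition surplus :: "nat \<Rightarrow> int" where "surplus k = (R k - L k) div 2 + 1 - int n"

lemma finite_row: "finite (row k)"
  by (rule finite_subset[of _ "{L k..R k}"]) (auto simp: row_def)

lemma surplus_eq: "k \<le> Suc m \<Longrightarrow> 2 * surplus k = R k - L k + 2 - 2 * int n"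
  using L_even[of k] R_even[of k] by (simp add: surplus_def)

lemma surplus_ends: "surplus 0 = 0" "surplus 1 = 1" "surplus m = 1" "surplus (Suc m) = 0"
  using surplus_eq[of 0] surplus_eq[of 1] surplus_eq[of m] surplus_eq[of "Suc m"] top bottom m_pos
  by auto

lemma L_Suc: "k \<le> m \<Longrightarrow> L (Suc k) = L k + 1 - 2 * int (\<delta> k)"
  using L_step[of k] by (auto simp: \<delta>_def)

lemma delta_le: "\<delta> k \<le> 1" by (simp add: \<delta>_def)

lemma surplus_Suc: "k \<le> m \<Longrightarrow>
    surplus (Suc k) - surplus k = int (\<delta> k) - (if R k < R (Suc k) then 0 else 1)"
  using surplus_eq[of k] surplus_eq[of "Suc k"] L_Suc[of k] R_step[of k] by auto

lemma lo_parity: "k \<le> m \<Longrightarrow> even (lo k + int k) \<longleftrightarrow> \<delta> k = 0"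
  using L_Suc[of k] L_even[of k] by (auto simp: lo_def \<delta>_def)

lemma hi_parity: "k \<le> m \<Longrightarrow> even (hi k + int k) \<longleftrightarrow> \<not> R k < R (Suc k)"
  using R_step[of k] R_even[of k] R_even[of "Suc k"] by (auto simp: hi_def max_def)

lemma lo_less_hi: "k \<le> m \<Longrightarrow> lo k < hi k"
  using width[of k] width[of "Suc k"] m_pos by (cases "k = 0") (auto simp: lo_def hi_def)

lemma row_chain: "k \<le> m \<Longrightarrow> c \<in> row k \<Longrightarrow> lo k \<le> c \<and> c \<le> hi k"
  "k \<le> m \<Longrightarrow> c \<in> row (Suc k) \<Longrightarrow> lo k \<le> c \<and> c \<le> hi k"
  by (auto simp: row_def lo_def hi_def split: if_splits)

lemma row_parity: "c \<in> row k \<Longrightarrow> even (c + int k)"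
  by (auto simp: row_def split: if_splits)

lemma mem_H_row:
  assumes "(a, int k) \<in> H" shows "1 \<le> k" "k \<le> m" "L k \<le> a" "a + 2 \<le> R k" "even (a + int k)"
  using assms by (auto simp: H_eq)

lemma A_horizontal:
  "((a, b), (a + 1, b)) \<in> parcs (hexagons_graph H) \<longleftrightarrow> (\<exists>k\<le>m. b = int k + 1 \<and> lo k \<le> a \<and> a < hi k)"
proof
  assume "((a, b), (a + 1, b)) \<in> parcs (hexagons_graph H)"
  then obtain c k where ck: "(c, int k) \<in> H" "(a, b) \<in> hexagon_verts (c, int k)" "(a + 1, b) \<in> hexagon_verts (c, int k)"
    by (auto simp: hexagons_graph_def H_eq)
  note k = mem_H_row[OF ck(1)]
  have a: "L k \<le> a" "a < R k" "b = int k \<or> b = int k + 1" using ck(2,3) k by (auto simp: mem_hexagon_verts)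
  show "\<exists>k\<le>m. b = int k + 1 \<and> lo k \<le> a \<and> a < hi k"
  proof (cases "b = int k")
    case True
    then show ?thesis using a k by (intro exI[of _ "k - 1"]) (auto simp: lo_def hi_def)
  next
    case False
    then show ?thesis using a k by (intro exI[of _ k]) (auto simp: lo_def hi_def)
  qed
next
  assume "\<exists>k\<le>m. b = int k + 1 \<and> lo k \<le> a \<and> a < hi k"
  then obtain k where k: "k \<le> m" "b = int k + 1" "lo k \<le> a" "a < hi k" by auto
  have *: "((a, b), (a + 1, b)) \<in> parcs (hexagons_graph H)"
    if "1 \<le> i" "i \<le> m" "L i \<le> a" "a < R i" "b = int i \<or> b = int i + 1" for i
  proof -
    define c where "c = (if even (a + int i) then a else a - 1)"
    have "(c, int i) \<in> H" "(a, b) \<in> hexagon_verts (c, int i)" "(a + 1, b) \<in> hexagon_verts (c, int i)"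
      using that L_even[of i] R_even[of i] width[of i] unfolding H_eq c_def mem_hexagon_verts
      by (auto; presburger)+
    moreover have "adjacent (a, b) (a + 1, b)" by (simp add: adjacent_iff)
    ultimately show ?thesis by (auto simp: hexagons_graph_def)
  qed
  have "(1 \<le> k \<and> L k \<le> a \<and> a < R k) \<or> (Suc k \<le> m \<and> L (Suc k) \<le> a \<and> a < R (Suc k))"
    using k L_step[of k] R_step[of k] width[of k] width[of "Suc k"] top bottom m_pos
    unfolding lo_def hi_def by (cases "k = 0"; cases "k = m") auto
  then show "((a, b), (a + 1, b)) \<in> parcs (hexagons_graph H)" using *[of k] *[of "Suc k"] k by auto
qed

lemma V_iff:
  "(a, b) \<in> pverts (hexagons_graph H) \<longleftrightarrow> (\<exists>k\<le>m. b = int k + 1 \<and> lo k \<le> a \<and> a \<le> hi k)" (is "_ \<longleftrightarrow> ?R")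
proof
  assume "(a, b) \<in> pverts (hexagons_graph H)"
  then obtain h where h: "h \<in> H" "(a, b) \<in> hexagon_verts h" by (auto simp: hexagons_graph_def)
  define c where "c = (if a < fst h + 2 then a else a - 1)"
  have "(c, b) \<in> hexagon_verts h" "(c + 1, b) \<in> hexagon_verts h" "a = c \<or> a = c + 1"
    using h(2) by (auto simp: c_def hexagon_verts_def)
  moreover have "adjacent (c, b) (c + 1, b)" by (simp add: adjacent_iff)
  ultimately have "((c, b), (c + 1, b)) \<in> parcs (hexagons_graph H)" using h(1) by (auto simp: hexagons_graph_def)
  then show ?R using \<open>a = c \<or> a = c + 1\<close> unfolding A_horizontal by fastforce
next
  assume ?R
  then obtain k where k: "k \<le> m" "b = int k + 1" "lo k \<le> a" "a \<le> hi k" by auto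
  then have "((a, b), (a + 1, b)) \<in> parcs (hexagons_graph H) \<or> ((a - 1, b), (a - 1 + 1, b)) \<in> parcs (hexagons_graph H)"
    unfolding A_horizontal using lo_less_hi[OF k(1)] by (cases "a = hi k") auto
  then show "(a, b) \<in> pverts (hexagons_graph H)" by (auto simp: hexagons_graph_def)
qed

lemma A_vertical:
  "((a, b), (a, b + 1)) \<in> parcs (hexagons_graph H) \<longleftrightarrow> (\<exists>k. b = int k \<and> a \<in> row k)"
proof
  assume "((a, b), (a, b + 1)) \<in> parcs (hexagons_graph H)"
  then obtain c k where ck: "(c, int k) \<in> H" "(a, b) \<in> hexagon_verts (c, int k)" "(a, b + 1) \<in> hexagon_verts (c, int k)"
    and ev: "even (a + b)"
    by (auto simp: hexagons_graph_def H_eq hex_lattice_def)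
  note k = mem_H_row[OF ck(1)]
  have "b = int k" "L k \<le> a" "a \<le> R k" using ck k by (auto simp: mem_hexagon_verts)
  then show "\<exists>k. b = int k \<and> a \<in> row k" using ev k by (auto simp: row_def)
next
  assume "\<exists>k. b = int k \<and> a \<in> row k"
  then obtain k where k: "b = int k" "1 \<le> k" "k \<le> m" "L k \<le> a" "a \<le> R k" "even (a + int k)"
    by (auto simp: row_def split: if_splits)
  define c where "c = (if a + 2 \<le> R k then a else a - 2)"
  have "(c, int k) \<in> H" "(a, b) \<in> hexagon_verts (c, int k)" "(a, b + 1) \<in> hexagon_verts (c, int k)"
    using k L_even[of k] R_even[of k] width[of k] unfolding H_eq c_def mem_hexagon_verts
    by (auto; presburger)+
  moreover have "adjacent (a, b) (a, b + 1)" using k by (simp add: adjacent_iff)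
  ultimately show "((a, b), (a, b + 1)) \<in> parcs (hexagons_graph H)" by (auto simp: hexagons_graph_def)
qed

sublocale hexagon_system H
proof
  show "even (fst h + snd h)" if "h \<in> H" for h using that by (auto simp: H_eq)
  show "finite H"
  proof (rule finite_subset)
    show "H \<subseteq> (\<Union>k\<in>{1..m}. {L k..R k} \<times> {int k})" by (auto simp: H_eq)
  qed auto
  fix h :: hexagon
  assume ev: "even (fst h + snd h)" and arcs: "hexagon_arcs h \<subseteq> parcs (hexagons_graph H)"
  obtain a b where h: "h = (a, b)" by (cases h)
  have "((a, b), (a, b + 1)) \<in> hexagon_arcs h" "((a + 2, b), (a + 2, b + 1)) \<in> hexagon_arcs h"
    using ev by (auto simp: h hexagon_arcs_def mem_hexagon_verts adjacent_iff)
  then have "\<exists>k. b = int k \<and> a \<in> row k" "\<exists>k. b = int k \<and> a + 2 \<in> row k"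
    using arcs A_vertical[of a b] A_vertical[of "a + 2" b] by blast+
  then obtain k where "b = int k" "a \<in> row k" "a + 2 \<in> row k" by auto
  then show "h \<in> H" by (auto simp: h H_eq row_def split: if_splits)
qed

lemma A_cases:
  "((a, b), v) \<in> A \<longleftrightarrow> (\<exists>k\<le>m. b = int k + 1 \<and>
     (v = (a - 1, b) \<and> lo k < a \<and> a \<le> hi k \<or> v = (a + 1, b) \<and> lo k \<le> a \<and> a < hi k \<or>
      v = (a, b + 1) \<and> a \<in> row (Suc k) \<or> v = (a, b - 1) \<and> a \<in> row k))"
proof -
  have sw: "(x, y) \<in> A \<longleftrightarrow> (y, x) \<in> A" for x y using sym_A by (meson symD)
  have 1: "((a, b), (a - 1, b)) \<in> A \<longleftrightarrow> (\<exists>k\<le>m. b = int k + 1 \<and> lo k < a \<and> a \<le> hi k)"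
    using A_horizontal[of "a - 1" b] sw[of "(a, b)"] by auto
  have 2: "((a, b), (a, b + 1)) \<in> A \<longleftrightarrow> (\<exists>k\<le>m. b = int k + 1 \<and> a \<in> row (Suc k))"
  proof -
    have "(\<exists>k. b = int k \<and> a \<in> row k) \<longleftrightarrow> (\<exists>k\<le>m. b = int k + 1 \<and> a \<in> row (Suc k))"
    proof
      assume "\<exists>k. b = int k \<and> a \<in> row k"
      then obtain k where "b = int k" "a \<in> row k" by auto
      then show "\<exists>k\<le>m. b = int k + 1 \<and> a \<in> row (Suc k)"
        by (intro exI[of _ "k - 1"]) (auto simp: row_def split: if_splits)
    next
      assume "\<exists>k\<le>m. b = int k + 1 \<and> a \<in> row (Suc k)"
      then obtain k where "b = int (Suc k)" "a \<in> row (Suc k)" by auto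
      then show "\<exists>k. b = int k \<and> a \<in> row k" by blast
    qed
    then show ?thesis using A_vertical by simp
  qed
  have 3: "((a, b), (a, b - 1)) \<in> A \<longleftrightarrow> (\<exists>k\<le>m. b = int k + 1 \<and> a \<in> row k)"
  proof -
    have "(\<exists>k. b - 1 = int k \<and> a \<in> row k) \<longleftrightarrow> (\<exists>k\<le>m. b = int k + 1 \<and> a \<in> row k)"
      by (auto simp: row_def algebra_simps split: if_splits)
    then show ?thesis using A_vertical[of a "b - 1"] sw[of "(a, b)"] by simp
  qed
  note 4 = A_horizontal[of a b]
  show ?thesis
  proof
    assume v: "((a, b), v) \<in> A"
    then have "adjacent (a, b) v" using A_lattice by blast
    then consider "v = (a - 1, b)" | "v = (a + 1, b)" | "v = (a, b + 1)" | "v = (a, b - 1)"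
      unfolding adjacent_iff by (metis (full_types))
    then show "\<exists>k\<le>m. b = int k + 1 \<and>
     (v = (a - 1, b) \<and> lo k < a \<and> a \<le> hi k \<or> v = (a + 1, b) \<and> lo k \<le> a \<and> a < hi k \<or>
      v = (a, b + 1) \<and> a \<in> row (Suc k) \<or> v = (a, b - 1) \<and> a \<in> row k)"
      using v 1 2 3 4 by cases blast+
  next
    assume "\<exists>k\<le>m. b = int k + 1 \<and>
     (v = (a - 1, b) \<and> lo k < a \<and> a \<le> hi k \<or> v = (a + 1, b) \<and> lo k \<le> a \<and> a < hi k \<or>
      v = (a, b + 1) \<and> a \<in> row (Suc k) \<or> v = (a, b - 1) \<and> a \<in> row k)"
    then show "((a, b), v) \<in> A" using 1 2 3 4 by blast
  qed
qed

end

section \<open>Matchings as interlacing rows\<close>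

definition below :: "int set \<Rightarrow> int \<Rightarrow> int" where
  "below S a = int (card {c \<in> S. c \<le> a})"

lemma below_step:
  assumes "finite S" shows "below S a = below S (a - 1) + of_bool (a \<in> S)"
proof -
  have eq: "{c \<in> S. c \<le> a} = {c \<in> S. c \<le> a - 1} \<union> (if a \<in> S then {a} else {})"
    by (auto simp: le_less)
  have "card {c \<in> S. c \<le> a} = card {c \<in> S. c \<le> a - 1} + card (if a \<in> S then {a} else {})"
    unfolding eq by (rule card_Un_disjoint) (use assms in auto)
  then show ?thesis by (simp add: below_def)
qed

lemma below_0: "(\<And>c. c \<in> S \<Longrightarrow> a < c) \<Longrightarrow> below S a = 0"
  unfolding below_def by (simp add: card_eq_0_iff) force

lemma below_card: "(\<And>c. c \<in> S \<Longrightarrow> c \<le> a) \<Longrightarrow> below S a = int (card S)"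
  by (auto simp: below_def intro!: arg_cong[where f = card])

lemma ex1_of_bool:
  assumes "\<And>u. P u \<Longrightarrow> u = w \<or> u = x \<or> u = y \<or> u = z" "distinct [w, x, y, z]"
  shows "(\<exists>!u. P u) \<longleftrightarrow> of_bool (P w) + of_bool (P x) + of_bool (P y) + of_bool (P z) = (1 :: int)"
proof
  assume "\<exists>!u. P u"
  then obtain u where u: "P u" "\<And>t. P t \<Longrightarrow> t = u" by auto
  have "\<And>t. P t \<longleftrightarrow> t = u" using u by blast
  then show "of_bool (P w) + of_bool (P x) + of_bool (P y) + of_bool (P z) = (1 :: int)"
    using assms(1)[OF u(1)] assms(2) by auto
next
  assume s: "of_bool (P w) + of_bool (P x) + of_bool (P y) + of_bool (P z) = (1 :: int)"
  then consider "P w" "\<not> P x" "\<not> P y" "\<not> P z" | "P x" "\<not> P w" "\<not> P y" "\<not> P z"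
    | "P y" "\<not> P w" "\<not> P x" "\<not> P z" | "P z" "\<not> P w" "\<not> P x" "\<not> P y"
    by (auto simp: of_bool_def split: if_splits)
  then show "\<exists>!u. P u" using assms(1) by cases metis+
qed

context strip
begin

text \<open>
  The number of chosen vertical edges below chain \<open>k\<close> minus the number of those above it, up to
  position \<open>a\<close>.
\<close>

definition drift :: "(nat \<Rightarrow> int set) \<Rightarrow> nat \<Rightarrow> int \<Rightarrow> int" where
  "drift X k a = below (X (Suc k)) a - below (X k) a"

text \<open>
  Vertices of chain \<open>k\<close> alternate between those with a vertical edge up (\<open>a + int k\<close> even) and down. The
  unmatched rest of the chain up to \<open>a\<close> is paired off except possibly for the vertex \<open>a\<close>, so the drift
  tells whether \<open>a\<close> is matched to the right.
\<close>

definition horiz :: "(nat \<Rightarrow> int set) \<Rightarrow> nat \<Rightarrow> int \<Rightarrow> bool" where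
  "horiz X k a \<longleftrightarrow> drift X k a = (if even (a + int k) then int (\<delta> k) else int (\<delta> k) - 1)"

text \<open>
  The drift takes two consecutive values: between two successive chosen edges on one side of a chain there is
  exactly one on the other side.
\<close>

definition interlacing :: "(nat \<Rightarrow> int set) \<Rightarrow> bool" where
  "interlacing X \<longleftrightarrow> (\<forall>k. X k \<subseteq> row k) \<and> (\<forall>k\<le>m. \<forall>a. drift X k a \<in> {int (\<delta> k) - 1, int (\<delta> k)}) \<and>
     (\<forall>k\<le>Suc m. int (card (X k)) = surplus k)"

definition rows_of :: "vertex rel \<Rightarrow> nat \<Rightarrow> int set" where
  "rows_of M k = {c \<in> row k. ((c, int k), (c, int k + 1)) \<in> M}"

definition match_of :: "(nat \<Rightarrow> int set) \<Rightarrow> vertex rel" where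
  "match_of X = {((a, b), v). \<exists>k\<le>m. b = int k + 1 \<and>
     (v = (a - 1, b) \<and> lo k < a \<and> a \<le> hi k \<and> horiz X k (a - 1) \<or>
      v = (a + 1, b) \<and> lo k \<le> a \<and> a < hi k \<and> horiz X k a \<or>
      v = (a, b + 1) \<and> a \<in> X (Suc k) \<or> v = (a, b - 1) \<and> a \<in> X k)}"

lemma match_of_iff:
  assumes "k \<le> m"
  shows "((a, int k + 1), v) \<in> match_of X \<longleftrightarrow>
     (v = (a - 1, int k + 1) \<and> lo k < a \<and> a \<le> hi k \<and> horiz X k (a - 1) \<or>
      v = (a + 1, int k + 1) \<and> lo k \<le> a \<and> a < hi k \<and> horiz X k a \<or>
      v = (a, int k + 2) \<and> a \<in> X (Suc k) \<or> v = (a, int k) \<and> a \<in> X k)"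
  using assms by (auto simp: match_of_def)

lemma A_cases_chain:
  assumes "((a, int k + 1), v) \<in> A"
  shows "v = (a - 1, int k + 1) \<or> v = (a + 1, int k + 1) \<or> v = (a, int k + 2) \<or> v = (a, int k)"
  using assms unfolding A_cases by auto

lemma vertex_ex1:
  assumes "M \<subseteq> A"
  shows "(\<exists>!u. ((a, int k + 1), u) \<in> M) \<longleftrightarrow>
    of_bool (((a, int k + 1), (a - 1, int k + 1)) \<in> M) + of_bool (((a, int k + 1), (a + 1, int k + 1)) \<in> M) +
    of_bool (((a, int k + 1), (a, int k + 2)) \<in> M) + of_bool (((a, int k + 1), (a, int k)) \<in> M) = (1 :: int)"
  by (rule ex1_of_bool) (use assms A_cases_chain in blast, simp)

lemma rows_of_row: "rows_of M k \<subseteq> row k" by (auto simp: rows_of_def)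

lemma vertical_rows_of:
  assumes "M \<subseteq> A" "sym M"
  shows "((a, int k + 1), (a, int k + 2)) \<in> M \<longleftrightarrow> a \<in> rows_of M (Suc k)"
    and "((a, int k + 1), (a, int k)) \<in> M \<longleftrightarrow> a \<in> rows_of M k"
proof -
  have *: "((a, int i), (a, int i + 1)) \<in> M \<longleftrightarrow> a \<in> rows_of M i" for i
    using assms(1) A_vertical[of a "int i"] by (auto simp: rows_of_def)
  show "((a, int k + 1), (a, int k + 2)) \<in> M \<longleftrightarrow> a \<in> rows_of M (Suc k)"
    using *[of "Suc k"] by (simp add: add.commute)
  show "((a, int k + 1), (a, int k)) \<in> M \<longleftrightarrow> a \<in> rows_of M k"
    using *[of k] assms(2) by (meson symD)
qed

lemma drift_step:
  assumes "\<forall>i. X i \<subseteq> row i"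
  shows "drift X k a = drift X k (a - 1) + of_bool (a \<in> X (Suc k)) - of_bool (a \<in> X k)"
proof -
  have "finite (X i)" for i using assms finite_row finite_subset by blast
  then show ?thesis using below_step[of "X k" a] below_step[of "X (Suc k)" a] by (simp add: drift_def)
qed

lemma drift_outside:
  assumes X: "\<forall>i. X i \<subseteq> row i" and k: "k \<le> m"
  shows "a < lo k \<Longrightarrow> drift X k a = 0"
    and "hi k \<le> a \<Longrightarrow> drift X k a = int (card (X (Suc k))) - int (card (X k))"
proof -
  have *: "lo k \<le> c \<and> c \<le> hi k" if "c \<in> X k \<or> c \<in> X (Suc k)" for c
    using that X row_chain[OF k] by blast
  { assume "a < lo k"
    then have "below (X k) a = 0" "below (X (Suc k)) a = 0" using * by (intro below_0; fastforce)+
    then show "drift X k a = 0" by (simp add: drift_def) }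
  { assume "hi k \<le> a"
    then have "below (X k) a = int (card (X k))" "below (X (Suc k)) a = int (card (X (Suc k)))"
      using * by (intro below_card; fastforce)+
    then show "drift X k a = int (card (X (Suc k))) - int (card (X k))" by (simp add: drift_def) }
qed

lemma row_excl: "a \<in> row (Suc k) \<Longrightarrow> odd (a + int k)" "a \<in> row k \<Longrightarrow> even (a + int k)"
  by (auto dest: row_parity)

text \<open>
  Induction along the chain: exactly one of the edges to the left, to the right and up or down is matched
  at each vertex, so the drift and the horizontal edge to the right determine each other.
\<close>

lemma matching_drift:
  assumes M: "matching M" and k: "k \<le> m" and a: "lo k - 1 \<le> a" "a \<le> hi k"
  shows "drift (rows_of M) k a =
    (if odd (a + int k) then int (\<delta> k) - of_bool (((a, int k + 1), (a + 1, int k + 1)) \<in> M)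
     else int (\<delta> k) - 1 + of_bool (((a, int k + 1), (a + 1, int k + 1)) \<in> M))"
  using a
proof (induction a rule: int_ge_induct)
  case base
  have MA: "M \<subseteq> A" using M by (simp add: matching_def)
  have "((lo k - 1, int k + 1), (lo k, int k + 1)) \<notin> M"
    using MA A_horizontal[of "lo k - 1" "int k + 1"] by auto
  moreover have "drift (rows_of M) k (lo k - 1) = 0"
    using drift_outside(1)[of "rows_of M", OF _ k] rows_of_row by auto
  ultimately show ?case using lo_parity[OF k] delta_le[of k] by auto
next
  case (step a)
  have MA: "M \<subseteq> A" and sy: "sym M" using M by (auto simp: matching_def)
  have "(a + 1, int k + 1) \<in> V" using step k by (auto simp: V_iff)
  then have "\<exists>!u. ((a + 1, int k + 1), u) \<in> M" using M by (simp add: matching_def)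
  then have one: "of_bool (((a + 1, int k + 1), (a, int k + 1)) \<in> M) + of_bool (((a + 1, int k + 1), (a + 1 + 1, int k + 1)) \<in> M)
      + of_bool (a + 1 \<in> rows_of M (Suc k)) + of_bool (a + 1 \<in> rows_of M k) = (1 :: int)"
    unfolding vertex_ex1[OF MA] vertical_rows_of[OF MA sy] by simp
  have sw: "((a + 1, int k + 1), (a, int k + 1)) \<in> M \<longleftrightarrow> ((a, int k + 1), (a + 1, int k + 1)) \<in> M"
    using sy by (meson symD)
  have st: "drift (rows_of M) k (a + 1) = drift (rows_of M) k a
      + of_bool (a + 1 \<in> rows_of M (Suc k)) - of_bool (a + 1 \<in> rows_of M k)"
    using drift_step[of "rows_of M" k "a + 1"] rows_of_row by simp
  have par: "even (a + 1 + int k) \<longleftrightarrow> odd (a + int k)" by presburger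
  show ?case
  proof (cases "odd (a + int k)")
    case True
    then have "a + 1 \<notin> rows_of M (Suc k)" using row_excl(1)[of "a + 1" k] rows_of_row[of M "Suc k"] par by blast
    then show ?thesis using True st one step.IH step.prems sw par by simp
  next
    case False
    then have "a + 1 \<notin> rows_of M k" using row_excl(2)[of "a + 1" k] rows_of_row[of M k] par by blast
    then show ?thesis using False st one step.IH step.prems sw par by simp
  qed
qed

lemma matching_drift_hi:
  assumes M: "matching M" and k: "k \<le> m"
  shows "drift (rows_of M) k (hi k) = surplus (Suc k) - surplus k"
proof -
  have "M \<subseteq> A" using M by (simp add: matching_def)
  then have "((hi k, int k + 1), (hi k + 1, int k + 1)) \<notin> M"
    using A_horizontal[of "hi k" "int k + 1"] by auto
  then show ?thesis
    using matching_drift[OF M k, of "hi k"] lo_less_hi[OF k] hi_parity[OF k] surplus_Suc[OF k] by simp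
qed

text \<open>
  At the right end of a chain no horizontal edge is left, so the drift there is the difference of the two
  cardinalities; they add up from the empty row \<open>0\<close>.
\<close>

lemma card_rows_of:
  assumes M: "matching M"
  shows "k \<le> Suc m \<Longrightarrow> int (card (rows_of M k)) = surplus k"
proof (induction k)
  case 0
  have "rows_of M 0 = {}" using rows_of_row[of M 0] by (auto simp: row_def)
  then show ?case using surplus_ends by simp
next
  case (Suc k)
  then have k: "k \<le> m" by simp
  have "int (card (rows_of M (Suc k))) - int (card (rows_of M k)) = surplus (Suc k) - surplus k"
    using matching_drift_hi[OF M k] drift_outside(2)[of "rows_of M", OF _ k] rows_of_row by auto
  then show ?case using Suc by simp
qed

lemma interlacing_rows_of:
  assumes M: "matching M"
  shows "interlacing (rows_of M)"
  unfolding interlacing_def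
proof (intro conjI allI impI)
  show sub: "rows_of M k \<subseteq> row k" for k by (rule rows_of_row)
  show "int (card (rows_of M k)) = surplus k" if "k \<le> Suc m" for k using card_rows_of[OF M that] .
  fix k a assume k: "k \<le> m"
  have X: "\<forall>i. rows_of M i \<subseteq> row i" using sub by blast
  have inside: "drift (rows_of M) k a \<in> {int (\<delta> k) - 1, int (\<delta> k)}" if "lo k - 1 \<le> a" "a \<le> hi k" for a
    using matching_drift[OF M k that] by auto
  consider "a < lo k" | "lo k - 1 \<le> a \<and> a \<le> hi k" | "hi k < a" by linarith
  then show "drift (rows_of M) k a \<in> {int (\<delta> k) - 1, int (\<delta> k)}"
  proof cases
    case 1
    then show ?thesis using drift_outside(1)[OF X k] delta_le[of k] by auto
  next
    case 2
    then show ?thesis using inside by blast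
  next
    case 3
    then have "drift (rows_of M) k a = drift (rows_of M) k (hi k)"
      using drift_outside(2)[OF X k] by simp
    then show ?thesis using inside[of "hi k"] lo_less_hi[OF k] by simp
  qed
qed

lemma match_of_rows_of:
  assumes M: "matching M"
  shows "match_of (rows_of M) = M"
proof -
  have MA: "M \<subseteq> A" and sy: "sym M" using M by (auto simp: matching_def)
  have hz: "horiz (rows_of M) k a \<longleftrightarrow> ((a, int k + 1), (a + 1, int k + 1)) \<in> M"
    if "k \<le> m" "lo k \<le> a" "a < hi k" for k a
    using matching_drift[OF M that(1), of a] that by (auto simp: horiz_def)
  have "((a, b), v) \<in> match_of (rows_of M) \<longleftrightarrow> ((a, b), v) \<in> M" for a b v
  proof (cases "\<exists>k\<le>m. b = int k + 1")
    case True
    then obtain k where k: "k \<le> m" "b = int k + 1" by auto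
    have h1: "lo k < a \<and> a \<le> hi k \<and> horiz (rows_of M) k (a - 1) \<longleftrightarrow> ((a, int k + 1), (a - 1, int k + 1)) \<in> M"
    proof -
      have "((a, int k + 1), (a - 1, int k + 1)) \<in> M \<longleftrightarrow> ((a - 1, int k + 1), (a - 1 + 1, int k + 1)) \<in> M"
        using sy by (auto dest: symD)
      then show ?thesis using hz[OF k(1), of "a - 1"] MA A_horizontal[of "a - 1" "int k + 1"] by auto
    qed
    have h2: "lo k \<le> a \<and> a < hi k \<and> horiz (rows_of M) k a \<longleftrightarrow> ((a, int k + 1), (a + 1, int k + 1)) \<in> M"
      using hz[OF k(1), of a] MA A_horizontal[of a "int k + 1"] by auto
    note vr = vertical_rows_of[OF MA sy, of a k]
    show ?thesis
      unfolding k(2) match_of_iff[OF k(1)] vr[symmetric] h2 h1 using A_cases_chain[of a k v] MA by blast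
  next
    case False
    then have "((a, b), v) \<notin> M" using MA A_cases[of a b v] by blast
    moreover have "((a, b), v) \<notin> match_of (rows_of M)" using False by (auto simp: match_of_def)
    ultimately show ?thesis by simp
  qed
  then show ?thesis by auto
qed

lemma horiz_ends:
  assumes X: "interlacing X" and k: "k \<le> m"
  shows "\<not> horiz X k (lo k - 1)" "\<not> horiz X k (hi k)"
proof -
  have sub: "\<forall>i. X i \<subseteq> row i" using X by (simp add: interlacing_def)
  show "\<not> horiz X k (lo k - 1)"
    using drift_outside(1)[OF sub k, of "lo k - 1"] lo_parity[OF k] delta_le[of k] by (auto simp: horiz_def)
  have "drift X k (hi k) = surplus (Suc k) - surplus k"
    using drift_outside(2)[OF sub k, of "hi k"] X k by (simp add: interlacing_def)
  then show "\<not> horiz X k (hi k)"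
    using surplus_Suc[OF k] hi_parity[OF k] by (auto simp: horiz_def)
qed

text \<open>
  At each vertex the drift changes by one exactly if its vertical edge is chosen; hence precisely one of
  \<open>horiz\<close> to the left, \<open>horiz\<close> to the right and the vertical edge holds. At the ends of the chain
  \<open>horiz\<close> fails by \<open>horiz_ends\<close>.
\<close>

lemma match_of_matching:
  assumes X: "interlacing X"
  shows "matching (match_of X)"
  unfolding matching_def
proof (intro conjI ballI)
  have sub: "\<forall>i. X i \<subseteq> row i" using X by (simp add: interlacing_def)
  have dr: "drift X k a \<in> {int (\<delta> k) - 1, int (\<delta> k)}" if "k \<le> m" for k a
    using X that by (simp add: interlacing_def)
  show MA: "match_of X \<subseteq> A"
  proof (rule subrelI)
    fix u v assume "(u, v) \<in> match_of X"
    moreover obtain a b where "u = (a, b)" by (cases u)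
    ultimately show "(u, v) \<in> A" using sub unfolding match_of_def by (simp add: A_cases) blast
  qed
  show "sym (match_of X)"
  proof (rule symI)
    fix u v assume uv: "(u, v) \<in> match_of X"
    obtain a b where u: "u = (a, b)" by (cases u)
    obtain k where k: "k \<le> m" "b = int k + 1" using uv u by (auto simp: match_of_def)
    from uv consider "v = (a - 1, int k + 1)" "lo k < a" "a \<le> hi k" "horiz X k (a - 1)"
      | "v = (a + 1, int k + 1)" "lo k \<le> a" "a < hi k" "horiz X k a"
      | "v = (a, int k + 2)" "a \<in> X (Suc k)" | "v = (a, int k)" "a \<in> X k"
      unfolding u k(2) match_of_iff[OF k(1)] by blast
    then show "(v, u) \<in> match_of X"
    proof cases
      case 1
      then show ?thesis unfolding u k(2) 1(1) match_of_iff[OF k(1)] by simp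
    next
      case 2
      then show ?thesis unfolding u k(2) 2(1) match_of_iff[OF k(1)] by simp
    next
      case 3
      then have "Suc k \<le> m" using sub by (auto simp: row_def split: if_splits)
      then show ?thesis using match_of_iff[of "Suc k" a u X] 3 unfolding u k(2) by (simp add: add.commute)
    next
      case 4
      then have "1 \<le> k" using sub by (auto simp: row_def split: if_splits)
      then have "((a, int (k - 1) + 1), u) \<in> match_of X"
        using match_of_iff[of "k - 1" a u X] 4 k unfolding u k(2) by simp
      then show ?thesis using 4(1) \<open>1 \<le> k\<close> by (simp add: of_nat_diff)
    qed
  qed
  fix x assume "x \<in> V"
  then obtain a k where x: "x = (a, int k + 1)" and k: "k \<le> m" "lo k \<le> a" "a \<le> hi k"
    by (cases x) (auto simp: V_iff)
  have p1: "((a, int k + 1), (a - 1, int k + 1)) \<in> match_of X \<longleftrightarrow> horiz X k (a - 1)"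
    unfolding match_of_iff[OF k(1)] using k horiz_ends(1)[OF X k(1)] by (cases "a = lo k") auto
  have p2: "((a, int k + 1), (a + 1, int k + 1)) \<in> match_of X \<longleftrightarrow> horiz X k a"
    unfolding match_of_iff[OF k(1)] using k horiz_ends(2)[OF X k(1)] by (cases "a = hi k") auto
  have p3: "((a, int k + 1), (a, int k + 2)) \<in> match_of X \<longleftrightarrow> a \<in> X (Suc k)"
    and p4: "((a, int k + 1), (a, int k)) \<in> match_of X \<longleftrightarrow> a \<in> X k"
    unfolding match_of_iff[OF k(1)] by auto
  have st: "drift X k a = drift X k (a - 1) + of_bool (a \<in> X (Suc k)) - of_bool (a \<in> X k)"
    by (rule drift_step[OF sub])
  have par: "even (a - 1 + int k) \<longleftrightarrow> odd (a + int k)" by presburger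
  show "\<exists>!u. (x, u) \<in> match_of X"
    unfolding x vertex_ex1[OF MA] p1 p2 p3 p4
  proof (cases "even (a + int k)")
    case True
    then have "a \<notin> X (Suc k)" using row_excl(1)[of a k] sub by blast
    then show "of_bool (horiz X k (a - 1)) + of_bool (horiz X k a) + of_bool (a \<in> X (Suc k)) + of_bool (a \<in> X k) = (1 :: int)"
      using st dr[OF k(1), of a] dr[OF k(1), of "a - 1"] True par by (auto simp: horiz_def)
  next
    case False
    then have "a \<notin> X k" using row_excl(2)[of a k] sub by blast
    then show "of_bool (horiz X k (a - 1)) + of_bool (horiz X k a) + of_bool (a \<in> X (Suc k)) + of_bool (a \<in> X k) = (1 :: int)"
      using st dr[OF k(1), of a] dr[OF k(1), of "a - 1"] False par by (auto simp: horiz_def)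
  qed
qed

lemma rows_of_match_of:
  assumes X: "interlacing X"
  shows "rows_of (match_of X) = X"
proof
  fix i
  have sub: "\<forall>i. X i \<subseteq> row i" using X by (simp add: interlacing_def)
  have M: "match_of X \<subseteq> A" "sym (match_of X)" using match_of_matching[OF X] by (auto simp: matching_def)
  show "rows_of (match_of X) i = X i"
  proof (cases "1 \<le> i \<and> i \<le> m")
    case True
    then show ?thesis
      using vertical_rows_of(2)[OF M, of _ i] match_of_iff[of i _ "(_, int i)" X] by auto
  next
    case False
    then have "row i = {}" by (auto simp: row_def)
    then show ?thesis using sub rows_of_row[of "match_of X" i] by auto
  qed
qed

lemma sextets_match_of:
  assumes X: "interlacing X"
  shows "(a, int k) \<in> sextets (match_of X) \<longleftrightarrow> (a, int k) \<in> H \<and> a + 2 \<in> X k \<and>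
    drift X (k - 1) a = int (\<delta> (k - 1)) - 1 \<and> drift X k a = int (\<delta> k)"
proof (cases "(a, int k) \<in> H")
  case True
  note k = mem_H_row[OF True]
  define l where "l = k - 1"
  have l: "k = Suc l" "l \<le> m" using k by (auto simp: l_def)
  have sy: "(u, v) \<in> match_of X \<longleftrightarrow> (v, u) \<in> match_of X" for u v
    using match_of_matching[OF X] by (auto simp: matching_def dest: symD)
  have "sextet_arcs (a, int k) \<subseteq> match_of X \<longleftrightarrow> ((a, int k), (a + 1, int k)) \<in> match_of X \<and>
      ((a, int k + 1), (a + 1, int k + 1)) \<in> match_of X \<and> ((a + 2, int k + 1), (a + 2, int k)) \<in> match_of X"
    unfolding sextet_arcs_def Let_def fst_conv snd_conv insert_subset using sy by blast
  also have "((a, int k), (a + 1, int k)) \<in> match_of X \<longleftrightarrow> horiz X l a"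
  proof -
    have "lo l \<le> a" "a < hi l" using k l by (auto simp: lo_def hi_def)
    then show ?thesis using match_of_iff[OF l(2), of a "(a + 1, int l + 1)" X] l(1) by (simp add: add.commute)
  qed
  also have "((a, int k + 1), (a + 1, int k + 1)) \<in> match_of X \<longleftrightarrow> horiz X k a"
  proof -
    have "lo k \<le> a" "a < hi k" using k by (auto simp: lo_def hi_def)
    then show ?thesis using match_of_iff[OF k(2), of a "(a + 1, int k + 1)" X] by simp
  qed
  also have "((a + 2, int k + 1), (a + 2, int k)) \<in> match_of X \<longleftrightarrow> a + 2 \<in> X k"
    using match_of_iff[OF k(2), of "a + 2" "(a + 2, int k)" X] by simp
  also have "horiz X l a \<longleftrightarrow> drift X l a = int (\<delta> l) - 1" using k(5) l(1) by (simp add: horiz_def)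
  also have "horiz X k a \<longleftrightarrow> drift X k a = int (\<delta> k)" using k(5) by (simp add: horiz_def)
  finally show ?thesis using True by (auto simp: sextets_def l_def)
qed (auto simp: sextets_def)

lemma sum_matchings_interlacing:
  "(\<Sum>M | matching M. F (sextets M)) = (\<Sum>X | interlacing X. F (sextets (match_of X)))"
  by (rule sum.reindex_bij_witness[where i = match_of and j = rows_of])
    (auto simp: match_of_rows_of rows_of_match_of interlacing_rows_of match_of_matching)

end

section \<open>Interlacing rows as order-preserving maps\<close>

definition increasing :: "(nat \<Rightarrow> int) \<Rightarrow> nat \<Rightarrow> bool" where
  "increasing c p \<longleftrightarrow> (\<forall>i j. 1 \<le> i \<longrightarrow> i < j \<longrightarrow> j \<le> p \<longrightarrow> c i < c j)"

lemma increasing_Suc: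
  assumes "\<And>j. 1 \<le> j \<Longrightarrow> Suc j \<le> p \<Longrightarrow> c j < c (Suc j)"
  shows "increasing c p"
proof -
  have "c i < c j" if "1 \<le> i" "i < j" "j \<le> p" for i j
    using that(2,3)
  proof (induction j)
    case (Suc j)
    have "c j < c (Suc j)" using assms[of j] that(1) Suc.prems by simp
    then show ?case using Suc by (cases "i = j") auto
  qed simp
  then show ?thesis by (auto simp: increasing_def)
qed

lemma increasing_inj: "increasing c p \<Longrightarrow> inj_on c {1..p}"
  by (rule linorder_inj_onI) (auto simp: increasing_def dest: less_imp_neq)

lemma increasing_le_iff:
  assumes "increasing c p" "1 \<le> i" "i \<le> p" "1 \<le> j" "j \<le> p"
  shows "c i \<le> c j \<longleftrightarrow> i \<le> j"
proof (cases i j rule: linorder_cases)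
  case less
  then have "c i < c j" using assms by (simp add: increasing_def)
  then show ?thesis using less by simp
next
  case greater
  then have "c j < c i" using assms by (simp add: increasing_def)
  then show ?thesis using greater by simp
qed simp

lemma below_increasing:
  assumes c: "increasing c p"
  shows "\<exists>N\<le>p. below (c ` {1..p}) a = int N \<and> (\<forall>j. 1 \<le> j \<longrightarrow> j \<le> p \<longrightarrow> (c j \<le> a \<longleftrightarrow> j \<le> N))"
proof -
  let ?J = "{j \<in> {1..p}. c j \<le> a}"
  define N where "N = (if ?J = {} then 0 else Max ?J)"
  have fin: "finite ?J" by simp
  have iff: "c j \<le> a \<longleftrightarrow> j \<le> N" if j: "1 \<le> j" "j \<le> p" for j
  proof
    assume "c j \<le> a"
    then have "j \<in> ?J" using j by simp
    then show "j \<le> N" unfolding N_def using Max_ge[OF fin] by auto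
  next
    assume jN: "j \<le> N"
    then have "?J \<noteq> {}" using j by (auto simp: N_def split: if_splits)
    then have "N \<in> ?J" unfolding N_def using Max_in[OF fin] by simp
    then have "c j \<le> c N" "c N \<le> a" using increasing_le_iff[OF c] j jN by auto
    then show "c j \<le> a" by simp
  qed
  have Np: "N \<le> p"
  proof (cases "?J = {}")
    case False
    then have "N \<in> ?J" unfolding N_def using Max_in[OF fin] by simp
    then show ?thesis by simp
  qed (simp add: N_def)
  have "{x \<in> c ` {1..p}. x \<le> a} = c ` {1..N}" using iff Np by auto
  moreover have "inj_on c {1..N}" by (rule inj_on_subset[OF increasing_inj[OF c]]) (use Np in auto)
  ultimately have "below (c ` {1..p}) a = int N" by (simp add: below_def card_image)
  then show ?thesis using Np iff by blast
qed

lemma le_below_iff: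
  assumes "increasing c p" "j \<le> p"
  shows "int j \<le> below (c ` {1..p}) a \<longleftrightarrow> j = 0 \<or> c j \<le> a"
  using below_increasing[OF assms(1), of a] assms(2) by (cases "j = 0") auto

text \<open>
  At the position \<open>d j\<close> at least \<open>j\<close> elements of \<open>d\<close> are counted; conversely, the last element of \<open>d\<close>
  counted at \<open>a\<close> has a partner in \<open>c\<close> that is counted as well.
\<close>

lemma below_compare:
  assumes c: "increasing c p" and d: "increasing d q"
  shows "(\<forall>a. below (d ` {1..q}) a \<le> below (c ` {1..p}) a + int t) \<longleftrightarrow>
    (\<forall>j. t < j \<longrightarrow> j \<le> q \<longrightarrow> j - t \<le> p \<and> c (j - t) \<le> d j)"
proof
  assume l: "\<forall>a. below (d ` {1..q}) a \<le> below (c ` {1..p}) a + int t"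
  show "\<forall>j. t < j \<longrightarrow> j \<le> q \<longrightarrow> j - t \<le> p \<and> c (j - t) \<le> d j"
  proof (intro allI impI)
    fix j assume j: "t < j" "j \<le> q"
    obtain N where N: "N \<le> p" "below (c ` {1..p}) (d j) = int N"
      "\<And>i. 1 \<le> i \<Longrightarrow> i \<le> p \<Longrightarrow> (c i \<le> d j \<longleftrightarrow> i \<le> N)"
      using below_increasing[OF c] by blast
    have "int j \<le> below (d ` {1..q}) (d j)" using le_below_iff[OF d j(2)] by simp
    then have "j - t \<le> N" using l N(2) by (smt (verit) j(1) le_diff_conv of_nat_add of_nat_le_iff)
    then show "j - t \<le> p \<and> c (j - t) \<le> d j" using N j by auto
  qed
next
  assume r: "\<forall>j. t < j \<longrightarrow> j \<le> q \<longrightarrow> j - t \<le> p \<and> c (j - t) \<le> d j"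
  show "\<forall>a. below (d ` {1..q}) a \<le> below (c ` {1..p}) a + int t"
  proof
    fix a
    \<comment> \<open>The last element of the enumeration that is counted at \<open>a\<close>.\<close>
    obtain j where j: "j \<le> q" "below (d ` {1..q}) a = int j"
      using below_increasing[OF d, of a] by blast
    show "below (d ` {1..q}) a \<le> below (c ` {1..p}) a + int t"
    proof (cases "t < j")
      case True
      have "d j \<le> a" using le_below_iff[OF d j(1), of a] j(2) True by simp
      moreover have "j - t \<le> p" "c (j - t) \<le> d j" using r True j(1) by auto
      ultimately have "int (j - t) \<le> below (c ` {1..p}) a" using le_below_iff[OF c, of "j - t" a] by auto
      then show ?thesis using j(2) True by linarith
    next
      case False
      then show ?thesis using j(2) by (simp add: below_def)
    qed
  qed
qed

text \<open>
  The interface orders are non-negative as soon as a perfect matching exists, by \<open>card_rows_of\<close>.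
\<close>

locale kekulean_strip = strip +
  assumes surplus_nonneg: "k \<le> Suc m \<Longrightarrow> 0 \<le> surplus k"
begin

definition ord :: "nat \<Rightarrow> nat" where "ord k = nat (surplus k)"

lemma ord_eq: "k \<le> Suc m \<Longrightarrow> int (ord k) = surplus k"
  using surplus_nonneg by (simp add: ord_def)

lemma ord_ends: "ord 0 = 0" "ord m = 1" "ord (Suc m) = 0"
  by (simp_all add: ord_def surplus_ends)

lemma ord_Suc: "k \<le> m \<Longrightarrow> ord (Suc k) \<le> ord k + \<delta> k" "k \<le> m \<Longrightarrow> ord k \<le> ord (Suc k) + (1 - \<delta> k)"
  using surplus_Suc[of k] ord_eq[of k] ord_eq[of "Suc k"] delta_le[of k] by (auto split: if_splits)

lemma R_eq: "k \<le> Suc m \<Longrightarrow> R k = L k + 2 * (int n + int (ord k) - 1)"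
  using surplus_eq[of k] ord_eq[of k] by simp

definition P :: "(nat \<times> nat) set" where
  "P = {(k, j). 1 \<le> k \<and> k \<le> m \<and> 1 \<le> j \<and> j \<le> ord k}"

text \<open>
  The cover relation, with the position of the first interface bond expressed by \<open>\<delta>\<close>.
\<close>

definition C :: "(nat \<times> nat) rel" where
  "C = {((k, j), (k', j')). (k, j) \<in> P \<and> (k', j') \<in> P \<and>
     (k' = Suc k \<and> j' = j + \<delta> k \<or> k = Suc k' \<and> j' = j + (1 - \<delta> k'))}"

text \<open>
  The horizontal position of the \<open>j\<close>-th matched vertical edge of row \<open>k\<close> if \<open>g (k, j)\<close> unmatched ones
  precede it.
\<close>

definition position :: "(nat \<times> nat \<Rightarrow> nat) \<Rightarrow> nat \<Rightarrow> nat \<Rightarrow> int" where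
  "position g k j = L k + 2 * (int (g (k, j)) + int j - 1)"

definition rows_map :: "(nat \<times> nat \<Rightarrow> nat) \<Rightarrow> nat \<Rightarrow> int set" where
  "rows_map g k = position g k ` {j. (k, j) \<in> P}"

lemma in_P: "k \<le> Suc m \<Longrightarrow> (k, j) \<in> P \<longleftrightarrow> j \<in> {1..ord k}"
proof -
  assume "k \<le> Suc m"
  then consider "k = 0" | "k = Suc m" | "1 \<le> k" "k \<le> m" by linarith
  then show "(k, j) \<in> P \<longleftrightarrow> j \<in> {1..ord k}" by cases (auto simp: P_def ord_ends)
qed

lemma rows_map_eq: "rows_map g k = position g k ` {1..ord k}" if "k \<le> Suc m"
proof -
  have "{j. (k, j) \<in> P} = {1..ord k}" using in_P[OF that] by blast
  then show ?thesis by (simp only: rows_map_def)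
qed

lemma finite_P: "finite P"
  by (rule finite_subset[of _ "SIGMA k:{1..m}. {1..ord k}"]) (auto simp: P_def)

definition chain_ok :: "(nat \<times> nat \<Rightarrow> nat) \<Rightarrow> nat \<Rightarrow> bool" where
  "chain_ok g k \<longleftrightarrow>
     (\<forall>j. \<delta> k < j \<longrightarrow> j \<le> ord (Suc k) \<longrightarrow> g (k, j - \<delta> k) \<le> g (Suc k, j)) \<and>
     (\<forall>j. 1 - \<delta> k < j \<longrightarrow> j \<le> ord k \<longrightarrow> g (Suc k, j - (1 - \<delta> k)) \<le> g (k, j))"

lemma weak_iff_chain_ok:
  "(\<forall>x\<in>P. \<forall>y\<in>P. (x, y) \<in> C \<longrightarrow> g x \<le> g y) \<longleftrightarrow> (\<forall>k\<le>m. chain_ok g k)"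
proof
  assume l: "\<forall>x\<in>P. \<forall>y\<in>P. (x, y) \<in> C \<longrightarrow> g x \<le> g y"
  show "\<forall>k\<le>m. chain_ok g k"
    unfolding chain_ok_def
  proof (intro allI impI conjI)
    fix k j assume k: "k \<le> m" and j: "\<delta> k < j" "j \<le> ord (Suc k)"
    have "j - \<delta> k \<le> ord k" using ord_Suc(1)[OF k] j by simp
    then have "(k, j - \<delta> k) \<in> P" "(Suc k, j) \<in> P" using in_P k j by auto
    moreover from this have "((k, j - \<delta> k), (Suc k, j)) \<in> C" using j by (simp add: C_def)
    ultimately show "g (k, j - \<delta> k) \<le> g (Suc k, j)" using l by blast
  next
    fix k j assume k: "k \<le> m" and j: "1 - \<delta> k < j" "j \<le> ord k"
    have "j - (1 - \<delta> k) \<le> ord (Suc k)" using ord_Suc(2)[OF k] j by linarith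
    moreover have "1 \<le> j - (1 - \<delta> k)" using j by linarith
    ultimately have "(Suc k, j - (1 - \<delta> k)) \<in> P" "(k, j) \<in> P" using in_P k j by auto
    moreover from this have "((Suc k, j - (1 - \<delta> k)), (k, j)) \<in> C" using j by (simp add: C_def)
    ultimately show "g (Suc k, j - (1 - \<delta> k)) \<le> g (k, j)" using l by blast
  qed
next
  assume r: "\<forall>k\<le>m. chain_ok g k"
  show "\<forall>x\<in>P. \<forall>y\<in>P. (x, y) \<in> C \<longrightarrow> g x \<le> g y"
  proof (intro ballI impI)
    fix x y assume xy: "x \<in> P" "y \<in> P" "(x, y) \<in> C"
    obtain k j k' j' where e: "x = (k, j)" "y = (k', j')" by (cases x, cases y)
    have b: "1 \<le> j" "j \<le> ord k" "1 \<le> j'" "j' \<le> ord k'" "k \<le> m" "k' \<le> m" using xy e by (auto simp: P_def)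
    from xy(3) consider "k' = Suc k" "j' = j + \<delta> k" | "k = Suc k'" "j' = j + (1 - \<delta> k')"
      unfolding e by (auto simp: C_def)
    then show "g x \<le> g y"
    proof cases
      case 1
      then have "\<delta> k < j'" "j' \<le> ord (Suc k)" "j = j' - \<delta> k" using b by auto
      then show ?thesis using r b(5) 1(1) unfolding chain_ok_def e by blast
    next
      case 2
      then have "1 - \<delta> k' < j'" "j' \<le> ord k'" "j = j' - (1 - \<delta> k')" using b by auto
      then show ?thesis using r b(6) 2(1) unfolding chain_ok_def e by blast
    qed
  qed
qed

text \<open>
  Between two consecutive elements of row \<open>k\<close> there is an element of row \<open>Suc k\<close> in the poset order,
  because \<open>ord k\<close> exceeds \<open>ord (Suc k)\<close> by at most \<open>1 - \<delta> k\<close>.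
\<close>

lemma increasing_position:
  assumes "k \<le> m" "chain_ok g k"
  shows "increasing (position g k) (ord k)"
proof (rule increasing_Suc)
  fix j assume j: "1 \<le> j" "Suc j \<le> ord k"
  have "j + \<delta> k \<le> ord (Suc k)" using ord_Suc(2)[OF assms(1)] j delta_le[of k] by linarith
  then have "g (k, j) \<le> g (Suc k, j + \<delta> k)"
    using assms(2) j by (auto simp: chain_ok_def dest!: spec[of _ "j + \<delta> k"])
  moreover have "Suc j - (1 - \<delta> k) = j + \<delta> k" using delta_le[of k] by linarith
  then have "g (Suc k, j + \<delta> k) \<le> g (k, Suc j)"
    using assms(2) j unfolding chain_ok_def by (metis diff_le_self le_imp_less_Suc le_trans less_eq_Suc_le)
  ultimately show "position g k j < position g k (Suc j)" by (simp add: position_def)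
qed

text \<open>
  In both cases the difference of the positions is twice the difference of the values of \<open>g\<close>, plus one: a
  hexagon is two units wide and adjacent rows are shifted by one unit.
\<close>

lemma position_le_iff:
  assumes "k \<le> m"
  shows "\<delta> k < j \<Longrightarrow> position g k (j - \<delta> k) \<le> position g (Suc k) j \<longleftrightarrow> g (k, j - \<delta> k) \<le> g (Suc k, j)"
    and "1 - \<delta> k < j \<Longrightarrow> position g (Suc k) (j - (1 - \<delta> k)) \<le> position g k j \<longleftrightarrow> g (Suc k, j - (1 - \<delta> k)) \<le> g (k, j)"
    and "\<delta> k < j \<Longrightarrow> position g k (j - \<delta> k) \<le> position g (Suc k) j - 2 \<longleftrightarrow> g (k, j - \<delta> k) < g (Suc k, j)"
    and "1 - \<delta> k < j \<Longrightarrow> position g (Suc k) (j - (1 - \<delta> k)) \<le> position g k j - 2 \<longleftrightarrow> g (Suc k, j - (1 - \<delta> k)) < g (k, j)"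
  using L_Suc[OF assms] delta_le[of k] by (auto simp: position_def of_nat_diff)

lemma chain_ok_iff_drift:
  assumes k: "k \<le> m" and inc: "increasing (position g k) (ord k)" "increasing (position g (Suc k)) (ord (Suc k))"
  shows "chain_ok g k \<longleftrightarrow> (\<forall>a. drift (rows_map g) k a \<in> {int (\<delta> k) - 1, int (\<delta> k)})"
proof -
  have k': "k \<le> Suc m" "Suc k \<le> Suc m" using k by auto
  have "(\<forall>a. drift (rows_map g) k a \<in> {int (\<delta> k) - 1, int (\<delta> k)}) \<longleftrightarrow>
      (\<forall>a. below (position g (Suc k) ` {1..ord (Suc k)}) a \<le> below (position g k ` {1..ord k}) a + int (\<delta> k)) \<and>
      (\<forall>a. below (position g k ` {1..ord k}) a \<le> below (position g (Suc k) ` {1..ord (Suc k)}) a + int (1 - \<delta> k))"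
    unfolding drift_def rows_map_eq[OF k'(1)] rows_map_eq[OF k'(2)] all_conj_distrib[symmetric]
    by (rule all_cong1) (use delta_le[of k] in auto)
  also have "\<dots> \<longleftrightarrow> chain_ok g k"
  proof -
    have 1: "(\<delta> k < j \<longrightarrow> j \<le> ord (Suc k) \<longrightarrow> j - \<delta> k \<le> ord k \<and> position g k (j - \<delta> k) \<le> position g (Suc k) j) \<longleftrightarrow>
        (\<delta> k < j \<longrightarrow> j \<le> ord (Suc k) \<longrightarrow> g (k, j - \<delta> k) \<le> g (Suc k, j))" for j
      using ord_Suc(1)[OF k] position_le_iff(1)[OF k, of j g] by auto
    have 2: "(1 - \<delta> k < j \<longrightarrow> j \<le> ord k \<longrightarrow>
          j - (1 - \<delta> k) \<le> ord (Suc k) \<and> position g (Suc k) (j - (1 - \<delta> k)) \<le> position g k j) \<longleftrightarrow>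
        (1 - \<delta> k < j \<longrightarrow> j \<le> ord k \<longrightarrow> g (Suc k, j - (1 - \<delta> k)) \<le> g (k, j))" for j
      using ord_Suc(2)[OF k] position_le_iff(2)[OF k, of j g] by auto
    show ?thesis
      unfolding below_compare[OF inc] below_compare[OF inc(2,1)] chain_ok_def 1 2 ..
  qed
  finally show ?thesis by simp
qed

lemma increasing_position':
  assumes "\<forall>k\<le>m. chain_ok g k" "k \<le> Suc m"
  shows "increasing (position g k) (ord k)"
  using assms increasing_position by (cases "k = Suc m") (auto simp: ord_ends increasing_def)

lemma weak_maps_C: "g \<in> weak_maps C P n \<longleftrightarrow> g \<in> P \<rightarrow>\<^sub>E {0..n} \<and> (\<forall>k\<le>m. chain_ok g k)"
  unfolding weak_maps_def by (simp add: weak_iff_chain_ok)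

lemma rows_map_row:
  assumes "g \<in> P \<rightarrow>\<^sub>E {0..n}"
  shows "rows_map g k \<subseteq> row k"
proof
  fix c assume "c \<in> rows_map g k"
  then obtain j where j: "(k, j) \<in> P" "c = position g k j" by (auto simp: rows_map_def)
  then have k: "1 \<le> k" "k \<le> m" "1 \<le> j" "j \<le> ord k" "g (k, j) \<le> n" using assms by (auto simp: P_def PiE_iff)
  have "even (c + int k)" using L_even[of k] k j(2) by (simp add: position_def)
  moreover have "L k \<le> c" "c \<le> R k" using k R_eq[of k] j(2) by (auto simp: position_def)
  ultimately show "c \<in> row k" using k by (simp add: row_def)
qed

lemma interlacing_rows_map:
  assumes g: "g \<in> weak_maps C P n"
  shows "interlacing (rows_map g)"
  unfolding interlacing_def
proof (intro conjI allI impI)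
  have ok: "\<forall>k\<le>m. chain_ok g k" and gP: "g \<in> P \<rightarrow>\<^sub>E {0..n}" using g by (auto simp: weak_maps_C)
  note inc = increasing_position'[OF ok]
  show "rows_map g k \<subseteq> row k" for k by (rule rows_map_row[OF gP])
  show "int (card (rows_map g k)) = surplus k" if "k \<le> Suc m" for k
    using that increasing_inj[OF inc[OF that]] by (simp add: rows_map_eq card_image ord_eq)
  show "drift (rows_map g) k a \<in> {int (\<delta> k) - 1, int (\<delta> k)}" if k: "k \<le> m" for k a
    using chain_ok_iff_drift[OF k inc inc] k ok by simp
qed

lemma inj_rows_map: "inj_on rows_map (weak_maps C P n)"
proof (rule inj_onI)
  fix g h assume g: "g \<in> weak_maps C P n" and h: "h \<in> weak_maps C P n" and eq: "rows_map g = rows_map h"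
  have gP: "g \<in> P \<rightarrow>\<^sub>E {0..n}" "h \<in> P \<rightarrow>\<^sub>E {0..n}" and
    ok: "\<forall>k\<le>m. chain_ok g k" "\<forall>k\<le>m. chain_ok h k" using g h by (auto simp: weak_maps_C)
  show "g = h"
  proof (rule PiE_ext[OF gP])
    fix x assume x: "x \<in> P"
    obtain k j where e: "x = (k, j)" by (cases x)
    have k: "k \<le> Suc m" "1 \<le> j" "j \<le> ord k" using x e by (auto simp: P_def)
    have "position g k j \<le> a \<longleftrightarrow> position h k j \<le> a" for a
      using le_below_iff[OF increasing_position'[OF ok(1) k(1)] k(3), of a]
        le_below_iff[OF increasing_position'[OF ok(2) k(1)] k(3), of a] k
        rows_map_eq[OF k(1), of g] rows_map_eq[OF k(1), of h] eq by auto
    then have "position g k j = position h k j" by (meson order.antisym order.refl)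
    then show "g x = h x" by (simp add: position_def e)
  qed
qed

text \<open>
  Elements of a row are at least 2 apart, so the \<open>j\<close>-th element is at least \<open>2 * (j - 1)\<close> away from the
  left end and similarly from the right end; this bounds \<open>g (k, j)\<close> by \<open>n\<close>.
\<close>

lemma interlacing_enumeration:
  assumes X: "interlacing X" and k: "1 \<le> k" "k \<le> m"
  shows "\<exists>g. (\<forall>j\<in>{1..ord k}. g (k, j) \<le> n) \<and> increasing (position g k) (ord k) \<and> X k = position g k ` {1..ord k}"
proof -
  have sub: "X k \<subseteq> row k" using X by (simp add: interlacing_def)
  have fin: "finite (X k)" using sub finite_row finite_subset by blast
  have "int (card (X k)) = int (ord k)" using X k ord_eq[of k] by (simp add: interlacing_def)
  then have card: "card (X k) = ord k" by simp
  define h where "h = (!) (sorted_list_of_set (X k))"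
  have h: "bij_betw h {..<ord k} (X k)"
    unfolding h_def by (rule bij_betw_nth) (use fin card in auto)
  have mono: "h i < h j" if "i < j" "j < ord k" for i j
    using sorted_wrt_nth_less[OF strict_sorted_list_of_set[of "X k"] that(1)] that(2) card by (simp add: h_def)
  have hX: "h i \<in> row k" if "i < ord k" for i using h that sub by (auto simp: bij_betw_def)
  have bounds: "L k \<le> h i" "h i \<le> R k" "even (h i - L k)" if "i < ord k" for i
    using hX[OF that] k L_even[of k] by (auto simp: row_def)
  have step: "h i + 2 \<le> h (Suc i)" if "Suc i < ord k" for i
  proof -
    have "h i < h (Suc i)" using mono that by simp
    then show ?thesis using bounds(3)[of i] bounds(3)[of "Suc i"] that by presburger
  qed
  have low: "L k + 2 * int i \<le> h i" if "i < ord k" for i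
    using that
  proof (induction i)
    case 0
    then show ?case using bounds(1)[of 0] by simp
  next
    case (Suc i)
    then show ?case using step[of i] by simp
  qed
  have up: "h i + 2 * int d \<le> h (i + d)" if "i + d < ord k" for i d
    using that
  proof (induction d)
    case (Suc d)
    then show ?case using step[of "i + d"] by simp
  qed simp
  have high: "h i \<le> L k + 2 * (int n + int i)" if "i < ord k" for i
  proof -
    have "h i + 2 * int (ord k - 1 - i) \<le> R k" using up[of i "ord k - 1 - i"] bounds(2)[of "ord k - 1"] that by simp
    then show ?thesis using R_eq[of k] k that by (simp add: of_nat_diff)
  qed
  define g where "g p = nat ((h (snd p - 1) - L k) div 2 - int (snd p - 1))" for p :: "nat \<times> nat"
  have g: "position g k j = h (j - 1) \<and> g (k, j) \<le> n" if j: "j \<in> {1..ord k}" for j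
  proof -
    have i: "j - 1 < ord k" using j by auto
    define t where "t = (h (j - 1) - L k) div 2"
    have t: "h (j - 1) = L k + 2 * t" using bounds(3)[OF i] by (simp add: t_def)
    have "int (j - 1) \<le> t" "t \<le> int n + int (j - 1)" using low[OF i] high[OF i] t by auto
    then have "int (g (k, j)) = t - int (j - 1)" "g (k, j) \<le> n" unfolding g_def snd_conv t_def[symmetric] by auto
    then show ?thesis using t j by (auto simp: position_def of_nat_diff)
  qed
  have "increasing (position g k) (ord k)"
    unfolding increasing_def
  proof (intro allI impI)
    fix i j :: nat assume ij: "1 \<le> i" "i < j" "j \<le> ord k"
    then have "h (i - 1) < h (j - 1)" by (intro mono) auto
    then show "position g k i < position g k j" using g[of i] g[of j] ij by simp
  qed
  moreover have "X k = position g k ` {1..ord k}"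
  proof -
    have "position g k ` {1..ord k} = (\<lambda>j. h (j - 1)) ` {1..ord k}"
      by (rule image_cong) (use g in auto)
    also have "\<dots> = h ` ((\<lambda>j. j - 1) ` {1..ord k})" by (simp add: image_image)
    also have "(\<lambda>j. j - 1) ` {1..ord k} = {..<ord k}"
      by (auto simp: image_iff intro!: bexI[of _ "Suc _"])
    finally show ?thesis using h by (simp add: bij_betw_def)
  qed
  ultimately show ?thesis using g by (intro exI[of _ g]) auto
qed

lemma interlacing_is_rows_map:
  assumes X: "interlacing X"
  shows "\<exists>g\<in>weak_maps C P n. X = rows_map g"
proof -
  have sub: "\<And>k. X k \<subseteq> row k" using X by (simp add: interlacing_def)
  have "\<forall>k\<in>{1..m}. \<exists>g. (\<forall>j\<in>{1..ord k}. g (k, j) \<le> n) \<and> increasing (position g k) (ord k) \<and>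
      X k = position g k ` {1..ord k}"
    using interlacing_enumeration[OF X] by auto
  from bchoice[OF this] obtain G where G: "\<And>k. k \<in> {1..m} \<Longrightarrow> (\<forall>j\<in>{1..ord k}. G k (k, j) \<le> n) \<and>
      increasing (position (G k) k) (ord k) \<and> X k = position (G k) k ` {1..ord k}"
    by blast
  define g where "g = restrict (\<lambda>(k, j). G k (k, j)) P"
  have gG: "g (k, j) = G k (k, j)" if "k \<in> {1..m}" "j \<in> {1..ord k}" for k j
    using that by (simp add: g_def P_def)
  have gP: "g \<in> P \<rightarrow>\<^sub>E {0..n}"
  proof (rule PiE_I)
    fix x assume x: "x \<in> P"
    obtain k j where e: "x = (k, j)" by (cases x)
    then have kj: "k \<in> {1..m}" "j \<in> {1..ord k}" using x by (auto simp: P_def)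
    then have "G k (k, j) \<le> n" using G[OF kj(1)] by blast
    then show "g x \<in> {0..n}" using gG[OF kj] e by simp
  qed (simp add: g_def)
  have eq: "X k = rows_map g k" for k
  proof (cases "k \<in> {1..m}")
    case True
    have "rows_map g k = position g k ` {1..ord k}" using True by (intro rows_map_eq) auto
    also have "\<dots> = X k" using G[OF True] gG[OF True] by (auto simp: position_def)
    finally show ?thesis ..
  next
    case False
    then have "row k = {}" by (auto simp: row_def)
    then show ?thesis using sub rows_map_row[OF gP, of k] by auto
  qed
  then have XG: "X = rows_map g" by auto
  have inc: "increasing (position g k) (ord k)" if "k \<le> Suc m" for k
  proof (cases "k \<in> {1..m}")
    case True
    then show ?thesis using G[OF True] gG[OF True] by (auto simp: increasing_def position_def)
  next
    case False
    then have "ord k = 0" using that ord_ends by (cases "k = 0") (auto simp: le_Suc_eq)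
    then show ?thesis by (simp add: increasing_def)
  qed
  have "chain_ok g k" if k: "k \<le> m" for k
    using chain_ok_iff_drift[OF k inc inc] X k unfolding XG interlacing_def by auto
  then have "g \<in> weak_maps C P n" using gP by (simp add: weak_maps_C)
  then show ?thesis using XG by blast
qed

text \<open>
  For the \<open>j\<close>-th matched edge of row \<open>k\<close>, the two horizontal sextet edges are present if and only if the
  predecessors in the rows \<open>k - 1\<close> and \<open>Suc k\<close> lie strictly further left than the place to which the
  edge would move, that is, have smaller values of \<open>g\<close>. For \<open>j = 1\<close>, positivity of \<open>g (k, j)\<close> says that
  the row has a hexagon to the left of the edge; for \<open>j > 1\<close> it follows from the predecessor in row \<open>k - 1\<close>.
\<close>

lemma sextet_iff_rise:
  assumes g: "g \<in> weak_maps C P n" and x: "(k, j) \<in> P"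
  shows "(position g k j - 2, int k) \<in> sextets (match_of (rows_map g)) \<longleftrightarrow> (k, j) \<in> rises C P g"
proof -
  let ?X = "rows_map g"
  have ok: "\<forall>k\<le>m. chain_ok g k" and gP: "g \<in> P \<rightarrow>\<^sub>E {0..n}" using g by (auto simp: weak_maps_C)
  note fam = interlacing_rows_map[OF g]
  note inc = increasing_position'[OF ok]
  define c where "c = position g k j"
  have k: "1 \<le> k" "k \<le> m" "1 \<le> j" "j \<le> ord k" using x by (auto simp: P_def)
  define l where "l = k - 1"
  let ?U = "\<delta> l < j \<longrightarrow> g (l, j - \<delta> l) < g (k, j)" and ?D = "1 - \<delta> k < j \<longrightarrow> g (Suc k, j - (1 - \<delta> k)) < g (k, j)"
  have l: "k = Suc l" "l \<le> m" "l \<le> Suc m" using k by (auto simp: l_def)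
  have k': "k \<le> Suc m" "Suc k \<le> Suc m" using k by auto
  have B: "int i \<le> below (?X r) a \<longleftrightarrow> i = 0 \<or> position g r i \<le> a" if "r \<le> Suc m" "i \<le> ord r" for r i a
    unfolding rows_map_eq[OF that(1)] by (rule le_below_iff[OF inc[OF that(1)] that(2)])
  have crow: "c \<in> row k" using rows_map_row[OF gP, of k] rows_map_eq[OF k'(1)] k unfolding c_def by auto
  have H: "(c - 2, int k) \<in> H \<longleftrightarrow> 2 \<le> g (k, j) + j"
    using crow k by (auto simp: H_eq row_def c_def position_def)
  have mem: "c - 2 + 2 \<in> ?X k" using rows_map_eq[OF k'(1)] k unfolding c_def by auto
  have bk: "below (?X k) (c - 2) = int j - 1"
  proof -
    have "\<not> int j \<le> below (?X k) (c - 2)" using B[OF k'(1) k(4), of "c - 2"] k(3) by (simp add: c_def)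
    moreover have "int (j - 1) \<le> below (?X k) (c - 2)"
    proof (cases "j = 1")
      case False
      then have "position g k (j - 1) < position g k j" using inc[OF k'(1)] k by (simp add: increasing_def)
      then have "position g k (j - 1) \<le> c - 2" unfolding c_def position_def by presburger
      then show ?thesis using B[OF k'(1), of "j - 1" "c - 2"] k by simp
    qed (simp add: below_def)
    ultimately show ?thesis using k(3) by linarith
  qed
  have up: "drift ?X l (c - 2) = int (\<delta> l) - 1 \<longleftrightarrow> ?U"
  proof -
    have "drift ?X l (c - 2) \<in> {int (\<delta> l) - 1, int (\<delta> l)}" using fam l by (auto simp: interlacing_def)
    then have "drift ?X l (c - 2) = int (\<delta> l) - 1 \<longleftrightarrow> int (j - \<delta> l) \<le> below (?X l) (c - 2)"
      using bk l(1) k(3) delta_le[of l] by (auto simp: drift_def of_nat_diff)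
    also have "\<dots> \<longleftrightarrow> j - \<delta> l = 0 \<or> position g l (j - \<delta> l) \<le> c - 2"
      using B[OF l(3), of "j - \<delta> l" "c - 2"] ord_Suc(1)[OF l(2)] k(4) unfolding l(1) by simp
    also have "\<dots> \<longleftrightarrow> ?U"
      using position_le_iff(3)[OF l(2), of j g] unfolding c_def l(1) by (cases "\<delta> l < j") auto
    finally show ?thesis .
  qed
  have down: "drift ?X k (c - 2) = int (\<delta> k) \<longleftrightarrow> ?D"
  proof -
    have "drift ?X k (c - 2) \<in> {int (\<delta> k) - 1, int (\<delta> k)}" using fam k by (auto simp: interlacing_def)
    then have "drift ?X k (c - 2) = int (\<delta> k) \<longleftrightarrow> int (j - (1 - \<delta> k)) \<le> below (?X (Suc k)) (c - 2)"
      using bk k(3) delta_le[of k] by (auto simp: drift_def of_nat_diff)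
    also have "\<dots> \<longleftrightarrow> j - (1 - \<delta> k) = 0 \<or> position g (Suc k) (j - (1 - \<delta> k)) \<le> c - 2"
      using B[OF k'(2), of "j - (1 - \<delta> k)" "c - 2"] ord_Suc(2)[OF k(2)] k(4) by simp
    also have "\<dots> \<longleftrightarrow> ?D"
      using position_le_iff(4)[OF k(2), of j g] unfolding c_def by (cases "1 - \<delta> k < j") auto
    finally show ?thesis .
  qed
  have preds: "(\<forall>x\<in>P. (x, (k, j)) \<in> C \<longrightarrow> g x < g (k, j)) \<longleftrightarrow>
      ?U \<and> ?D"
  proof -
    have 1: "(l, j - \<delta> l) \<in> P" if "\<delta> l < j"
    proof -
      have "1 \<le> j - \<delta> l" "j - \<delta> l \<le> ord l"
        using that ord_Suc(1)[OF l(2)] k(4) unfolding l(1) by linarith+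
      then show ?thesis using in_P[OF l(3)] by simp
    qed
    have 2: "(Suc k, j - (1 - \<delta> k)) \<in> P" if "1 - \<delta> k < j"
    proof -
      have "1 \<le> j - (1 - \<delta> k)" "j - (1 - \<delta> k) \<le> ord (Suc k)" using that ord_Suc(2)[OF k(2)] k(4) by linarith+
      then show ?thesis using in_P[OF k'(2)] by simp
    qed
    have "(y, (k, j)) \<in> C \<longleftrightarrow> (\<delta> l < j \<and> y = (l, j - \<delta> l)) \<or> (1 - \<delta> k < j \<and> y = (Suc k, j - (1 - \<delta> k)))"
      if "y \<in> P" for y
    proof -
      obtain k1 j1 where y: "y = (k1, j1)" by (cases y)
      have "1 \<le> j1" using that y by (simp add: P_def)
      then show ?thesis using that x unfolding y C_def l(1) by auto
    qed
    then show ?thesis using 1 2 by auto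
  qed
  have "(c - 2, int k) \<in> sextets (match_of ?X) \<longleftrightarrow> 2 \<le> g (k, j) + j \<and>
      ?U \<and> ?D"
    unfolding sextets_match_of[OF fam] H l_def[symmetric] up down using mem by simp
  also have "\<dots> \<longleftrightarrow> 1 \<le> g (k, j) \<and>
      ?U \<and> ?D"
  proof (cases "j = 1")
    case False
    then have "\<delta> l < j" using delta_le[of l] k(3) by linarith
    then show ?thesis using False k(3) by auto
  qed auto
  also have "\<dots> \<longleftrightarrow> (k, j) \<in> rises C P g" unfolding rises_def using preds x by auto
  finally show ?thesis by (simp add: c_def)
qed

lemma card_sextets_eq_card_rises:
  assumes g: "g \<in> weak_maps C P n"
  shows "card (sextets (match_of (rows_map g))) = card (rises C P g)"
proof (rule bij_betw_same_card[symmetric])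
  have ok: "\<forall>k\<le>m. chain_ok g k" using g by (auto simp: weak_maps_C)
  let ?f = "\<lambda>(k, j). (position g k j - 2, int k)"
  show "bij_betw ?f (rises C P g) (sextets (match_of (rows_map g)))"
  proof (rule bij_betw_imageI)
    show "inj_on ?f (rises C P g)"
    proof (rule inj_onI)
      fix x y assume xy: "x \<in> rises C P g" "y \<in> rises C P g" "?f x = ?f y"
      obtain k i j where e: "x = (k, i)" "y = (k, j)" "position g k i = position g k j"
        using xy(3) by (cases x, cases y) auto
      have k: "k \<le> Suc m" "i \<in> {1..ord k}" "j \<in> {1..ord k}" using xy e by (auto simp: rises_def P_def)
      then show "x = y" using inj_onD[OF increasing_inj[OF increasing_position'[OF ok k(1)]] e(3)] e by simp
    qed
    show "?f ` rises C P g = sextets (match_of (rows_map g))"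
    proof (intro set_eqI iffI)
      fix h assume "h \<in> ?f ` rises C P g"
      then obtain k j where "(k, j) \<in> rises C P g" "h = (position g k j - 2, int k)" by auto
      then show "h \<in> sextets (match_of (rows_map g))"
        using sextet_iff_rise[OF g, of k j] by (auto simp: rises_def)
    next
      fix h assume h: "h \<in> sextets (match_of (rows_map g))"
      then have "h \<in> H" unfolding sextets_def by blast
      then obtain a k where e: "h = (a, int k)" using H_eq by blast
      have "a + 2 \<in> rows_map g k" using h sextets_match_of[OF interlacing_rows_map[OF g]] unfolding e by blast
      then obtain j where j: "(k, j) \<in> P" "a = position g k j - 2" by (auto simp: rows_map_def)
      then have "(k, j) \<in> rises C P g" using sextet_iff_rise[OF g j(1)] h e by simp
      then show "h \<in> ?f ` rises C P g" using e j(2) by force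
    qed
  qed
qed

lemma sum_matchings_weak_maps:
  fixes x :: "'a :: comm_semiring_1"
  shows "(\<Sum>M | matching M. x ^ card (sextets M)) = (\<Sum>g\<in>weak_maps C P n. x ^ card (rises C P g))"
proof -
  have "bij_betw rows_map (weak_maps C P n) {X. interlacing X}"
    unfolding bij_betw_def using inj_rows_map interlacing_rows_map interlacing_is_rows_map by auto
  from sum.reindex_bij_betw[OF this, of "\<lambda>X. x ^ card (sextets (match_of X))"]
  have "(\<Sum>X | interlacing X. x ^ card (sextets (match_of X)))
      = (\<Sum>g\<in>weak_maps C P n. x ^ card (sextets (match_of (rows_map g))))" by simp
  then show ?thesis using sum_matchings_interlacing[of "\<lambda>S. x ^ card S"] card_sextets_eq_card_rises by simp
qed

end

section \<open>The poset of a strip and the theorem\<close>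

lemma weak_maps_trancl:
  assumes "C \<subseteq> P \<times> P"
  shows "weak_maps (C\<^sup>+) P n = weak_maps C P n"
proof -
  have "g x \<le> g y" if "\<forall>x\<in>P. \<forall>y\<in>P. (x, y) \<in> C \<longrightarrow> g x \<le> g y" "(x, y) \<in> C\<^sup>+" for g :: "'a \<Rightarrow> nat" and x y
    using that(2)
  proof (induction rule: trancl_induct)
    case (base y)
    then show ?case using that(1) assms by blast
  next
    case (step y z)
    then have "g y \<le> g z" using that(1) assms by blast
    then show ?case using step by simp
  qed
  then show ?thesis unfolding weak_maps_def by blast
qed

lemma rises_trancl:
  assumes "C \<subseteq> P \<times> P" "g \<in> weak_maps C P n"
  shows "rises (C\<^sup>+) P g = rises C P g"
proof -
  have "g x < g y" if "\<forall>x\<in>P. (x, y) \<in> C \<longrightarrow> g x < g y" "(x, y) \<in> C\<^sup>+" for x y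
  proof -
    from that(2) obtain z where z: "(x, z) \<in> C\<^sup>*" "(z, y) \<in> C" by (meson tranclD2)
    then have "z \<in> P" using assms(1) by blast
    then have "g z < g y" using that(1) z by blast
    moreover have "g x \<le> g z" using z(1)
    proof (induction rule: rtrancl_induct)
      case (step v w)
      then have "g v \<le> g w" using assms unfolding weak_maps_def by blast
      then show ?case using step by simp
    qed simp
    ultimately show ?thesis by simp
  qed
  then show ?thesis unfolding rises_def by blast
qed

context strip
begin

lemma interface_eq: "interface H k = {((c, int k), (c, int k + 1)) | c. c \<in> row k}"
proof -
  have "(\<exists>a. (a, int k) \<in> H \<and> (c = a \<or> c = a + 2)) \<longleftrightarrow> c \<in> row k" for c
  proof
    assume "\<exists>a. (a, int k) \<in> H \<and> (c = a \<or> c = a + 2)"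
    then show "c \<in> row k" by (auto simp: H_eq row_def)
  next
    assume c: "c \<in> row k"
    then have k: "1 \<le> k" "k \<le> m" "L k \<le> c" "c \<le> R k" "even (c + int k)"
      by (auto simp: row_def split: if_splits)
    define a where "a = (if c + 2 \<le> R k then c else c - 2)"
    have ev: "even (c - L k)" "even (R k - c)" using k(5) L_even[of k] R_even[of k] k(2) by auto
    have "L k \<le> a" "a + 2 \<le> R k" "even (a + int k)"
      using k width[OF k(1,2)] ev unfolding a_def by (auto; presburger)+
    then have "(a, int k) \<in> H" using k by (auto simp: H_eq)
    moreover have "c = a \<or> c = a + 2" by (simp add: a_def)
    ultimately show "\<exists>a. (a, int k) \<in> H \<and> (c = a \<or> c = a + 2)" by blast
  qed
  then show ?thesis unfolding interface_def by simp
qed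

lemma card_row: "1 \<le> k \<Longrightarrow> k \<le> m \<Longrightarrow> int (card (row k)) = surplus k + int n"
proof -
  assume k: "1 \<le> k" "k \<le> m"
  define N where "N = nat ((R k - L k) div 2 + 1)"
  have R: "R k = L k + 2 * (int N - 1)"
    using surplus_eq[of k] width[OF k] k unfolding N_def surplus_def by simp
  have "row k = (\<lambda>i. L k + 2 * int i) ` {..<N}"
  proof (intro set_eqI iffI)
    fix c assume "c \<in> row k"
    then have c: "L k \<le> c" "c \<le> R k" "even (c - L k)" using k L_even[of k] by (auto simp: row_def)
    define i where "i = nat ((c - L k) div 2)"
    have "c = L k + 2 * int i" "i < N" using c R by (auto simp: i_def)
    then show "c \<in> (\<lambda>i. L k + 2 * int i) ` {..<N}" by blast
  next
    fix c assume "c \<in> (\<lambda>i. L k + 2 * int i) ` {..<N}"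
    then show "c \<in> row k" using k R L_even[of k] by (auto simp: row_def)
  qed
  moreover have "inj_on (\<lambda>i. L k + 2 * int i) {..<N}" by (rule inj_onI) simp
  ultimately have "card (row k) = N" by (simp add: card_image)
  moreover have "int N = surplus k + int n" using width[OF k] by (simp add: N_def surplus_def)
  ultimately show ?thesis by simp
qed

lemma interface_ord_eq: "1 \<le> k \<Longrightarrow> k \<le> m \<Longrightarrow> interface_ord n H k = surplus k"
proof -
  assume k: "1 \<le> k" "k \<le> m"
  have "interface H k = (\<lambda>c. ((c, int k), (c, int k + 1))) ` row k" unfolding interface_eq by auto
  moreover have "inj_on (\<lambda>c. ((c, int k), (c, int k + 1))) (row k)" by (rule inj_onI) simp
  ultimately have "card (interface H k) = card (row k)" by (simp add: card_image)
  then show ?thesis using card_row[OF k] by (simp add: interface_ord_def)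
qed

text \<open>
  The leftmost bonds of the two rows have different positions, so the minimum is attained only once.
\<close>

lemma first_interface_bond_mem:
  assumes k: "1 \<le> k" "Suc k \<le> m"
  shows "first_interface_bond H (Suc k) \<in> interface H k \<longleftrightarrow> \<delta> k = 0"
    and "first_interface_bond H (Suc k) \<in> interface H (Suc k) \<longleftrightarrow> \<delta> k = 1"
proof -
  let ?B = "interface_bonds H (Suc k)"
  let ?e = "first_interface_bond H (Suc k)"
  have B: "?B = interface H k \<union> interface H (Suc k)" by (simp add: interface_bonds_def)
  have Lrow: "L k \<in> row k" "L (Suc k) \<in> row (Suc k)"
    using k L_even[of k] L_even[of "Suc k"] width[of k] width[of "Suc k"] by (auto simp: row_def)
  have mem: "((L k, int k), (L k, int k + 1)) \<in> ?B" "((L (Suc k), int (Suc k)), (L (Suc k), int (Suc k) + 1)) \<in> ?B"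
    unfolding B interface_eq using Lrow by blast+
  have pos: "horizontal_pos e \<ge> (if \<delta> k = 1 then L (Suc k) else L k)" if "e \<in> ?B" for e
    using that L_Suc[of k] delta_le[of k] k unfolding B interface_eq by (auto simp: horizontal_pos_def row_def)
  have "\<exists>e. is_arg_min horizontal_pos (\<lambda>x. x \<in> ?B) e"
  proof (cases "\<delta> k = 1")
    case True
    then show ?thesis using mem(2) pos unfolding is_arg_min_linorder
      by (intro exI[of _ "((L (Suc k), int (Suc k)), (L (Suc k), int (Suc k) + 1))"]) (auto simp: horizontal_pos_def)
  next
    case False
    then show ?thesis using mem(1) pos unfolding is_arg_min_linorder
      by (intro exI[of _ "((L k, int k), (L k, int k + 1))"]) (auto simp: horizontal_pos_def)
  qed
  then have "is_arg_min horizontal_pos (\<lambda>x. x \<in> ?B) ?e"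
    unfolding first_interface_bond_def arg_min_on_def arg_min_def by (rule someI_ex)
  then have e: "?e \<in> ?B" "\<And>x. x \<in> ?B \<Longrightarrow> horizontal_pos ?e \<le> horizontal_pos x"
    by (auto simp: is_arg_min_linorder)
  have le: "horizontal_pos ?e \<le> L k" "horizontal_pos ?e \<le> L (Suc k)"
    using e(2)[OF mem(1)] e(2)[OF mem(2)] by (simp_all add: horizontal_pos_def)
  have k1: "?e \<in> interface H k \<Longrightarrow> L k \<le> horizontal_pos ?e"
    and k2: "?e \<in> interface H (Suc k) \<Longrightarrow> L (Suc k) \<le> horizontal_pos ?e"
    by (auto simp: interface_eq horizontal_pos_def row_def split: if_splits)
  have "L (Suc k) = L k + 1 - 2 * int (\<delta> k)" using L_Suc k by simp
  then have "?e \<in> interface H k \<Longrightarrow> \<delta> k = 0" "?e \<in> interface H (Suc k) \<Longrightarrow> \<delta> k = 1"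
    using k1 k2 le delta_le[of k] by linarith+
  moreover have "?e \<in> interface H k \<or> ?e \<in> interface H (Suc k)" using e(1) B by blast
  ultimately show "?e \<in> interface H k \<longleftrightarrow> \<delta> k = 0" "?e \<in> interface H (Suc k) \<longleftrightarrow> \<delta> k = 1" by auto
qed

end

context kekulean_strip
begin

lemma strip_poset_eq: "strip_poset m n H = P"
proof -
  have "int j \<le> interface_ord n H k \<longleftrightarrow> j \<le> ord k" if "1 \<le> k" "k \<le> m" for k j
    using interface_ord_eq[OF that] ord_eq[of k] that by linarith
  then show ?thesis unfolding strip_poset_def P_def by blast
qed

text \<open>
  Either row of a cover may have the smaller index; these are the two disjuncts of \<open>C\<close>.
\<close>

lemma strip_covers_eq: "strip_covers m n H = C"
proof -
  have "(let e = first_interface_bond H (max k k') in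
           (e \<in> interface H k \<and> int j' - int j = 0) \<or> (e \<in> interface H k' \<and> int j' - int j = 1)) \<and>
        \<bar>int k' - int k\<bar> = 1 \<longleftrightarrow> k' = Suc k \<and> j' = j + \<delta> k \<or> k = Suc k' \<and> j' = j + (1 - \<delta> k')"
    if "(k, j) \<in> P" "(k', j') \<in> P" for k j k' j'
  proof -
    have b: "1 \<le> k" "k \<le> m" "1 \<le> k'" "k' \<le> m" using that by (auto simp: P_def)
    consider "k' = Suc k" | "k = Suc k'" | "k' \<noteq> Suc k" "k \<noteq> Suc k'" by blast
    then show ?thesis
    proof cases
      case 1
      then show ?thesis
        using first_interface_bond_mem[of k] b delta_le[of k] by (auto simp: Let_def)
    next
      case 2
      then show ?thesis
        using first_interface_bond_mem[of k'] b delta_le[of k'] by (auto simp: Let_def)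
    next
      case 3
      then show ?thesis by auto
    qed
  qed
  then show ?thesis unfolding strip_covers_def strip_poset_eq C_def by blast
qed

lemma C_sub: "C \<subseteq> P \<times> P" by (auto simp: C_def)

lemma zz_poly_weak_maps:
  assumes "\<exists>K. clar_cover (hexagons_graph H) K"
  shows "zz_poly (hexagons_graph H) =
    (\<Sum>g\<in>weak_maps (strip_less m n H) (strip_poset m n H) n.
       [:1, 1:] ^ card (rises (strip_less m n H) (strip_poset m n H) g))"
  unfolding zz_poly_matchings[OF assms] sum_matchings_weak_maps strip_less_def strip_covers_eq strip_poset_eq
    weak_maps_trancl[OF C_sub]
  by (rule sum.cong) (simp_all add: rises_trancl[OF C_sub])

end

lemma regular_strip_strip:
  assumes "regular_strip m n H"
  shows "\<exists>L R. strip m n L R H"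
proof -
  from assms obtain l :: "nat \<Rightarrow> int" and len :: "nat \<Rightarrow> nat" where m: "1 \<le> m"
    and row: "\<forall>k\<in>{1..m}. 1 \<le> len k \<and> even (l k + int k)"
    and step: "\<forall>k\<in>{1..<m}. \<bar>l (k + 1) - l k\<bar> = 1 \<and>
        \<bar>l (k + 1) + 2 * int (len (k + 1)) - (l k + 2 * int (len k))\<bar> = 1"
    and ends: "len 1 = n" "len m = n"
    and H: "H = (\<Union>k\<in>{1..m}. one_tier_strip (int k) (l k) (len k))"
    unfolding regular_strip_def Let_def by blast
  define r where "r k = l k + 2 * int (len k)" for k
  define L where "L k = (if k = 0 then l 1 + 1 else if k = Suc m then l m + 1 else l k)" for k
  define R where "R k = (if k = 0 then r 1 - 1 else if k = Suc m then r m - 1 else r k)" for k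
  have LR: "L k = l k" "R k = r k" if "1 \<le> k" "k \<le> m" for k using that by (auto simp: L_def R_def)
  have l_even: "even (l k + int k)" if "1 \<le> k" "k \<le> m" for k using row that by auto
  have "strip m n L R H"
  proof
    show "1 \<le> m" by fact
    fix k assume k: "k \<le> Suc m"
    then consider "k = 0" | "k = Suc m" | "1 \<le> k" "k \<le> m" by linarith
    then show "even (L k + int k)" "even (R k + int k)"
      using l_even[of 1] l_even[of m] l_even[of k] m by (cases; auto simp: L_def R_def r_def)+
  next
    fix k assume k: "k \<le> m"
    have s: "\<bar>l (Suc k) - l k\<bar> = 1 \<and> \<bar>r (Suc k) - r k\<bar> = 1" if "1 \<le> k" "Suc k \<le> m"
      using step[rule_format, of k] that by (simp add: r_def)
    consider "k = 0" | "k = m" "1 \<le> k" | "1 \<le> k" "Suc k \<le> m" using k by linarith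
    then show "\<bar>L (Suc k) - L k\<bar> = 1" "\<bar>R (Suc k) - R k\<bar> = 1"
      using s m by (cases; auto simp: L_def R_def)+
  next
    fix k assume k: "1 \<le> k" "k \<le> m"
    then show "L k + 2 \<le> R k" using row LR[OF k] by (auto simp: r_def)
  next
    show "L 0 = L 1 + 1" "R 0 = R 1 - 1" "L (Suc m) = L m + 1" "R (Suc m) = R m - 1"
      using m by (auto simp: L_def R_def)
    show "R 1 - L 1 = 2 * int n" "R m - L m = 2 * int n" using m ends by (auto simp: LR r_def)
  next
    have tier: "one_tier_strip (int k) (l k) (len k) =
        {(a, int k) | a. L k \<le> a \<and> a + 2 \<le> R k \<and> even (a + int k)}" if k: "k \<in> {1..m}" for k
    proof (intro set_eqI iffI)
      fix h assume "h \<in> one_tier_strip (int k) (l k) (len k)"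
      then obtain j where j: "h = (l k + 2 * int j, int k)" "j < len k" by (auto simp: one_tier_strip_def)
      then show "h \<in> {(a, int k) | a. L k \<le> a \<and> a + 2 \<le> R k \<and> even (a + int k)}"
        using k l_even[of k] LR[of k] by (auto simp: r_def)
    next
      fix h assume "h \<in> {(a, int k) | a. L k \<le> a \<and> a + 2 \<le> R k \<and> even (a + int k)}"
      then obtain a where a: "h = (a, int k)" "l k \<le> a" "a + 2 \<le> r k" "even (a + int k)"
        using k LR[of k] by auto
      define j where "j = nat ((a - l k) div 2)"
      have "even (a - l k)" using a(4) l_even[of k] k by auto
      then have "a = l k + 2 * int j" "j < len k" using a(2,3) by (auto simp: j_def r_def)
      then show "h \<in> one_tier_strip (int k) (l k) (len k)" using a(1) by (auto simp: one_tier_strip_def)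
    qed
    show "H = {(a, int k) | a k. 1 \<le> k \<and> k \<le> m \<and> L k \<le> a \<and> a + 2 \<le> R k \<and> even (a + int k)}"
      unfolding H using tier by auto
  qed
  then show ?thesis by blast
qed

theorem mainTheorem2:
  fixes m n :: nat and H :: "hexagon set" and \<omega> :: "nat \<times> nat \<Rightarrow> nat"
  defines "P \<equiv> strip_poset m n H"
    and "r \<equiv> strip_less m n H"
  assumes "regular_strip m n H"
    and "\<exists>K. kekule_structure (hexagons_graph H) K"
    and "order_pres_bij P r \<omega>"
  shows "zz_poly (hexagons_graph H) =
    (\<Sum>k = 0..card P. \<Sum>w\<in>linext_words P r \<omega>.
       of_nat (binom (card P - fix_count P r \<omega> w) (int k - int (fix_count P r \<omega> w))
               * ((n + des w) choose k)) * [:1, 1:] ^ k)"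
proof -
  obtain L R where "strip m n L R H" using regular_strip_strip[OF assms(3)] by blast
  then interpret S: strip m n L R H .
  obtain K where K: "clar_cover (hexagons_graph H) K" using assms(4) by (auto simp: kekule_structure_def)
  then have "S.local_cover (parcs K)" using S.clar_cover_iff by blast
  then have M: "S.matching (S.matching_of (parcs K))" by (rule S.matching_of_matching)
  interpret S: kekulean_strip m n L R H
  proof
    show "0 \<le> S.surplus k" if "k \<le> Suc m" for k using S.card_rows_of[OF M that] by simp
  qed
  interpret labelled_poset P r \<omega>
  proof
    show "finite P" unfolding P_def S.strip_poset_eq by (rule S.finite_P)
    show "trans r" unfolding r_def strip_less_def by (rule trans_trancl)
    show "r \<subseteq> P \<times> P"
      unfolding r_def P_def strip_less_def S.strip_covers_eq S.strip_poset_eq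
      by (rule trancl_subset_Sigma[OF S.C_sub])
    show "order_pres_bij P r \<omega>" by fact
  qed
  show ?thesis
    using S.zz_poly_weak_maps K sum_weak_maps_words[of "[:1, 1 :: int:]" n] unfolding P_def r_def by auto
qed

end
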